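(* Let $n\ge1$, let $E=E_{n+1}=L(\mathfrak g)\oplus\mathcal C\oplus\mathcal D$ be an (untwisted) fgc extended affine Lie algebra of nullity $n+1$ with core $E_c=L(\mathfrak g)\oplus\mathcal C$, and let $V$ be an irreducible quasi-finite module over $E$ (or over the toroidal Lie algebra $\tau_{n+1}^{tor}$) on which $E_c$ (respectively $\overline L(\mathfrak g)$) acts non-trivially. Then $V$ is either a level zero integrable module or a restricted generalized highest weight module.
   Context: Everything is over $\mathbb{C}$. $\mathfrak g$ is a finite-dimensional simple Lie algebra with Cartan subalgebra $\mathfrak h$, root spaces $\mathfrak g_\alpha$, and invariant form $(\cdot|\cdot)$ normalized by $(\theta|\theta)=2$ for the highest root $\theta$. $A_{n+1}=\mathbb{C}[t_0^{\pm1},\dots,t_n^{\pm1}]$, $L(\mathfrak g)=\mathfrak g\otimes A_{n+1}$, $d_i=t_i\partial/\partial t_i$, $D=\mathrm{span}\{d_0,\dots,d_n\}$, $\langle x\otimes t^{\underline r},y\otimes t^{\underline s}\rangle=(x|y)\delta_{\underline r+\underline s,\underline 0}$. fgc EALA of nullity $n+1$: let $\mathcal S_{n+1}=\mathrm{span}\{t^{\underline r}\sum_iu_id_i:\sum_iu_ir_i=0\}\subset\mathrm{Der}(A_{n+1})$ and $\mathcal D$ a $\mathbb{Z}^{n+1}$-graded Lie subalgebra of $\mathcal S_{n+1}$ with $\mathcal D_{\underline 0}=D$. Let $\mathcal C=\bigoplus\mathcal C_{\underline r}$, $\mathcal C_{\underline r}=(\mathcal D_{-\underline r})^*$, be its graded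 dual with $(d\cdot f)(d')=-f([d,d'])$; $\sigma_{\mathcal D}(l_1,l_2)(d)=\langle d(l_1),l_2\rangle$, where $\mathcal D$ acts on $L(\mathfrak g)$ through $A_{n+1}$; $\phi:\mathcal D\times\mathcal D\to\mathcal C$ a 2-cocycle with $\phi(d_0',d)=0$ for $d_0'\in\mathcal D_{\underline 0}$, $d\in\mathcal D$, and $\phi(d,d')(d'')=\phi(d',d'')(d)$. Then $E=L(\mathfrak g)\oplus\mathcal C\oplus\mathcal D$ has bracket $[l_1+f_1+\partial_1,l_2+f_2+\partial_2]=([l_1,l_2]+\partial_1(l_2)-\partial_2(l_1))+(\sigma_{\mathcal D}(l_1,l_2)+\partial_1\cdot f_2-\partial_2\cdot f_1+\phi(\partial_1,\partial_2))+[\partial_1,\partial_2]$. Let $K_i\in\mathcal C_{\underline 0}$ ($0\le i\le n$) be the dual basis of $d_0,\dots,d_n$; the $K_i$ are central in $E$. Toroidal algebra: $\mathcal Z_{n+1}$ is the span of symbols $t^{\underline r}K_i$ ($0\le i\le n$) modulo $\sum_ir_it^{\underline r}K_i=0$; $\overline L(\mathfrak g)=L(\mathfrak g)\oplus\mathcal Z_{n+1}$ with $[x\otimes t^{\underline r},y\otimes t^{\underline s}]=[x,y]\otimes t^{\underline r+\underline s}+(x|y)\sum_ir_it^{\underline r+\underline s}K_i$, $\mathcal Z_{n+1}$ central; $\tau_{n+1}^{tor}=\overline L(\mathfrak g)\oplus D$ with $[d_i,x\otimes t^{\underline s}]=s_ix\otimes t^{\underline s}$, $[d_i,t^{\underline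 s}K_j]=s_it^{\underline s}K_j$, $[d_i,d_j]=0$. $V$ is quasi-finite if $V=\bigoplus_{\mu\in D^*}V_\mu$, $V_\mu=\{v:d_iv=\mu(d_i)v\}$, with all $V_\mu$ finite-dimensional. On an irreducible quasi-finite module the $K_i$ act by scalars; level zero means all these are $0$. With $H=\mathfrak h\oplus\sum\mathbb{C}K_i\oplus\sum\mathbb{C}d_i$, $V$ is integrable if it is an $H$-weight module with finite-dimensional $H$-weight spaces and every element of $\mathfrak g_\alpha\otimes\mathbb{C}t^{\underline k}$ ($\alpha\ne0$, $\underline k\in\mathbb{Z}^{n+1}$) acts locally nilpotently. Restricted generalized highest weight (GHW) module: there are a weight $\Lambda_0\in D^*$, $0\ne v\in V_{\Lambda_0}$ and $N\in\mathbb{N}$ with $\mathfrak c_{\underline k}v=0$ for all $\underline k\in\mathbb{Z}^{n+1}$ with all $k_i\ge N$, where $\mathfrak c_{\underline k}$ is the degree-$\underline k$ part of $\mathfrak c=E_c$ (resp. $\overline L(\mathfrak g)$). As in the paper, this is understood up to a twist by an automorphism: for $A=(a_{pj})\in GL(n+1,\mathbb{Z})$, $(b_{jp})=A^{-1}$, the map $T_A(x\otimes t^{\underline m})=x\otimes t^{\underline mA^t}$, $T_A(t^{\underline m}K_j)=\sum_pa_{pj}t^{\underline mA^t}K_p$, $T_A(t^{\underline m}d_j)=\sum_pb_{jp}t^{\underline mA^t}d_p$ is an isomorphism of $E$ onto another fgc EALA (and of $\tau_{n+1}^{tor}$ onto itself); here $t^{\underline r}K_i\in\mathcal C_{\underline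 r}$ is the functional $t^{-\underline r}\sum_ju_jd_j\mapsto u_i$. The twist of $V$ by $A$ is the same space with $y$ acting as $T_A^{-1}(y)$, and $V$ may be replaced by such a twist. *)

theory Defs
  imports
    "HOL-Analysis.Cartesian_Space"
    "HOL-Library.Poly_Mapping"
    "HOL-Library.Function_Algebras"
begin

section \<open>Finite-dimensional simple Lie algebras\<close>

definition linear_functional_on :: "(complex \<Rightarrow> 'a::ab_group_add \<Rightarrow> 'a) \<Rightarrow> 'a set \<Rightarrow> ('a \<Rightarrow> complex) \<Rightarrow> bool"
  where "linear_functional_on s W f \<longleftrightarrow>
    (\<forall>x\<in>W. \<forall>y\<in>W. f (x + y) = f x + f y) \<and> (\<forall>c. \<forall>x\<in>W. f (s c x) = c * f x)"

text \<open>A functional on a subspace \<open>W\<close> is represented by its extension by \<open>0\<close> to the whole type, so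
  that equality of functions is equality of functionals on \<open>W\<close>.\<close>

definition dual_space :: "(complex \<Rightarrow> 'a::ab_group_add \<Rightarrow> 'a) \<Rightarrow> 'a set \<Rightarrow> ('a \<Rightarrow> complex) set"
  where "dual_space s W = {f. linear_functional_on s W f \<and> (\<forall>x. x \<notin> W \<longrightarrow> f x = 0)}"

definition fun_scale :: "complex \<Rightarrow> ('a \<Rightarrow> complex) \<Rightarrow> 'a \<Rightarrow> complex"
  where "fun_scale c f = (\<lambda>x. c * f x)"

definition root_space ::
  "(complex \<Rightarrow> 'g::ab_group_add \<Rightarrow> 'g) \<Rightarrow> ('g \<Rightarrow> 'g \<Rightarrow> 'g) \<Rightarrow> 'g set \<Rightarrow> ('g \<Rightarrow> complex) \<Rightarrow> 'g set"
  where "root_space s br h \<alpha> = {x. \<forall>y\<in>h. br y x = s (\<alpha> y) x}"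

locale lie_algebra = vector_space scale
  for scale :: "complex \<Rightarrow> 'g::ab_group_add \<Rightarrow> 'g" +
  fixes bracket :: "'g \<Rightarrow> 'g \<Rightarrow> 'g"
  assumes bracket_add_left: "bracket (x + y) z = bracket x z + bracket y z"
    and bracket_add_right: "bracket x (y + z) = bracket x y + bracket x z"
    and bracket_scale_left: "bracket (scale c x) y = scale c (bracket x y)"
    and bracket_scale_right: "bracket x (scale c y) = scale c (bracket x y)"
    and bracket_self: "bracket x x = 0"
    and jacobi: "bracket x (bracket y z) + bracket y (bracket z x) + bracket z (bracket x y) = 0"
begin

definition ideal :: "'g set \<Rightarrow> bool"
  where "ideal I \<longleftrightarrow> subspace I \<and> (\<forall>x. \<forall>y\<in>I. bracket x y \<in> I)"

definition simple :: bool
  where "simple \<longleftrightarrow> (\<exists>x y. bracket x y \<noteq> 0) \<and> (\<forall>I. ideal I \<longrightarrow> I = {0} \<or> I = UNIV)"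

definition subalgebra :: "'g set \<Rightarrow> bool"
  where "subalgebra S \<longleftrightarrow> subspace S \<and> (\<forall>x\<in>S. \<forall>y\<in>S. bracket x y \<in> S)"

primrec lower_central :: "'g set \<Rightarrow> nat \<Rightarrow> 'g set"
  where "lower_central S 0 = S"
  | "lower_central S (Suc k) = span {bracket x y | x y. x \<in> S \<and> y \<in> lower_central S k}"

definition cartan_subalgebra :: "'g set \<Rightarrow> bool"
  where "cartan_subalgebra h \<longleftrightarrow>
    subalgebra h \<and> (\<exists>k. lower_central h k = {0}) \<and> {x. \<forall>y\<in>h. bracket x y \<in> h} = h"

definition roots :: "'g set \<Rightarrow> ('g \<Rightarrow> complex) set"
  where "roots h = {\<alpha> \<in> dual_space scale h. \<alpha> \<noteq> 0 \<and> root_space scale bracket h \<alpha> \<noteq> {0}}"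

definition nonneg_comb :: "('g \<Rightarrow> complex) set \<Rightarrow> ('g \<Rightarrow> complex) set"
  where "nonneg_comb \<Delta> = {\<Sum>\<delta>\<in>\<Delta>. fun_scale (of_nat (m \<delta>)) \<delta> | m. True}"

definition root_base :: "'g set \<Rightarrow> ('g \<Rightarrow> complex) set \<Rightarrow> bool"
  where "root_base h \<Delta> \<longleftrightarrow> finite \<Delta> \<and> \<Delta> \<subseteq> roots h \<and> \<not> module.dependent fun_scale \<Delta> \<and>
    (\<forall>\<alpha>\<in>roots h. \<alpha> \<in> nonneg_comb \<Delta> \<or> - \<alpha> \<in> nonneg_comb \<Delta>)"

definition highest_root :: "'g set \<Rightarrow> ('g \<Rightarrow> complex) set \<Rightarrow> ('g \<Rightarrow> complex) \<Rightarrow> bool"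
  where "highest_root h \<Delta> \<theta> \<longleftrightarrow> \<theta> \<in> roots h \<and> (\<forall>\<alpha>\<in>roots h. \<theta> - \<alpha> \<in> nonneg_comb \<Delta>)"

definition invariant_form :: "('g \<Rightarrow> 'g \<Rightarrow> complex) \<Rightarrow> bool"
  where "invariant_form B \<longleftrightarrow> (\<forall>x. linear_functional_on scale UNIV (B x)) \<and>
    (\<forall>x y. B x y = B y x) \<and> (\<forall>x y z. B (bracket x y) z = B x (bracket y z)) \<and>
    (\<forall>x. (\<forall>y. B x y = 0) \<longrightarrow> x = 0)"

text \<open>The form on \<open>h\<^sup>*\<close> induced by the identification \<open>h \<cong> h\<^sup>*\<close>, \<open>t \<mapsto> B t _\<close>.\<close>

definition dual_form :: "('g \<Rightarrow> 'g \<Rightarrow> complex) \<Rightarrow> 'g set \<Rightarrow> ('g \<Rightarrow> complex) \<Rightarrow> ('g \<Rightarrow> complex) \<Rightarrow> complex"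
  where "dual_form B h \<alpha> \<beta> =
    (let t = (\<lambda>\<gamma>. THE t. t \<in> h \<and> (\<forall>y\<in>h. B t y = \<gamma> y)) in B (t \<alpha>) (t \<beta>))"

end

locale normalized_simple_lie_algebra = lie_algebra scale bracket
  for scale :: "complex \<Rightarrow> 'g::ab_group_add \<Rightarrow> 'g" and bracket :: "'g \<Rightarrow> 'g \<Rightarrow> 'g" +
  fixes h :: "'g set" and form :: "'g \<Rightarrow> 'g \<Rightarrow> complex"
    and \<Delta> :: "('g \<Rightarrow> complex) set" and \<theta> :: "'g \<Rightarrow> complex"
  assumes finite_dimensional: "\<exists>B. finite B \<and> span B = UNIV"
    and simple: "simple"
    and cartan: "cartan_subalgebra h"
    and form: "invariant_form form"
    and base: "root_base h \<Delta>"
    and highest: "highest_root h \<Delta> \<theta>"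
    and normalized: "dual_form form h \<theta> \<theta> = 2"


section \<open>Laurent polynomials with coefficients in a vector space\<close>

text \<open>\<open>X \<otimes> A\<close>, where \<open>A\<close> is the ring of Laurent polynomials in variables \<open>t\<^sub>i\<close> indexed by
  the finite type \<open>'n\<close>, is the space of finitely supported functions \<open>int^'n \<Rightarrow>\<^sub>0 X\<close>;
  \<open>single r x\<close> is \<open>x \<otimes> t\<^sup>r\<close>. The free \<open>A\<close>-module \<open>Der A\<close> with basis \<open>(d\<^sub>i)\<close> is
  \<open>int^'n \<Rightarrow>\<^sub>0 complex^'n\<close>, with \<open>single r u\<close> being \<open>t\<^sup>r \<Sum>\<^sub>i u\<^sub>i d\<^sub>i\<close>.\<close>

type_synonym ('g, 'n) loop = "(int, 'n) vec \<Rightarrow>\<^sub>0 'g"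
type_synonym 'n der = "(int, 'n) vec \<Rightarrow>\<^sub>0 (complex, 'n) vec"

definition pm_scale :: "('c \<Rightarrow> 'a \<Rightarrow> 'a::zero) \<Rightarrow> 'c \<Rightarrow> ('k \<Rightarrow>\<^sub>0 'a) \<Rightarrow> 'k \<Rightarrow>\<^sub>0 'a"
  where "pm_scale s c = Poly_Mapping.map (s c)"

text \<open>The map that sends \<open>single r x\<close> to \<open>F r x\<close>, extended additively.\<close>

definition lin_ext :: "('k \<Rightarrow> 'a \<Rightarrow> 'b) \<Rightarrow> ('k \<Rightarrow>\<^sub>0 'a::zero) \<Rightarrow> 'b::comm_monoid_add"
  where "lin_ext F p = (\<Sum>r\<in>Poly_Mapping.keys p. F r (Poly_Mapping.lookup p r))"

lemma lookup_pm_scale: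
  assumes "s c 0 = 0"
  shows "Poly_Mapping.lookup (pm_scale s c p) k = s c (Poly_Mapping.lookup p k)"
  using assms by (auto simp: pm_scale_def Poly_Mapping.map.rep_eq when_def)

lemma vector_space_pm_scale:
  assumes "vector_space s"
  shows "vector_space (pm_scale s :: _ \<Rightarrow> ('k \<Rightarrow>\<^sub>0 'a::ab_group_add) \<Rightarrow> _)"
proof -
  interpret vector_space s by fact
  show ?thesis
    by unfold_locales
      (auto intro!: poly_mapping_eqI simp: lookup_pm_scale lookup_add scale_right_distrib scale_left_distrib)
qed

lemma lin_ext_superset:
  assumes "finite S" "Poly_Mapping.keys p \<subseteq> S" "\<And>r. F r 0 = 0"
  shows "lin_ext F p = (\<Sum>r\<in>S. F r (Poly_Mapping.lookup p r))"
  unfolding lin_ext_def using assms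
  by (intro sum.mono_neutral_left) (auto simp: in_keys_iff)

lemma lin_ext_single [simp]: "F r 0 = 0 \<Longrightarrow> lin_ext F (Poly_Mapping.single r x) = F r x"
  by (simp add: lin_ext_def)

lemma lin_ext_add:
  assumes "\<And>r. F r 0 = 0" "\<And>r x y. F r (x + y) = F r x + F r y"
  shows "lin_ext F (p + q) = lin_ext F p + lin_ext F q"
proof -
  let ?S = "Poly_Mapping.keys p \<union> Poly_Mapping.keys q"
  have "Poly_Mapping.keys (p + q) \<subseteq> ?S" by (rule keys_add)
  then show ?thesis
    using assms by (simp add: lin_ext_superset[where S = ?S] lookup_add sum.distrib)
qed

lemma lin_ext_scale:
  assumes "\<And>r. F r 0 = 0" "vector_space s" "module s'" "\<And>r x. F r (s c x) = s' c (F r x)"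
  shows "lin_ext F (pm_scale s c p) = s' c (lin_ext F p)"
proof -
  interpret vector_space s by fact
  interpret m: module s' by fact
  have "Poly_Mapping.keys (pm_scale s c p) \<subseteq> Poly_Mapping.keys p"
    by (auto simp: in_keys_iff lookup_pm_scale)
  then have "lin_ext F (pm_scale s c p) = (\<Sum>r\<in>Poly_Mapping.keys p. s' c (F r (Poly_Mapping.lookup p r)))"
    using assms(1,4) by (simp add: lin_ext_superset[where S = "Poly_Mapping.keys p"] lookup_pm_scale)
  then show ?thesis by (simp add: lin_ext_def m.scale_sum_right)
qed

lemma pm_induct [case_names single add]:
  assumes single: "\<And>r x. P (Poly_Mapping.single r x)" and add: "\<And>p q. P p \<Longrightarrow> P q \<Longrightarrow> P (p + q)"
  shows "P (p :: 'k \<Rightarrow>\<^sub>0 'a::comm_monoid_add)"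
proof -
  have "P (\<Sum>r\<in>S. Poly_Mapping.single r (Poly_Mapping.lookup p r))" if "finite S" for S
    using that
  proof induction
    case empty
    show ?case using single[of undefined 0] by simp
  qed (simp add: single add)
  moreover have "(\<Sum>r\<in>Poly_Mapping.keys p. Poly_Mapping.single r (Poly_Mapping.lookup p r)) = p"
    by (rule poly_mapping_eqI) (auto simp: lookup_sum lookup_single when_def in_keys_iff)
  ultimately show ?thesis using finite_keys by metis
qed

definition graded_prod ::
  "('k \<Rightarrow> 'k \<Rightarrow> 'a \<Rightarrow> 'b \<Rightarrow> 'c) \<Rightarrow> ('k::plus \<Rightarrow>\<^sub>0 'a::zero) \<Rightarrow> ('k \<Rightarrow>\<^sub>0 'b::zero) \<Rightarrow> 'k \<Rightarrow>\<^sub>0 'c::comm_monoid_add"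
  where "graded_prod b p q = lin_ext (\<lambda>r x. lin_ext (\<lambda>s y. Poly_Mapping.single (r + s) (b r s x y)) q) p"

lemma graded_prod_single:
  assumes "\<And>r s x. b r s x 0 = 0" "\<And>r s y. b r s 0 y = 0"
  shows "graded_prod b (Poly_Mapping.single r x) (Poly_Mapping.single s y) = Poly_Mapping.single (r + s) (b r s x y)"
  using assms by (simp add: graded_prod_def lin_ext_def)

lemma graded_prod_add_left:
  assumes "\<And>r s y. b r s 0 y = 0" "\<And>r s x x' y. b r s (x + x') y = b r s x y + b r s x' y"
  shows "graded_prod b (p + p') q = graded_prod b p q + graded_prod b p' q"
  unfolding graded_prod_def
  by (rule lin_ext_add) (simp_all add: lin_ext_def assms single_add sum.distrib)

lemma graded_prod_add_right:
  assumes "\<And>r s x. b r s x 0 = 0" "\<And>r s x y y'. b r s x (y + y') = b r s x y + b r s x y'"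
  shows "graded_prod b p (q + q') = graded_prod b p q + graded_prod b p q'"
proof -
  have "lin_ext (\<lambda>s y. Poly_Mapping.single (r + s) (b r s x y)) (q + q') =
     lin_ext (\<lambda>s y. Poly_Mapping.single (r + s) (b r s x y)) q +
     lin_ext (\<lambda>s y. Poly_Mapping.single (r + s) (b r s x y)) q'" for r x
    by (rule lin_ext_add) (simp_all add: assms single_add)
  then show ?thesis by (simp add: graded_prod_def lin_ext_def sum.distrib)
qed

definition vec_of_int :: "int ^ 'n \<Rightarrow> complex ^ 'n"
  where "vec_of_int r = (\<chi> i. of_int (r $ i))"

definition pairing :: "complex ^ 'n \<Rightarrow> int ^ 'n \<Rightarrow> complex"
  where "pairing u r = (\<Sum>i\<in>UNIV. u $ i * of_int (r $ i))"

definition loop_bracket :: "('g \<Rightarrow> 'g \<Rightarrow> 'g) \<Rightarrow> ('g::ab_group_add, 'n::finite) loop \<Rightarrow> ('g, 'n) loop \<Rightarrow> ('g, 'n) loop"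
  where "loop_bracket br = graded_prod (\<lambda>r s x y. br x y)"

definition loop_form :: "('g \<Rightarrow> 'g \<Rightarrow> complex) \<Rightarrow> ('g::ab_group_add, 'n::finite) loop \<Rightarrow> ('g, 'n) loop \<Rightarrow> complex"
  where "loop_form B p q = lin_ext (\<lambda>r x. lin_ext (\<lambda>s y. if r + s = 0 then B x y else 0) q) p"

text \<open>\<open>[t\<^sup>r D\<^sub>u, t\<^sup>s D\<^sub>v] = t\<^sup>r\<^sup>+\<^sup>s ((u|s) D\<^sub>v - (v|r) D\<^sub>u)\<close> for \<open>D\<^sub>u = \<Sum>\<^sub>i u\<^sub>i d\<^sub>i\<close>; this is the
  commutator for the action \<open>t\<^sup>r D\<^sub>u (x \<otimes> t\<^sup>s) = (u|s) x \<otimes> t\<^sup>r\<^sup>+\<^sup>s\<close>, see \<open>der_act_bracket\<close> below.\<close>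

definition der_bracket :: "('n::finite) der \<Rightarrow> 'n der \<Rightarrow> 'n der"
  where "der_bracket = graded_prod (\<lambda>r s u v. pairing u s *s v - pairing v r *s u)"

definition der_act :: "(complex \<Rightarrow> 'g \<Rightarrow> 'g) \<Rightarrow> ('n::finite) der \<Rightarrow> ('g::ab_group_add, 'n) loop \<Rightarrow> ('g, 'n) loop"
  where "der_act sc = graded_prod (\<lambda>r s u x. sc (pairing u s) x)"

abbreviation der_scale :: "complex \<Rightarrow> ('n::finite) der \<Rightarrow> 'n der"
  where "der_scale \<equiv> pm_scale (*s)"

interpretation der: vector_space "der_scale :: _ \<Rightarrow> ('n::finite) der \<Rightarrow> _"
  by (intro vector_space_pm_scale vec.vector_space_axioms)

lemma pm_scale_single:
  "der_scale c (Poly_Mapping.single s v) = Poly_Mapping.single s (c *s v)"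
  by (rule poly_mapping_eqI) (simp add: lookup_pm_scale lookup_single when_def)

lemma pairing_simps [simp]:
  "pairing 0 s = 0" "pairing u 0 = 0" "pairing (u + v) s = pairing u s + pairing v s"
  "pairing (u - v) s = pairing u s - pairing v s"
  "pairing (c *s u) s = c * pairing u s" "pairing u (r + s) = pairing u r + pairing u s"
  by (simp_all add: pairing_def algebra_simps sum.distrib sum_subtractf sum_distrib_left)

lemma der_act_bracket:
  assumes "vector_space sc"
  shows "der_act sc (der_bracket d e) l = der_act sc d (der_act sc e l) - der_act sc e (der_act sc d l)"
proof -
  interpret vector_space sc by fact
  note act = der_act_def graded_prod_single graded_prod_add_left graded_prod_add_right
    scale_left_distrib scale_right_distrib
  note br = der_bracket_def graded_prod_single graded_prod_add_left graded_prod_add_right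
    vec.scale_left_distrib vec.scale_right_distrib
  show ?thesis
  proof (induction l rule: pm_induct)
    case l: (single s x)
    show ?case
    proof (induction d rule: pm_induct)
      case d: (single r u)
      show ?case
      proof (induction e rule: pm_induct)
        case (single q v)
        show ?case
          by (simp add: act br scale_left_diff_distrib flip: single_diff)
            (simp add: algebra_simps flip: single_add single_diff)
      qed (simp add: act br algebra_simps)
    qed (simp add: act br algebra_simps)
  qed (simp add: act algebra_simps)
qed

definition skew_der :: "('n::finite) der set"
  where "skew_der = {d. \<forall>r. pairing (Poly_Mapping.lookup d r) r = 0}"


section \<open>Extended affine Lie algebras\<close>

definition der_component :: "('n::finite) der set \<Rightarrow> int ^ 'n \<Rightarrow> 'n der set"
  where "der_component \<D> r = {d \<in> \<D>. \<exists>u. d = Poly_Mapping.single r u}"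

definition graded_der_subalgebra :: "('n::finite) der set \<Rightarrow> bool"
  where "graded_der_subalgebra \<D> \<longleftrightarrow> \<D> \<subseteq> skew_der \<and> module.subspace der_scale \<D> \<and>
    (\<forall>d\<in>\<D>. \<forall>d'\<in>\<D>. der_bracket d d' \<in> \<D>) \<and>
    (\<forall>d\<in>\<D>. \<forall>r. Poly_Mapping.single r (Poly_Mapping.lookup d r) \<in> \<D>)"

definition graded_dual :: "('n::finite) der set \<Rightarrow> ('n der \<Rightarrow> complex) set"
  where "graded_dual \<D> =
    {f \<in> dual_space der_scale \<D>. finite {r. \<exists>d\<in>der_component \<D> r. f d \<noteq> 0}}"

definition graded_dual_component :: "('n::finite) der set \<Rightarrow> int ^ 'n \<Rightarrow> ('n der \<Rightarrow> complex) set"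
  where "graded_dual_component \<D> r =
    {f \<in> graded_dual \<D>. \<forall>s. s \<noteq> - r \<longrightarrow> (\<forall>d\<in>der_component \<D> s. f d = 0)}"

definition coadjoint :: "('n::finite) der set \<Rightarrow> 'n der \<Rightarrow> ('n der \<Rightarrow> complex) \<Rightarrow> 'n der \<Rightarrow> complex"
  where "coadjoint \<D> d f = (\<lambda>d'. if d' \<in> \<D> then - f (der_bracket d d') else 0)"

definition affine_cocycle :: "('n::finite) der set \<Rightarrow> ('n der \<Rightarrow> 'n der \<Rightarrow> 'n der \<Rightarrow> complex) \<Rightarrow> bool"
  where "affine_cocycle \<D> \<phi> \<longleftrightarrow>
    (\<forall>d\<in>\<D>. \<forall>d'\<in>\<D>. \<phi> d d' \<in> graded_dual \<D>) \<and>
    (\<forall>d\<in>\<D>. \<forall>d'\<in>\<D>. \<forall>e\<in>\<D>. \<phi> (d + d') e = \<phi> d e + \<phi> d' e \<and> \<phi> e (d + d') = \<phi> e d + \<phi> e d') \<and>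
    (\<forall>c. \<forall>d\<in>\<D>. \<forall>e\<in>\<D>. \<phi> (der_scale c d) e = fun_scale c (\<phi> d e) \<and>
        \<phi> e (der_scale c d) = fun_scale c (\<phi> e d)) \<and>
    (\<forall>d\<in>\<D>. \<phi> d d = 0) \<and>
    (\<forall>x\<in>\<D>. \<forall>y\<in>\<D>. \<forall>z\<in>\<D>.
      coadjoint \<D> x (\<phi> y z) + coadjoint \<D> y (\<phi> z x) + coadjoint \<D> z (\<phi> x y) =
      \<phi> (der_bracket x y) z + \<phi> (der_bracket y z) x + \<phi> (der_bracket z x) y) \<and>
    (\<forall>d0\<in>der_component \<D> 0. \<forall>d\<in>\<D>. \<phi> d0 d = 0) \<and>
    (\<forall>x\<in>\<D>. \<forall>y\<in>\<D>. \<forall>z\<in>\<D>. \<phi> x y z = \<phi> y z x)"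

definition fgc_data :: "('n::finite) der set \<Rightarrow> ('n der \<Rightarrow> 'n der \<Rightarrow> 'n der \<Rightarrow> complex) \<Rightarrow> bool"
  where "fgc_data \<D> \<phi> \<longleftrightarrow> graded_der_subalgebra \<D> \<and>
    der_component \<D> 0 = {Poly_Mapping.single 0 u | u. True} \<and> affine_cocycle \<D> \<phi>"

text \<open>A triple \<open>(l, f, d)\<close> stands for \<open>l + f + d\<close>.\<close>

type_synonym ('g, 'n) eala_elem = "('g, 'n) loop \<times> ('n der \<Rightarrow> complex) \<times> 'n der"

definition eala :: "('n::finite) der set \<Rightarrow> ('g::ab_group_add, 'n) eala_elem set"
  where "eala \<D> = UNIV \<times> graded_dual \<D> \<times> \<D>"

definition eala_scale :: "(complex \<Rightarrow> 'g \<Rightarrow> 'g) \<Rightarrow> complex \<Rightarrow>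
    ('g::ab_group_add, 'n::finite) eala_elem \<Rightarrow> ('g, 'n) eala_elem"
  where "eala_scale sc c = (\<lambda>(l, f, d). (pm_scale sc c l, fun_scale c f, der_scale c d))"

definition sigma_form :: "(complex \<Rightarrow> 'g \<Rightarrow> 'g) \<Rightarrow> ('g \<Rightarrow> 'g \<Rightarrow> complex) \<Rightarrow> ('n::finite) der set \<Rightarrow>
    ('g::ab_group_add, 'n) loop \<Rightarrow> ('g, 'n) loop \<Rightarrow> 'n der \<Rightarrow> complex"
  where "sigma_form sc B \<D> l1 l2 = (\<lambda>d. if d \<in> \<D> then loop_form B (der_act sc d l1) l2 else 0)"

definition eala_bracket :: "(complex \<Rightarrow> 'g \<Rightarrow> 'g) \<Rightarrow> ('g \<Rightarrow> 'g \<Rightarrow> 'g) \<Rightarrow> ('g \<Rightarrow> 'g \<Rightarrow> complex) \<Rightarrow>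
    ('n::finite) der set \<Rightarrow> ('n der \<Rightarrow> 'n der \<Rightarrow> 'n der \<Rightarrow> complex) \<Rightarrow>
    ('g::ab_group_add, 'n) eala_elem \<Rightarrow> ('g, 'n) eala_elem \<Rightarrow> ('g, 'n) eala_elem"
  where "eala_bracket sc br B \<D> \<phi> = (\<lambda>(l1, f1, d1) (l2, f2, d2).
    (loop_bracket br l1 l2 + der_act sc d1 l2 - der_act sc d2 l1,
     sigma_form sc B \<D> l1 l2 + coadjoint \<D> d1 f2 - coadjoint \<D> d2 f1 + \<phi> d1 d2,
     der_bracket d1 d2))"

definition eala_core :: "('n::finite) der set \<Rightarrow> ('g::ab_group_add, 'n) eala_elem set"
  where "eala_core \<D> = UNIV \<times> graded_dual \<D> \<times> {0}"

definition eala_core_component :: "('n::finite) der set \<Rightarrow> int ^ 'n \<Rightarrow> ('g::ab_group_add, 'n) eala_elem set"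
  where "eala_core_component \<D> k =
    {(Poly_Mapping.single k x, f, 0) | x f. f \<in> graded_dual_component \<D> k}"

definition eala_d :: "'n::finite \<Rightarrow> ('g::ab_group_add, 'n) eala_elem"
  where "eala_d i = (0, 0, Poly_Mapping.single 0 (axis i 1))"

text \<open>The functional \<open>t\<^sup>r K\<^sub>i\<close> of degree \<open>r\<close>, i.e. \<open>t\<^sup>-\<^sup>r \<Sum>\<^sub>j u\<^sub>j d\<^sub>j \<mapsto> u\<^sub>i\<close>.\<close>

definition K_functional :: "('n::finite) der set \<Rightarrow> int ^ 'n \<Rightarrow> 'n \<Rightarrow> 'n der \<Rightarrow> complex"
  where "K_functional \<D> r i = (\<lambda>d. if d \<in> \<D> then Poly_Mapping.lookup d (- r) $ i else 0)"

definition eala_K :: "('n::finite) der set \<Rightarrow> 'n \<Rightarrow> ('g::ab_group_add, 'n) eala_elem"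
  where "eala_K \<D> i = (0, K_functional \<D> 0 i, 0)"

definition eala_H :: "'g set \<Rightarrow> ('n::finite) der set \<Rightarrow> ('g::ab_group_add, 'n) eala_elem set"
  where "eala_H h \<D> = {(Poly_Mapping.single 0 x, (\<Sum>i\<in>UNIV. fun_scale (a $ i) (K_functional \<D> 0 i)),
      Poly_Mapping.single 0 u) | x a u. x \<in> h}"

definition real_root_vectors :: "(complex \<Rightarrow> 'g \<Rightarrow> 'g) \<Rightarrow> ('g \<Rightarrow> 'g \<Rightarrow> 'g) \<Rightarrow> 'g set \<Rightarrow>
    ('g::ab_group_add, 'n::finite) loop set"
  where "real_root_vectors sc br h = {Poly_Mapping.single k x | k x.
    \<exists>\<alpha>\<in>dual_space sc h. \<alpha> \<noteq> 0 \<and> x \<in> root_space sc br h \<alpha>}"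


section \<open>The toroidal Lie algebra\<close>

text \<open>The span of the elements \<open>\<Sum>\<^sub>i r\<^sub>i t\<^sup>r K\<^sub>i\<close>; here \<open>single r a\<close> stands for \<open>\<Sum>\<^sub>i a\<^sub>i t\<^sup>r K\<^sub>i\<close>.\<close>

definition central_relations :: "(int ^ 'n \<Rightarrow>\<^sub>0 complex ^ 'n) set"
  where "central_relations = der.span {Poly_Mapping.single r (vec_of_int r) | r. True}"

lemma linear_preserves_central_relations:
  assumes add: "\<And>p q. f (p + q) = f p + f q"
    and scale: "\<And>c p. f (der_scale c p) = der_scale c (f p)"
    and gen: "\<And>r. f (Poly_Mapping.single r (vec_of_int r)) \<in> central_relations"
    and p: "p \<in> central_relations"
  shows "f p \<in> central_relations"
proof -
  have 0: "f 0 = 0" using add[of 0 0] by simp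
  have "der.subspace {p. f p \<in> central_relations}"
    by (auto simp: der.subspace_def central_relations_def add scale 0
        intro: der.span_zero der.span_add der.span_scale)
  from der.span_induct[OF p[unfolded central_relations_def] this] gen show ?thesis by blast
qed

lemma linear_preserves_central_equiv:
  assumes add: "\<And>p q. f (p + q) = f p + f q"
    and scale: "\<And>c p. f (der_scale c p) = der_scale c (f p)"
    and gen: "\<And>r. f (Poly_Mapping.single r (vec_of_int r)) \<in> central_relations"
    and pq: "p - q \<in> central_relations"
  shows "f p - f q \<in> central_relations"
proof -
  have "f (p - q) = f p - f q" using add[of "p - q" q] by simp
  then show ?thesis using linear_preserves_central_relations[of f, OF add scale gen pq] by simp
qed

definition central_equiv :: "(int ^ 'n \<Rightarrow>\<^sub>0 complex ^ 'n) \<Rightarrow> (int ^ 'n \<Rightarrow>\<^sub>0 complex ^ 'n) \<Rightarrow> bool"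
  where "central_equiv p q \<longleftrightarrow> p - q \<in> central_relations"

quotient_type 'n center = "(int, 'n::finite) vec \<Rightarrow>\<^sub>0 (complex, 'n) vec" / central_equiv
proof (rule equivpI)
  show "reflp central_equiv"
    by (auto simp: reflp_def central_equiv_def central_relations_def intro: der.span_zero)
  have "q - p \<in> central_relations" if "p - q \<in> central_relations" for p q :: "('a::finite) der"
    using der.span_neg[OF that[unfolded central_relations_def]] by (simp add: central_relations_def)
  then show "symp central_equiv" unfolding symp_def central_equiv_def by blast
  have "p - r \<in> central_relations" if "p - q \<in> central_relations" "q - r \<in> central_relations"
    for p q r :: "('a::finite) der"
    using der.span_add[OF that[unfolded central_relations_def]] by (simp add: central_relations_def)
  then show "transp central_equiv" unfolding transp_def central_equiv_def by blast
qed

instantiation center :: (finite) ab_group_add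
begin

lift_definition zero_center :: "'a center" is 0 .

lift_definition plus_center :: "'a center \<Rightarrow> 'a center \<Rightarrow> 'a center" is "(+)"
  unfolding central_equiv_def central_relations_def
  by (drule (1) der.span_add) (simp add: algebra_simps)

lift_definition uminus_center :: "'a center \<Rightarrow> 'a center" is uminus
  unfolding central_equiv_def central_relations_def
  by (drule der.span_neg) (simp add: algebra_simps)

lift_definition minus_center :: "'a center \<Rightarrow> 'a center \<Rightarrow> 'a center" is "(-)"
  unfolding central_equiv_def central_relations_def
  by (drule (1) der.span_diff) (simp add: algebra_simps)

instance
  by standard (transfer; simp add: central_equiv_def central_relations_def der.span_zero algebra_simps)+

end

lift_definition center_scale :: "complex \<Rightarrow> ('n::finite) center \<Rightarrow> 'n center" is der_scale
  unfolding central_equiv_def central_relations_def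
  by (simp add: der.span_scale flip: der.scale_right_diff_distrib)

text \<open>\<open>[\<Sum>\<^sub>i u\<^sub>i d\<^sub>i, t\<^sup>s K\<^sub>j] = (u|s) t\<^sup>s K\<^sub>j\<close>.\<close>

lift_definition center_d_act :: "complex ^ 'n \<Rightarrow> ('n::finite) center \<Rightarrow> 'n center"
  is "\<lambda>u. lin_ext (\<lambda>s a. Poly_Mapping.single s (pairing u s *s a))"
  unfolding central_equiv_def
proof -
  fix u :: "complex ^ 'n" and p q :: "'n der"
  assume pq: "p - q \<in> central_relations"
  let ?F = "\<lambda>s a. Poly_Mapping.single s (pairing u s *s a)"
  have add: "lin_ext ?F (p + q) = lin_ext ?F p + lin_ext ?F q" for p q
    by (rule lin_ext_add) (simp_all add: single_add vec.scale_right_distrib)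
  have scale: "lin_ext ?F (der_scale c p) = der_scale c (lin_ext ?F p)" for c p
    by (rule lin_ext_scale)
      (simp_all add: vec.vector_space_axioms der.module_axioms pm_scale_single mult.commute)
  have gen: "lin_ext ?F (Poly_Mapping.single r (vec_of_int r)) \<in> central_relations" for r
    unfolding central_relations_def
    by (simp flip: pm_scale_single) (rule der.span_scale, rule der.span_base, blast)
  show "lin_ext ?F p - lin_ext ?F q \<in> central_relations"
    by (rule linear_preserves_central_equiv[of "lin_ext ?F", OF add scale gen pq])
qed

definition complex_matrix :: "int ^ 'n ^ 'n \<Rightarrow> complex ^ 'n ^ 'n"
  where "complex_matrix A = (\<chi> i j. of_int (A $ i $ j))"

lemma complex_matrix_vec_of_int: "complex_matrix A *v vec_of_int m = vec_of_int (A *v m)"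
  by (simp add: complex_matrix_def vec_of_int_def matrix_vector_mult_def vec_eq_iff)

text \<open>\<open>t\<^sup>m K\<^sub>j \<mapsto> \<Sum>\<^sub>p A\<^sub>p\<^sub>j t\<^sup>A\<^sup>m K\<^sub>p\<close>; as a column vector, \<open>m A\<^sup>t\<close> is \<open>A m\<close>.\<close>

lift_definition center_twist :: "int ^ 'n ^ 'n \<Rightarrow> ('n::finite) center \<Rightarrow> 'n center"
  is "\<lambda>A. lin_ext (\<lambda>m a. Poly_Mapping.single (A *v m) (complex_matrix A *v a))"
  unfolding central_equiv_def
proof -
  fix A :: "int ^ 'n ^ 'n" and p q :: "'n der"
  assume pq: "p - q \<in> central_relations"
  let ?F = "\<lambda>m a. Poly_Mapping.single (A *v m) (complex_matrix A *v a)"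
  have add: "lin_ext ?F (p + q) = lin_ext ?F p + lin_ext ?F q" for p q
    by (rule lin_ext_add) (simp_all add: single_add matrix_vector_right_distrib)
  have scale: "lin_ext ?F (der_scale c p) = der_scale c (lin_ext ?F p)" for c p
    by (rule lin_ext_scale)
      (simp_all add: vec.vector_space_axioms der.module_axioms pm_scale_single vec.scale)
  have gen: "lin_ext ?F (Poly_Mapping.single r (vec_of_int r)) \<in> central_relations" for r
    unfolding central_relations_def
    by (auto simp: complex_matrix_vec_of_int intro!: der.span_base)
  show "lin_ext ?F p - lin_ext ?F q \<in> central_relations"
    by (rule linear_preserves_central_equiv[of "lin_ext ?F", OF add scale gen pq])
qed

text \<open>A triple \<open>(l, z, u)\<close> stands for \<open>l + z + \<Sum>\<^sub>i u\<^sub>i d\<^sub>i\<close>.\<close>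

type_synonym ('g, 'n) tor_elem = "('g, 'n) loop \<times> 'n center \<times> (complex, 'n) vec"

definition tor_scale :: "(complex \<Rightarrow> 'g \<Rightarrow> 'g) \<Rightarrow> complex \<Rightarrow>
    ('g::ab_group_add, 'n::finite) tor_elem \<Rightarrow> ('g, 'n) tor_elem"
  where "tor_scale sc c = (\<lambda>(l, z, u). (pm_scale sc c l, center_scale c z, c *s u))"

definition tor_cocycle :: "('g \<Rightarrow> 'g \<Rightarrow> complex) \<Rightarrow>
    ('g::ab_group_add, 'n::finite) loop \<Rightarrow> ('g, 'n) loop \<Rightarrow> 'n center"
  where "tor_cocycle B l1 l2 = abs_center (graded_prod (\<lambda>r s x y. B x y *s vec_of_int r) l1 l2)"

definition tor_bracket :: "(complex \<Rightarrow> 'g \<Rightarrow> 'g) \<Rightarrow> ('g \<Rightarrow> 'g \<Rightarrow> 'g) \<Rightarrow> ('g \<Rightarrow> 'g \<Rightarrow> complex) \<Rightarrow>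
    ('g::ab_group_add, 'n::finite) tor_elem \<Rightarrow> ('g, 'n) tor_elem \<Rightarrow> ('g, 'n) tor_elem"
  where "tor_bracket sc br B = (\<lambda>(l1, z1, u1) (l2, z2, u2).
    (loop_bracket br l1 l2 + der_act sc (Poly_Mapping.single 0 u1) l2 - der_act sc (Poly_Mapping.single 0 u2) l1,
     tor_cocycle B l1 l2 + center_d_act u1 z2 - center_d_act u2 z1,
     0))"

definition tor_core :: "('g::ab_group_add, 'n::finite) tor_elem set"
  where "tor_core = UNIV \<times> UNIV \<times> {0}"

definition tor_core_component :: "int ^ 'n \<Rightarrow> ('g::ab_group_add, 'n::finite) tor_elem set"
  where "tor_core_component k =
    {(Poly_Mapping.single k x, abs_center (Poly_Mapping.single k a), 0) | x a. True}"

definition tor_d :: "'n::finite \<Rightarrow> ('g::ab_group_add, 'n) tor_elem"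
  where "tor_d i = (0, 0, axis i 1)"

definition tor_K :: "'n::finite \<Rightarrow> ('g::ab_group_add, 'n) tor_elem"
  where "tor_K i = (0, abs_center (Poly_Mapping.single 0 (axis i 1)), 0)"

definition tor_H :: "'g set \<Rightarrow> ('g::ab_group_add, 'n::finite) tor_elem set"
  where "tor_H h = {(Poly_Mapping.single 0 x, abs_center (Poly_Mapping.single 0 a), u) | x a u. x \<in> h}"


section \<open>Modules\<close>

definition lie_module :: "(complex \<Rightarrow> 'l \<Rightarrow> 'l) \<Rightarrow> 'l::ab_group_add set \<Rightarrow> ('l \<Rightarrow> 'l \<Rightarrow> 'l) \<Rightarrow>
    (complex \<Rightarrow> 'v::ab_group_add \<Rightarrow> 'v) \<Rightarrow> ('l \<Rightarrow> 'v \<Rightarrow> 'v) \<Rightarrow> bool"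
  where "lie_module sL L br sV \<rho> \<longleftrightarrow> vector_space sV \<and>
    (\<forall>x\<in>L. Vector_Spaces.linear sV sV (\<rho> x)) \<and>
    (\<forall>x\<in>L. \<forall>y\<in>L. \<forall>v. \<rho> (x + y) v = \<rho> x v + \<rho> y v) \<and>
    (\<forall>c. \<forall>x\<in>L. \<forall>v. \<rho> (sL c x) v = sV c (\<rho> x v)) \<and>
    (\<forall>x\<in>L. \<forall>y\<in>L. \<forall>v. \<rho> (br x y) v = \<rho> x (\<rho> y v) - \<rho> y (\<rho> x v))"

definition irreducible_module :: "(complex \<Rightarrow> 'l \<Rightarrow> 'l) \<Rightarrow> 'l::ab_group_add set \<Rightarrow> ('l \<Rightarrow> 'l \<Rightarrow> 'l) \<Rightarrow>
    (complex \<Rightarrow> 'v::ab_group_add \<Rightarrow> 'v) \<Rightarrow> ('l \<Rightarrow> 'v \<Rightarrow> 'v) \<Rightarrow> bool"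
  where "irreducible_module sL L br sV \<rho> \<longleftrightarrow> lie_module sL L br sV \<rho> \<and> (\<exists>v::'v. v \<noteq> 0) \<and>
    (\<forall>W. module.subspace sV W \<and> (\<forall>x\<in>L. \<forall>w\<in>W. \<rho> x w \<in> W) \<longrightarrow> W = {0} \<or> W = UNIV)"

definition finite_dim :: "(complex \<Rightarrow> 'v::ab_group_add \<Rightarrow> 'v) \<Rightarrow> 'v set \<Rightarrow> bool"
  where "finite_dim sV W \<longleftrightarrow> (\<exists>B. finite B \<and> W \<subseteq> module.span sV B)"

text \<open>In the following, \<open>d i\<close> are the elements \<open>d\<^sub>i\<close> of the algebra, and \<open>\<mu> \<in> D\<^sup>*\<close> is given by
  its values \<open>\<mu>\<^sub>i = \<mu>(d\<^sub>i)\<close>. Sums of simultaneous eigenspaces are automatically direct.\<close>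

definition D_weight_space :: "('n \<Rightarrow> 'l) \<Rightarrow> (complex \<Rightarrow> 'v \<Rightarrow> 'v) \<Rightarrow> ('l \<Rightarrow> 'v \<Rightarrow> 'v) \<Rightarrow> complex ^ 'n \<Rightarrow> 'v set"
  where "D_weight_space d sV \<rho> \<mu> = {v. \<forall>i. \<rho> (d i) v = sV (\<mu> $ i) v}"

definition quasi_finite :: "('n::finite \<Rightarrow> 'l) \<Rightarrow> (complex \<Rightarrow> 'v::ab_group_add \<Rightarrow> 'v) \<Rightarrow> ('l \<Rightarrow> 'v \<Rightarrow> 'v) \<Rightarrow> bool"
  where "quasi_finite d sV \<rho> \<longleftrightarrow>
    module.span sV (\<Union>\<mu>. D_weight_space d sV \<rho> \<mu>) = UNIV \<and>
    (\<forall>\<mu>. finite_dim sV (D_weight_space d sV \<rho> \<mu>))"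

definition level_zero :: "('n \<Rightarrow> 'l) \<Rightarrow> ('l \<Rightarrow> 'v::zero \<Rightarrow> 'v) \<Rightarrow> bool"
  where "level_zero K \<rho> \<longleftrightarrow> (\<forall>i v. \<rho> (K i) v = 0)"

definition H_weight_space :: "'l set \<Rightarrow> (complex \<Rightarrow> 'v \<Rightarrow> 'v) \<Rightarrow> ('l \<Rightarrow> 'v \<Rightarrow> 'v) \<Rightarrow> ('l \<Rightarrow> complex) \<Rightarrow> 'v set"
  where "H_weight_space H sV \<rho> \<mu> = {v. \<forall>x\<in>H. \<rho> x v = sV (\<mu> x) v}"

definition integrable_module :: "(complex \<Rightarrow> 'l \<Rightarrow> 'l) \<Rightarrow> 'l::ab_group_add set \<Rightarrow> 'l set \<Rightarrow>
    (complex \<Rightarrow> 'v::ab_group_add \<Rightarrow> 'v) \<Rightarrow> ('l \<Rightarrow> 'v \<Rightarrow> 'v) \<Rightarrow> bool"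
  where "integrable_module sL H R sV \<rho> \<longleftrightarrow>
    module.span sV (\<Union>\<mu>\<in>dual_space sL H. H_weight_space H sV \<rho> \<mu>) = UNIV \<and>
    (\<forall>\<mu>\<in>dual_space sL H. finite_dim sV (H_weight_space H sV \<rho> \<mu>)) \<and>
    (\<forall>y\<in>R. \<forall>v. \<exists>m. (\<rho> y ^^ m) v = 0)"

text \<open>\<open>c k\<close> is the degree-\<open>k\<close> part of the core.\<close>

definition untwisted_ghw :: "('n::finite \<Rightarrow> 'l) \<Rightarrow> (int ^ 'n \<Rightarrow> 'l set) \<Rightarrow>
    (complex \<Rightarrow> 'v::zero \<Rightarrow> 'v) \<Rightarrow> ('l \<Rightarrow> 'v \<Rightarrow> 'v) \<Rightarrow> bool"
  where "untwisted_ghw d c sV \<rho> \<longleftrightarrow>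
    (\<exists>\<Lambda>0. \<exists>v \<in> D_weight_space d sV \<rho> \<Lambda>0. v \<noteq> 0 \<and>
      (\<exists>N::nat. \<forall>k. (\<forall>i. k $ i \<ge> int N) \<longrightarrow> (\<forall>y\<in>c k. \<rho> y v = 0)))"


section \<open>Twists by \<open>GL(n + 1, \<int>)\<close>\<close>

definition loop_twist :: "int ^ 'n ^ 'n \<Rightarrow> ('g::ab_group_add, 'n::finite) loop \<Rightarrow> ('g, 'n) loop"
  where "loop_twist A = lin_ext (\<lambda>m x. Poly_Mapping.single (A *v m) x)"

definition D_twist :: "int ^ 'n ^ 'n \<Rightarrow> complex ^ 'n \<Rightarrow> complex ^ ('n::finite)"
  where "D_twist A u = u v* complex_matrix (matrix_inv A)"

definition der_twist :: "int ^ 'n ^ 'n \<Rightarrow> ('n::finite) der \<Rightarrow> 'n der"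
  where "der_twist A = lin_ext (\<lambda>m u. Poly_Mapping.single (A *v m) (D_twist A u))"

text \<open>The isomorphism \<open>T\<^sub>A\<close> onto the algebra for \<open>der_twist A ` \<D>\<close> and the transported cocycle.
  On the graded dual it is the transport of functionals; that this amounts to
  \<open>t\<^sup>m K\<^sub>j \<mapsto> \<Sum>\<^sub>p A\<^sub>p\<^sub>j t\<^sup>A\<^sup>m K\<^sub>p\<close> is lemma \<open>K_functional_twist\<close> below.\<close>

definition eala_twist :: "int ^ 'n ^ 'n \<Rightarrow> ('g::ab_group_add, 'n::finite) eala_elem \<Rightarrow> ('g, 'n) eala_elem"
  where "eala_twist A = (\<lambda>(l, f, d). (loop_twist A l, f \<circ> inv (der_twist A), der_twist A d))"

definition tor_twist :: "int ^ 'n ^ 'n \<Rightarrow> ('g::ab_group_add, 'n::finite) tor_elem \<Rightarrow> ('g, 'n) tor_elem"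
  where "tor_twist A = (\<lambda>(l, z, u). (loop_twist A l, center_twist A z, D_twist A u))"

lemma complex_matrix_mult: "complex_matrix A ** complex_matrix B = complex_matrix (A ** B)"
  by (simp add: complex_matrix_def matrix_matrix_mult_def vec_eq_iff)

lemma matrix_inv_int:
  fixes A :: "int ^ 'n ^ 'n"
  assumes "invertible A"
  shows "A ** matrix_inv A = mat 1" "matrix_inv A ** A = mat 1"
  using someI_ex[OF assms[unfolded invertible_def]] by (simp_all add: matrix_inv_def)

lemma D_twist_inverse:
  assumes "invertible (A :: int ^ 'n ^ 'n)"
  shows "D_twist A (u v* complex_matrix A) = u" "D_twist A u v* complex_matrix A = u"
proof -
  have "complex_matrix (mat 1 :: int ^ 'n ^ 'n) = mat 1"
    by (simp add: complex_matrix_def mat_def vec_eq_iff)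
  then show "D_twist A (u v* complex_matrix A) = u" "D_twist A u v* complex_matrix A = u"
    by (simp_all add: D_twist_def vector_matrix_mul_assoc complex_matrix_mult matrix_inv_int[OF assms])
qed

lemma der_twist_inverse:
  assumes "invertible (A :: int ^ 'n ^ 'n)"
  shows "inv (der_twist A) =
      lin_ext (\<lambda>m u. Poly_Mapping.single (matrix_inv A *v m) (u v* complex_matrix A))" (is "_ = ?S")
    and "bij (der_twist A)"
proof -
  have [simp]: "A *v (matrix_inv A *v m) = m" "matrix_inv A *v (A *v m) = m" for m
    by (simp_all add: matrix_vector_mul_assoc matrix_inv_int[OF assms])
  have T0: "D_twist A 0 = 0" and Tadd: "D_twist A (u + v) = D_twist A u + D_twist A v" for u v
    by (simp_all add: D_twist_def vector_matrix_left_distrib)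
  have T: "der_twist A (p + q) = der_twist A p + der_twist A q"
    "der_twist A (Poly_Mapping.single m u) = Poly_Mapping.single (A *v m) (D_twist A u)" for p q m u
    unfolding der_twist_def by (auto intro!: lin_ext_add simp: T0 Tadd single_add)
  have S: "?S (p + q) = ?S p + ?S q"
    "?S (Poly_Mapping.single m u) = Poly_Mapping.single (matrix_inv A *v m) (u v* complex_matrix A)" for p q m u
    by (auto intro!: lin_ext_add simp: vector_matrix_left_distrib single_add)
  have ST: "?S (der_twist A d) = d" for d
  proof (induction d rule: pm_induct)
    case (single m u)
    show ?case unfolding T S D_twist_inverse[OF assms] by simp
  next
    case (add p q)
    then show ?case unfolding T S by (rule arg_cong2)
  qed
  have TS: "der_twist A (?S d) = d" for d
  proof (induction d rule: pm_induct)
    case (single m u)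
    show ?case unfolding T S D_twist_inverse[OF assms] by simp
  next
    case (add p q)
    then show ?case unfolding T S by (rule arg_cong2)
  qed
  show "inv (der_twist A) = ?S" using ST TS by (intro inv_equality)
  show "bij (der_twist A)" using ST TS by (intro o_bij[of ?S]) (auto simp: fun_eq_iff)
qed

lemma K_functional_twist:
  assumes A: "invertible (A :: int ^ 'n ^ 'n)"
  shows "K_functional \<D> m j \<circ> inv (der_twist A) =
    (\<Sum>p\<in>UNIV. fun_scale (of_int (A $ p $ j)) (K_functional (der_twist A ` \<D>) (A *v m) p))"
proof
  fix d
  let ?F = "\<lambda>m u. Poly_Mapping.single (matrix_inv A *v m) (u v* complex_matrix A)"
  have inv: "matrix_inv A *v k = - m \<longleftrightarrow> k = - (A *v m)" for k
  proof
    assume "matrix_inv A *v k = - m"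
    then have "A *v (matrix_inv A *v k) = A *v (- m)" by simp
    then show "k = - (A *v m)"
      using matrix_vector_mult_diff_distrib[of A 0 m]
      by (simp add: matrix_vector_mul_assoc matrix_inv_int[OF A])
  next
    assume "k = - (A *v m)"
    then have "matrix_inv A *v k = - (matrix_inv A *v (A *v m))"
      using matrix_vector_mult_diff_distrib[of "matrix_inv A" 0 "A *v m"] by simp
    then show "matrix_inv A *v k = - m" by (simp add: matrix_vector_mul_assoc matrix_inv_int[OF A])
  qed
  have lookup: "Poly_Mapping.lookup (lin_ext ?F d) (- m) = Poly_Mapping.lookup d (- (A *v m)) v* complex_matrix A"
  proof (induction d rule: pm_induct)
    case (single k u)
    show ?case by (simp add: lookup_single when_def inv)
  next
    case (add p q)
    have "lin_ext ?F (p + q) = lin_ext ?F p + lin_ext ?F q"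
      by (rule lin_ext_add) (simp_all add: vector_matrix_left_distrib single_add)
    with add show ?case by (simp add: lookup_add vector_matrix_left_distrib)
  qed
  have mem: "inv (der_twist A) d \<in> \<D> \<longleftrightarrow> d \<in> der_twist A ` \<D>"
  proof
    assume "inv (der_twist A) d \<in> \<D>"
    then show "d \<in> der_twist A ` \<D>"
      by (rule rev_image_eqI) (simp add: surj_f_inv_f[OF bij_is_surj[OF der_twist_inverse(2)[OF A]]])
  next
    assume "d \<in> der_twist A ` \<D>"
    then show "inv (der_twist A) d \<in> \<D>"
      using inv_f_f[OF bij_is_inj[OF der_twist_inverse(2)[OF A]]] by auto
  qed
  have sum_apply: "sum F UNIV x = (\<Sum>i\<in>UNIV. F i x)" for F :: "'n \<Rightarrow> 'n der \<Rightarrow> complex" and x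
    by (induction rule: infinite_finite_induct[of "\<lambda>S. sum F S x = (\<Sum>i\<in>S. F i x)"]) simp_all
  show "(K_functional \<D> m j \<circ> inv (der_twist A)) d =
    (\<Sum>p\<in>UNIV. fun_scale (of_int (A $ p $ j)) (K_functional (der_twist A ` \<D>) (A *v m) p)) d"
    using mem lookup
    by (simp add: K_functional_def fun_scale_def sum_apply der_twist_inverse(1)[OF A]
        vector_matrix_mult_def complex_matrix_def mult.commute)
qed

definition eala_restricted_ghw :: "('n::finite) der set \<Rightarrow> (complex \<Rightarrow> 'v::zero \<Rightarrow> 'v) \<Rightarrow>
    (('g::ab_group_add, 'n) eala_elem \<Rightarrow> 'v \<Rightarrow> 'v) \<Rightarrow> bool"
  where "eala_restricted_ghw \<D> sV \<rho> \<longleftrightarrow> (\<exists>A. invertible A \<and>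
    untwisted_ghw eala_d (eala_core_component (der_twist A ` \<D>)) sV (\<lambda>y. \<rho> (inv (eala_twist A) y)))"

definition tor_restricted_ghw :: "(complex \<Rightarrow> 'v::zero \<Rightarrow> 'v) \<Rightarrow>
    (('g::ab_group_add, 'n::finite) tor_elem \<Rightarrow> 'v \<Rightarrow> 'v) \<Rightarrow> bool"
  where "tor_restricted_ghw sV \<rho> \<longleftrightarrow> (\<exists>A. invertible A \<and>
    untwisted_ghw tor_d tor_core_component sV (\<lambda>y. \<rho> (inv (tor_twist A) y)))"

end

(*
  Suppose that V is not GHW. Then, for every basis (f_i) of the lattice, no nonzero weight vector is killed by all
  g (x) t^{f_i}, because g is perfect and the elements of the core of large degree in the cone spanned by the f_i
  are generated by the g (x) t^{f_i}. This bounds dim V_mu by the dimensions of the V_{mu + f_i}. Applied to bases that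
  agree, up to the shift by -j p, with a fixed one, it bounds the dimensions of V_{mu + j p}, uniformly in j. On spaces
  of dimension at most M the product of x (x) t^k and x (x) t^{-k}, for a root vector x, has vanishing M-th power, as
  h shifts it; commutators with h (x) t^{2k} turn this relation into (x (x) t^k)^{3M} = 0. Since 3M also works for all
  multiples of k, sl_2-theory for the triples e (x) t^{mk}, f (x) t^{-mk} forces the level to be 0.

  For the weight decomposition under h one needs that h acts diagonalizably on g. The normalization of the form says that
  the highest root is nonisotropic, and the weight spaces of nonisotropic weights consist of root vectors and generate an
  ideal, hence g; no Killing form is used.
*)
theory Submission
  imports Defs "HOL-Computational_Algebra.Fundamental_Theorem_Algebra"
begin

text \<open>The bases in question are \<open>s_i - j p\<close> with \<open>s_i\<close> independent
  of \<open>j\<close>: an element of degree \<open>s_i - j p\<close> sends weight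
  \<open>\<mu> + j p\<close> to \<open>\<mu> + s_i\<close>, so every space on the line embeds into
  one fixed finite sum. Such bases need two lattice directions, hence nullity at least two. The
  exponent is 3M = M + 2M, since each of M factors of degree \<open>-k\<close> is traded for two of
  degree \<open>k\<close>. In the level argument [e t^(mk), f t^(-mk)] = t + m K, so one fixed
  vector has the weights \<open>\<eta> + m c\<close> for all m; the common exponent confines them to
  a finite set, whence \<open>c = 0\<close>. A Cartan subalgebra is given here as a nilpotent
  self-normalizing subalgebra. Its weight spaces are therefore generalized ones at first, and trace
  arguments are replaced by counting: a non-nilpotent operator that is shifted by another one would
  create infinitely many eigenvalues. The eigenvalue lemmas work modulo a subspace \<open>U\<close>,
  which stands for the quotient by \<open>U\<close>.\<close>

abbreviation (input) "single \<equiv> Poly_Mapping.single"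
abbreviation (input) "lookup \<equiv> Poly_Mapping.lookup"
abbreviation (input) "keys \<equiv> Poly_Mapping.keys"

section \<open>Endomorphisms of complex vector spaces\<close>

locale complex_vector_space = vector_space sc
  for sc :: "complex \<Rightarrow> 'v::ab_group_add \<Rightarrow> 'v"
begin

definition endo :: "('v \<Rightarrow> 'v) \<Rightarrow> bool"
  where "endo T \<longleftrightarrow> (\<forall>x y. T (x + y) = T x + T y) \<and> (\<forall>c x. T (sc c x) = sc c (T x))"

lemma endo_linear: "endo T \<longleftrightarrow> Vector_Spaces.linear sc sc T"
  by (auto simp: endo_def Vector_Spaces.linear_iff vector_space_axioms)

lemma endo_add: "endo T \<Longrightarrow> T (x + y) = T x + T y"
  and endo_scale: "endo T \<Longrightarrow> T (sc c x) = sc c (T x)"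
  by (auto simp: endo_def)

lemma endo_0: "endo T \<Longrightarrow> T 0 = 0"
  using endo_scale[of T 0 0] by simp

lemma endo_minus: "endo T \<Longrightarrow> T (- x) = - T x"
  using endo_scale[of T "-1" x] by simp

lemma endo_diff: "endo T \<Longrightarrow> T (x - y) = T x - T y"
  using endo_add[of T x "- y"] endo_minus[of T y] by simp

lemmas endo_simps = endo_add endo_scale endo_0 endo_minus endo_diff

lemma endo_pow: "endo T \<Longrightarrow> endo (T ^^ n)"
  by (induction n) (auto simp: endo_def)

lemma endo_comp: "endo S \<Longrightarrow> endo T \<Longrightarrow> endo (\<lambda>v. S (T v))"
  by (auto simp: endo_def)

lemma endo_shift: "endo T \<Longrightarrow> endo (\<lambda>v. T v - sc c v)"
  by (simp add: endo_def algebra_simps)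

lemma pow_mem: "(\<And>w. w \<in> W \<Longrightarrow> T w \<in> W) \<Longrightarrow> v \<in> W \<Longrightarrow> (T ^^ n) v \<in> W"
  by (induction n) auto

lemma endo_image_subspace:
  assumes "endo T" "subspace W"
  shows "subspace (T ` W)"
proof -
  interpret Vector_Spaces.linear sc sc T using assms(1) endo_linear by simp
  show ?thesis using assms(2) by (rule subspace_image)
qed

lemma endo_stable_span:
  assumes "endo T" "\<And>b. b \<in> B \<Longrightarrow> T b \<in> W" "subspace W" "v \<in> span B"
  shows "T v \<in> W"
proof -
  have "subspace {v. T v \<in> W}"
    using assms(3) by (auto simp: subspace_def endo_simps[OF assms(1)])
  from span_induct[OF assms(4) this] assms(2) show ?thesis by auto
qed

text \<open>This is dimension at most \<open>n\<close>. Phrased by spanning sets, it makes sense for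
  every subset and passes to smaller ones, so bounds can be chained freely.\<close>

definition spanned_by :: "nat \<Rightarrow> 'v set \<Rightarrow> bool"
  where "spanned_by n W \<longleftrightarrow> (\<exists>B. finite B \<and> card B \<le> n \<and> W \<subseteq> span B)"

lemma spanned_by_mono: "spanned_by n W \<Longrightarrow> U \<subseteq> W \<Longrightarrow> n \<le> m \<Longrightarrow> spanned_by m U"
  unfolding spanned_by_def by (meson order_trans)

lemma finite_dim_iff: "finite_dim sc W \<longleftrightarrow> (\<exists>n. spanned_by n W)"
  by (auto simp: finite_dim_def spanned_by_def)

lemma spanned_by_0: "spanned_by 0 W \<longleftrightarrow> W \<subseteq> {0}"
proof
  assume "W \<subseteq> {0}"
  then show "spanned_by 0 W" unfolding spanned_by_def by (intro exI[of _ "{}"]) simp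
qed (auto simp: spanned_by_def)

lemma spanned_by_basis:
  assumes "spanned_by n W" "subspace W"
  obtains C where "C \<subseteq> W" "finite C" "card C \<le> n" "independent C" "span C = W"
proof -
  obtain B where B: "finite B" "card B \<le> n" "W \<subseteq> span B"
    using assms(1) by (auto simp: spanned_by_def)
  obtain C where C: "C \<subseteq> W" "independent C" "W \<subseteq> span C"
    using maximal_independent_subset[of W] by metis
  then have "finite C" "card C \<le> card B"
    using independent_span_bound[OF B(1) C(2)] B(3) by auto
  moreover have "span C = W" using C assms(2) by (meson span_minimal subset_antisym)
  ultimately show ?thesis using that C B(2) by auto
qed

text \<open>A basis of \<open>U\<close> remains independent when \<open>v\<close> is added, so it
  has fewer than \<open>n\<close> elements. This drop drives the inductions on dimension.\<close>

lemma spanned_by_proper_subspace: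
  assumes "spanned_by n W" "subspace U" "U \<subseteq> W" "v \<in> W" "v \<notin> U"
  obtains m where "n = Suc m" "spanned_by m U"
proof -
  obtain B where B: "finite B" "card B \<le> n" "W \<subseteq> span B"
    using assms(1) by (auto simp: spanned_by_def)
  have "spanned_by n U" using assms by (blast intro: spanned_by_mono)
  then obtain C where C: "C \<subseteq> U" "finite C" "independent C" "span C = U"
    by (rule spanned_by_basis[OF _ assms(2)])
  have "independent (insert v C)" using C assms(5) by (simp add: independent_insert)
  moreover have "insert v C \<subseteq> span B" using C B assms by auto
  ultimately have "card (insert v C) \<le> card B" using independent_span_bound[OF B(1)] by blast
  moreover have "v \<notin> C" using C assms(5) by auto
  ultimately have "Suc (card C) \<le> n" using C B by simp
  then obtain m where m: "n = Suc m" "card C \<le> m" by (cases n) auto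
  with C have "spanned_by m U" by (auto simp: spanned_by_def)
  with m that show ?thesis by blast
qed

text \<open>Rank and nullity as an inequality: lifts of a basis of the image, together with a
  spanning set of the kernel, span \<open>W\<close>.\<close>

lemma spanned_by_kernel_image:
  assumes "endo T" "subspace W" "spanned_by a {w\<in>W. T w = 0}" "spanned_by b U" "\<And>w. w \<in> W \<Longrightarrow> T w \<in> U"
  shows "spanned_by (a + b) W"
proof -
  obtain A where A: "finite A" "card A \<le> a" "{w\<in>W. T w = 0} \<subseteq> span A"
    using assms(3) by (auto simp: spanned_by_def)
  have "spanned_by b (T ` W)" using assms(4,5) by (blast intro: spanned_by_mono)
  then obtain C where C: "C \<subseteq> T ` W" "finite C" "card C \<le> b" "span C = T ` W"
    by (rule spanned_by_basis[OF _ endo_image_subspace[OF assms(1,2)]])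
  then obtain C' where C': "C' \<subseteq> W" "finite C'" "C = T ` C'" "card C' = card C"
    by (metis card_image finite_imageD subset_image_inj)
  have lin: "Vector_Spaces.linear sc sc T" using assms(1) endo_linear by simp
  interpret Vector_Spaces.linear sc sc T by fact
  have "W \<subseteq> span (A \<union> C')"
  proof
    fix w assume w: "w \<in> W"
    then have "T w \<in> T ` span C'" using C C' span_image by auto
    then obtain u where u: "u \<in> span C'" "T w = T u" by auto
    then have "u \<in> W" using C' assms(2) span_minimal by blast
    with w u assms(2) have "w - u \<in> {w\<in>W. T w = 0}"
      by (auto simp: endo_diff[OF assms(1)] subspace_diff)
    then have "w - u \<in> span (A \<union> C')" "u \<in> span (A \<union> C')"
      using A(3) u span_mono[of A "A \<union> C'"] span_mono[of C' "A \<union> C'"] by auto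
    from span_add[OF this] show "w \<in> span (A \<union> C')" by simp
  qed
  moreover have "card (A \<union> C') \<le> a + b" using card_Un_le[of A C'] A C C' by linarith
  ultimately show ?thesis using A C' unfolding spanned_by_def by blast
qed

text \<open>The \<open>T i\<close> embed \<open>W\<close> into the product of the
  \<open>U i\<close>. The induction replaces \<open>W\<close> by the kernel of one
  \<open>T i\<close>, where the others still have trivial joint kernel.\<close>

lemma spanned_by_joint_kernel:
  assumes "finite I" "subspace W" "\<And>i. i \<in> I \<Longrightarrow> endo (T i)" "\<And>i. i \<in> I \<Longrightarrow> spanned_by (b i) (U i)"
    "\<And>i w. i \<in> I \<Longrightarrow> w \<in> W \<Longrightarrow> T i w \<in> U i" "\<And>w. w \<in> W \<Longrightarrow> (\<And>i. i \<in> I \<Longrightarrow> T i w = 0) \<Longrightarrow> w = 0"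
  shows "spanned_by (sum b I) W"
  using assms
proof (induction I arbitrary: W rule: finite_induct)
  case empty
  then show ?case by (auto simp: spanned_by_0)
next
  case (insert i I)
  have "spanned_by (sum b I) {w\<in>W. T i w = 0}"
  proof (rule insert.IH)
    show "subspace {w\<in>W. T i w = 0}"
      using insert.prems(1) by (auto simp: subspace_def endo_simps[OF insert.prems(2)[OF insertI1]])
    show "w = 0" if "w \<in> {w\<in>W. T i w = 0}" "\<And>j. j \<in> I \<Longrightarrow> T j w = 0" for w
      using that insert.prems(5)[of w] by auto
  qed (use insert.prems in auto)
  then have "spanned_by (sum b I + b i) W"
    using insert.prems by (intro spanned_by_kernel_image[of "T i" W _ _ "U i"]) auto
  then show ?case using insert.hyps by (simp add: add.commute)
qed

section \<open>Polynomials in an operator, and eigenvectors modulo a subspace\<close>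

definition poly_op :: "complex poly \<Rightarrow> ('v \<Rightarrow> 'v) \<Rightarrow> 'v \<Rightarrow> 'v"
  where "poly_op p T = fold_coeffs (\<lambda>a f v. sc a v + T (f v)) p (\<lambda>_. 0)"

lemma poly_op_0 [simp]: "poly_op 0 T v = 0"
  by (simp add: poly_op_def)

lemma poly_op_pCons: "endo T \<Longrightarrow> poly_op (pCons a p) T v = sc a v + T (poly_op p T v)"
  by (cases "a = 0 \<and> p = 0") (auto simp: poly_op_def endo_0)

lemma poly_op_add: "endo T \<Longrightarrow> poly_op (p + q) T v = poly_op p T v + poly_op q T v"
  by (induction p q rule: poly_induct2) (simp_all add: poly_op_pCons endo_add scale_left_distrib)

lemma poly_op_smult: "endo T \<Longrightarrow> poly_op (smult c p) T v = sc c (poly_op p T v)"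
  by (induction p) (simp_all add: poly_op_pCons endo_scale scale_right_distrib)

lemma poly_op_sum: "endo T \<Longrightarrow> poly_op (sum f I) T v = (\<Sum>i\<in>I. poly_op (f i) T v)"
  by (induction I rule: infinite_finite_induct) (simp_all add: poly_op_add)

lemma poly_op_monom: "endo T \<Longrightarrow> poly_op (monom c i) T v = sc c ((T ^^ i) v)"
  by (induction i) (simp_all add: monom_0 monom_Suc poly_op_pCons endo_0 endo_scale)

lemma poly_op_root: "endo T \<Longrightarrow> poly_op ([:- a, 1:] * q) T v = T (poly_op q T v) - sc a (poly_op q T v)"
  using poly_op_add[of T "smult (- a) q" "pCons 0 q" v]
  by (simp add: poly_op_smult poly_op_pCons del: smult_minus_left)

lemma poly_op_mem:
  assumes "endo T" "subspace W" "\<And>w. w \<in> W \<Longrightarrow> T w \<in> W" "v \<in> W"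
  shows "poly_op p T v \<in> W"
  by (induction p) (use assms in \<open>auto simp: poly_op_pCons subspace_0 intro!: subspace_add subspace_scale\<close>)

lemma poly_op_annihilator:
  assumes T: "endo T" and W: "\<And>w. w \<in> W \<Longrightarrow> T w \<in> W" "v \<in> W" and n: "spanned_by n W"
  obtains p where "p \<noteq> 0" "poly_op p T v = 0"
\<comment> \<open>A set of vectors forgets repetitions, so linear dependence can be used only if the
  \<open>n + 1\<close> powers are distinct. A repetition yields an annihilating polynomial
  directly.\<close>
proof (cases "inj_on (\<lambda>i. (T ^^ i) v) {..n}")
  case True
  let ?S = "(\<lambda>i. (T ^^ i) v) ` {..n}"
  obtain B where B: "finite B" "card B \<le> n" "W \<subseteq> span B" using n by (auto simp: spanned_by_def)
  have "?S \<subseteq> W" using pow_mem[of W T] W by blast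
  then have "dependent ?S"
    using independent_span_bound[OF B(1), of ?S] B card_image[OF True] by force
  then obtain u where u: "\<exists>w\<in>?S. u w \<noteq> 0" "(\<Sum>w\<in>?S. sc (u w) w) = 0"
    using dependent_finite[of ?S] by auto
  let ?p = "\<Sum>i\<le>n. monom (u ((T ^^ i) v)) i"
  obtain i where i: "i \<le> n" "u ((T ^^ i) v) \<noteq> 0" using u(1) by auto
  then have "coeff ?p i \<noteq> 0" by (simp add: coeff_sum coeff_monom)
  then have "?p \<noteq> 0" by force
  moreover have "poly_op ?p T v = 0"
    using u(2) by (simp add: poly_op_sum T poly_op_monom sum.reindex[OF True])
  ultimately show ?thesis by (rule that)
next
  case False
  then obtain i j where ij: "i \<noteq> j" "(T ^^ i) v = (T ^^ j) v" by (auto simp: inj_on_def)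
  let ?p = "monom 1 i + smult (-1) (monom 1 j) :: complex poly"
  have "coeff ?p i \<noteq> 0" using ij by simp
  then have "?p \<noteq> 0" by (metis coeff_0)
  moreover have "poly_op ?p T v = 0"
    using ij by (simp add: poly_op_add T poly_op_smult poly_op_monom del: smult_minus_left)
  ultimately show ?thesis by (rule that)
qed

text \<open>A minimal polynomial of the class of \<open>v\<close> modulo \<open>U\<close>. Its
  degree is positive since a nonzero constant would put \<open>v\<close> into
  \<open>U\<close>.\<close>

lemma minimal_annihilator_mod:
  assumes T: "endo T" and W: "\<And>w. w \<in> W \<Longrightarrow> T w \<in> W" "v \<in> W" and n: "spanned_by n W"
    and U: "subspace U" "v \<notin> U"
  obtains p where "p \<noteq> 0" "degree p > 0" "poly_op p T v \<in> U"
    "\<And>q. q \<noteq> 0 \<Longrightarrow> degree q < degree p \<Longrightarrow> poly_op q T v \<notin> U"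
proof -
  obtain p0 where "p0 \<noteq> 0" "poly_op p0 T v = 0"
    by (rule poly_op_annihilator[OF T W n])
  then have "p0 \<noteq> 0 \<and> poly_op p0 T v \<in> U" using subspace_0[OF U(1)] by simp
  then obtain p where p: "p \<noteq> 0" "poly_op p T v \<in> U"
    "\<And>q. q \<noteq> 0 \<and> poly_op q T v \<in> U \<Longrightarrow> degree p \<le> degree q"
    using ex_has_least_nat[of "\<lambda>p. p \<noteq> 0 \<and> poly_op p T v \<in> U" p0 degree] by blast
  have "degree p > 0"
  proof (rule ccontr)
    assume "\<not> degree p > 0"
    then obtain c where c: "p = [:c:]" using degree_eq_zeroE by blast
    then have "sc c v \<in> U" "c \<noteq> 0" using p by (auto simp: poly_op_pCons T endo_0)
    then have "sc (1 / c) (sc c v) \<in> U" using U(1) subspace_scale by blast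
    with \<open>c \<noteq> 0\<close> U(2) show False by simp
  qed
  moreover have "poly_op q T v \<notin> U" if "q \<noteq> 0" "degree q < degree p" for q
    using p(3)[of q] that by linarith
  ultimately show ?thesis using p by (intro that[of p])
qed

text \<open>Split the minimal polynomial as \<open>[:- a, 1:] * q\<close>. By minimality
  \<open>q\<close> keeps \<open>w0\<close> outside \<open>U\<close>, while \<open>T - a\<close> then
  moves the result into \<open>U\<close>.\<close>

lemma eigenvector_mod:
  assumes T: "endo T" and W: "subspace W" "\<And>w. w \<in> W \<Longrightarrow> T w \<in> W" and n: "spanned_by n W"
    and U: "subspace U" and w0: "w0 \<in> W" "w0 \<notin> U"
  obtains v a where "v \<in> W" "v \<notin> U" "T v - sc a v \<in> U"
proof -
  obtain p where p: "p \<noteq> 0" "degree p > 0" "poly_op p T w0 \<in> U"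
    "\<And>q. q \<noteq> 0 \<Longrightarrow> degree q < degree p \<Longrightarrow> poly_op q T w0 \<notin> U"
    using minimal_annihilator_mod[OF T W(2) w0(1) n U w0(2)] by metis
  obtain a where "poly p a = 0"
    using fundamental_theorem_of_algebra[of p] p(2) by (auto simp: constant_degree)
  then have "[:- a, 1:] dvd p" by (simp only: poly_eq_0_iff_dvd)
  then obtain q where q: "p = [:- a, 1:] * q" by (rule dvdE)
  have q0: "q \<noteq> 0" using p(1) q by auto
  then have "degree p = Suc (degree q)" unfolding q by (subst degree_mult_eq) auto
  then have "poly_op q T w0 \<notin> U" using p(4)[OF q0] by simp
  moreover have "poly_op q T w0 \<in> W" using poly_op_mem[OF T W w0(1)] .
  moreover have "T (poly_op q T w0) - sc a (poly_op q T w0) \<in> U"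
    using p(3) by (simp only: q poly_op_root[OF T])
  ultimately show ?thesis using that by blast
qed

lemma eigenvector:
  assumes "endo T" "subspace W" "\<And>w. w \<in> W \<Longrightarrow> T w \<in> W" "spanned_by n W" "w0 \<in> W" "w0 \<noteq> 0"
  obtains v a where "v \<in> W" "v \<noteq> 0" "T v = sc a v"
  using eigenvector_mod[OF assms(1-4), of "{0}" w0] assms(5,6) by auto

text \<open>Applying \<open>T - a i\<close> to a relation removes \<open>u i\<close> modulo
  \<open>U\<close> and multiplies each other coefficient by \<open>a j - a i\<close>, which is
  nonzero.\<close>

lemma eigenvectors_mod_independent:
  assumes T: "endo T" and U: "subspace U" "\<And>u. u \<in> U \<Longrightarrow> T u \<in> U" and "finite J" and inj: "inj_on a J"
    and u: "\<And>j. j \<in> J \<Longrightarrow> u j \<notin> U" "\<And>j. j \<in> J \<Longrightarrow> T (u j) - sc (a j) (u j) \<in> U"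
    and sum: "(\<Sum>j\<in>J. sc (c j) (u j)) \<in> U"
  shows "\<forall>j\<in>J. c j = 0"
  using \<open>finite J\<close> inj u sum
proof (induction J arbitrary: c rule: finite_induct)
  case empty
  then show ?case by simp
next
  case (insert i J)
  let ?s = "\<Sum>j\<in>J. sc (c j) (u j)"
  have s: "sc (c i) (u i) + ?s \<in> U" using insert by simp
  have Tsum: "T (\<Sum>j\<in>J. sc (c j) (u j)) = (\<Sum>j\<in>J. sc (c j) (T (u j)))" for J
    by (induction J rule: infinite_finite_induct) (auto simp: endo_simps[OF T])
  have i: "sc (c i) (T (u i) - sc (a i) (u i)) \<in> U"
    using insert.prems U by (auto intro: subspace_scale)
  have "T (sc (c i) (u i) + ?s) - sc (a i) (sc (c i) (u i) + ?s) \<in> U"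
    using U s by (auto intro: subspace_diff subspace_scale)
  from subspace_diff[OF U(1) this i] have 1: "T ?s - sc (a i) ?s \<in> U"
    by (simp add: endo_simps[OF T] algebra_simps)
  have "(\<Sum>j\<in>J. sc (c j) (T (u j) - sc (a j) (u j))) \<in> U"
    using insert.prems U by (auto intro!: subspace_sum subspace_scale)
  then have "(T ?s - sc (a i) ?s) - (\<Sum>j\<in>J. sc (c j) (T (u j) - sc (a j) (u j))) \<in> U"
    using 1 U by (auto intro: subspace_diff)
  also have "(T ?s - sc (a i) ?s) - (\<Sum>j\<in>J. sc (c j) (T (u j) - sc (a j) (u j)))
    = (\<Sum>j\<in>J. sc (c j * (a j - a i)) (u j))"
    unfolding Tsum scale_sum_right sum_subtractf[symmetric]
    by (intro sum.cong refl)
      (simp add: scale_right_diff_distrib right_diff_distrib scale_left_diff_distrib mult.commute)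
  finally have "\<forall>j\<in>J. c j * (a j - a i) = 0"
    using insert.prems insert.IH[of "\<lambda>j. c j * (a j - a i)"] by auto
  moreover have "a j \<noteq> a i" if "j \<in> J" for j using insert.prems(1) insert.hyps that by (auto simp: inj_on_def)
  ultimately have 0: "\<forall>j\<in>J. c j = 0" by auto
  then have "sc (c i) (u i) \<in> U" using s by simp
  then have "c i = 0"
    using subspace_scale[OF U(1), of "sc (c i) (u i)" "1 / c i"] insert.prems(2)[of i]
    by (cases "c i = 0") auto
  with 0 show ?case by simp
qed

lemma infinitely_many_eigenvalues_mod:
  assumes T: "endo T" and U: "subspace U" "\<And>u. u \<in> U \<Longrightarrow> T u \<in> U" and n: "spanned_by n W"
    and a: "inj (a :: nat \<Rightarrow> complex)"
    and u: "\<And>j. u j \<in> W" "\<And>j. u j \<notin> U" "\<And>j. T (u j) - sc (a j) (u j) \<in> U"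
  shows False
proof -
  have inj: "inj u"
  proof (rule injI, rule ccontr)
    fix i j assume ij: "u i = u j" "i \<noteq> j"
    \<comment> \<open>Equal vectors with different eigenvalues would satisfy the relation with
      coefficients 1 and -1.\<close>
    have "\<forall>k\<in>{i,j}. (if k = i then 1 else -1 :: complex) = 0"
      by (rule eigenvectors_mod_independent[OF T U, of _ a u])
        (use a u ij in \<open>auto simp: inj_on_def inj_def subspace_0[OF U(1)]\<close>)
    then show False by auto
  qed
  obtain B where B: "finite B" "card B \<le> n" "W \<subseteq> span B" using n by (auto simp: spanned_by_def)
  let ?S = "u ` {..n}"
  have "independent ?S"
  proof
    assume "dependent ?S"
    then obtain c where c: "\<exists>w\<in>?S. c w \<noteq> 0" "(\<Sum>w\<in>?S. sc (c w) w) = 0"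
      using dependent_finite[of ?S] by auto
    have inj': "inj_on u {..n}" using inj by (rule inj_on_subset) auto
    have "\<forall>j\<in>{..n}. c (u j) = 0"
      by (rule eigenvectors_mod_independent[OF T U, of _ a u])
        (use a u c(2) in \<open>auto simp: inj_on_def inj_def sum.reindex[OF inj'] subspace_0[OF U(1)]\<close>)
    with c(1) show False by auto
  qed
  moreover have "?S \<subseteq> span B" using u B by auto
  ultimately have "card ?S \<le> n" using independent_span_bound[OF B(1)] B by force
  moreover have "card ?S = Suc n" using card_image[of u "{..n}"] inj by (auto simp: inj_on_def inj_def)
  ultimately show False by simp
qed

text \<open>If some vector of \<open>W\<close> were not killed by a power of \<open>T\<close>, an
  eigenvector \<open>w\<close> of \<open>Y\<close> modulo the killed ones would give eigenvectors
  \<open>T^j w\<close> for the infinitely many eigenvalues \<open>a + j c\<close>. So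
  \<open>T\<close> is locally nilpotent on \<open>W\<close>, and the exponent \<open>n\<close>
  follows from the dimensions of its images.\<close>

lemma shift_nilpotent:
  assumes T: "endo T" and Y: "endo Y" and W: "subspace W" "\<And>w. w \<in> W \<Longrightarrow> T w \<in> W" "\<And>w. w \<in> W \<Longrightarrow> Y w \<in> W"
    and n: "spanned_by n W" and c: "c \<noteq> 0" "\<And>w. w \<in> W \<Longrightarrow> Y (T w) = T (Y w) + sc c (T w)"
    and v: "v \<in> W"
  shows "(T ^^ n) v = 0"
  using W n c(2) v
proof (induction n arbitrary: W v)
  case 0
  then show ?case by (auto simp: spanned_by_0)
next
  case (Suc n)
  note comm = Suc.prems(5)
  have powW: "(T ^^ j) w \<in> W" if "w \<in> W" for j w using pow_mem[of W T] Suc.prems(2) that by blast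
  have TY: "Y ((T ^^ j) w) = (T ^^ j) (Y w) + sc (of_nat j * c) ((T ^^ j) w)" if "w \<in> W" for j w
    by (induction j) (simp_all add: comm powW that endo_simps[OF T] scale_left_distrib algebra_simps)
  define U where "U = {w\<in>W. \<exists>j. (T ^^ j) w = 0}"
  have U: "subspace U"
    unfolding subspace_def
  proof (intro conjI ballI allI)
    show "0 \<in> U" using subspace_0[OF Suc.prems(1)] by (auto simp: U_def intro: exI[of _ 0])
  next
    fix x y assume "x \<in> U" "y \<in> U"
    then obtain i j where ij: "x \<in> W" "y \<in> W" "(T ^^ i) x = 0" "(T ^^ j) y = 0" by (auto simp: U_def)
    have "(T ^^ (i + j)) x = (T ^^ j) ((T ^^ i) x)" "(T ^^ (i + j)) y = (T ^^ i) ((T ^^ j) y)"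
      by (metis add.commute comp_apply funpow_add)+
    then have "(T ^^ (i + j)) (x + y) = 0"
      using ij by (simp add: endo_simps[OF endo_pow[OF T]])
    then show "x + y \<in> U" using ij subspace_add[OF Suc.prems(1)] by (auto simp: U_def)
  next
    fix c x assume "x \<in> U"
    then show "sc c x \<in> U" using subspace_scale[OF Suc.prems(1)]
      by (auto simp: U_def endo_simps[OF endo_pow[OF T]])
  qed
  have YU: "Y u \<in> U" if u: "u \<in> U" for u
  proof -
    obtain j where j: "u \<in> W" "(T ^^ j) u = 0" using u by (auto simp: U_def)
    have "(T ^^ j) (Y u) = 0" using TY[OF j(1), of j] j(2) endo_0[OF Y] by simp
    then show ?thesis using j Suc.prems(3) by (auto simp: U_def)
  qed
  have WU: "W \<subseteq> U"
  proof (rule ccontr)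
    assume "\<not> W \<subseteq> U"
    then obtain w0 where w0: "w0 \<in> W" "w0 \<notin> U" by auto
    obtain w a where w: "w \<in> W" "w \<notin> U" "Y w - sc a w \<in> U"
      by (rule eigenvector_mod[OF Y Suc.prems(1) _ Suc.prems(4) U w0]) (use Suc.prems(3) in auto)
    have TU: "T u \<in> U" if u: "u \<in> U" for u
    proof -
      obtain j where j: "u \<in> W" "(T ^^ j) u = 0" using u by (auto simp: U_def)
      then have "(T ^^ j) (T u) = 0" by (metis T endo_0 funpow_swap1)
      then show ?thesis using j Suc.prems(2) by (auto simp: U_def)
    qed
    show False
    proof (rule infinitely_many_eigenvalues_mod[OF Y U YU Suc.prems(4)])
      show "inj (\<lambda>j. a + of_nat j * c)" using c(1) by (auto simp: inj_def)
      show "(T ^^ j) w \<in> W" for j using powW w by blast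
      show "(T ^^ j) w \<notin> U" for j
      proof
        assume "(T ^^ j) w \<in> U"
        then obtain i where "(T ^^ i) ((T ^^ j) w) = 0" by (auto simp: U_def)
        then have "(T ^^ (i + j)) w = 0" by (simp add: funpow_add)
        then show False using w by (auto simp: U_def)
      qed
      have "(T ^^ j) (Y w - sc a w) \<in> U" for j using pow_mem[of U T, OF TU w(3)] .
      then show "Y ((T ^^ j) w) - sc (a + of_nat j * c) ((T ^^ j) w) \<in> U" for j
        by (simp add: TY w(1) endo_simps[OF endo_pow[OF T]] scale_left_distrib algebra_simps)
    qed auto
  qed
  show ?case
  \<comment> \<open>If the image is smaller, the induction hypothesis applies to it and costs one
    power of \<open>T\<close>. If \<open>T\<close> is onto, nilpotency forces \<open>W\<close> to
    vanish.\<close>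
  proof (cases "T ` W = W")
    case False
    then obtain w where w: "w \<in> W" "w \<notin> T ` W" using Suc.prems(2) by auto
    have "T ` W \<subseteq> W" using Suc.prems(2) by blast
    then obtain m where "Suc n = Suc m" "spanned_by m (T ` W)"
      by (rule spanned_by_proper_subspace[OF Suc.prems(4) endo_image_subspace[OF T Suc.prems(1)] _ w])
    then have "spanned_by n (T ` W)" by simp
    then have "(T ^^ n) (T v) = 0"
    proof (rule Suc.IH[OF endo_image_subspace[OF T Suc.prems(1)], rotated 2])
      fix w assume "w \<in> T ` W"
      then obtain u where u: "u \<in> W" "w = T u" by auto
      show "T w \<in> T ` W" using u Suc.prems(2) by auto
      have "Y w = T (Y u + sc c u)" using comm u by (simp add: endo_simps[OF T])
      then show "Y w \<in> T ` W"
        using u Suc.prems(1,3) by (auto intro!: imageI subspace_add subspace_scale)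
      show "Y (T w) = T (Y w) + sc c (T w)" using u comm Suc.prems(2) by auto
    qed (use Suc.prems in auto)
    then show ?thesis by (simp only: funpow_Suc_right comp_apply)
  next
    case True
    obtain C where C: "C \<subseteq> W" "finite C" "span C = W"
      using spanned_by_basis[OF Suc.prems(4,1)] by metis
    have "\<forall>x\<in>C. \<exists>j. (T ^^ j) x = 0" using C(1) WU unfolding U_def by blast
    then obtain m where m: "\<forall>x\<in>C. (T ^^ m x) x = 0" by (rule bchoice[THEN exE])
    \<comment> \<open>\<open>C\<close> may be empty; inserting 0 keeps the maximum
      meaningful.\<close>
    let ?m = "Max (insert 0 (m ` C))"
    have "(T ^^ ?m) x = 0" if "x \<in> C" for x
    proof -
      have "m x \<le> ?m" using that C by auto
      then obtain d where "?m = d + m x" by (metis le_add_diff_inverse2)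
      then show ?thesis using m that by (simp add: funpow_add endo_0[OF endo_pow[OF T]])
    qed
    then have 0: "(T ^^ ?m) x = 0" if "x \<in> W" for x
      using endo_stable_span[OF endo_pow[OF T], of C ?m "{0}" x] that C by auto
    have "(T ^^ j) ` W = W" for j
    proof (induction j)
      case (Suc j)
      have "(T ^^ Suc j) ` W = T ` ((T ^^ j) ` W)" by (simp add: image_comp)
      with Suc True show ?case by simp
    qed auto
    then obtain x where "x \<in> W" "v = (T ^^ ?m) x" using Suc.prems(6) by blast
    then have "v = 0" using 0 by simp
    then show ?thesis using endo_0[OF endo_pow[OF T]] by blast
  qed
qed

lemma funpow_add_apply: "(f ^^ (i + j)) x = (f ^^ i) ((f ^^ j) x)"
  by (simp add: funpow_add)

section \<open>Generalized eigenspaces\<close>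

definition gen_eigenspace :: "('v \<Rightarrow> 'v) \<Rightarrow> complex \<Rightarrow> 'v set"
  where "gen_eigenspace T c = {v. \<exists>k. ((\<lambda>v. T v - sc c v) ^^ k) v = 0}"

lemma gen_eigenspace_step:
  assumes "T v - sc c v \<in> gen_eigenspace T c"
  shows "v \<in> gen_eigenspace T c"
proof -
  obtain k where "((\<lambda>v. T v - sc c v) ^^ k) (T v - sc c v) = 0"
    using assms by (auto simp: gen_eigenspace_def)
  then have "((\<lambda>v. T v - sc c v) ^^ Suc k) v = 0" by (simp add: funpow_Suc_right del: funpow.simps)
  then show ?thesis unfolding gen_eigenspace_def by (intro CollectI exI)
qed

lemma eigen_gen_eigenspace: "T v = sc c v \<Longrightarrow> v \<in> gen_eigenspace T c"
  unfolding gen_eigenspace_def by (intro CollectI exI[of _ 1]) simp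

lemma gen_eigenspace_subspace:
  assumes "endo T"
  shows "subspace (gen_eigenspace T c)"
  unfolding subspace_def
proof (intro conjI ballI allI)
  let ?S = "\<lambda>v. T v - sc c v"
  note S = endo_shift[OF assms, of c]
  show "0 \<in> gen_eigenspace T c" by (auto simp: gen_eigenspace_def intro: exI[of _ 0])
  fix x assume "x \<in> gen_eigenspace T c"
  then obtain i where i: "(?S ^^ i) x = 0" by (auto simp: gen_eigenspace_def)
  then show "sc a x \<in> gen_eigenspace T c" for a
    unfolding gen_eigenspace_def by (intro CollectI exI[of _ i]) (simp add: endo_simps[OF endo_pow[OF S]])
  fix y assume "y \<in> gen_eigenspace T c"
  then obtain j where j: "(?S ^^ j) y = 0" by (auto simp: gen_eigenspace_def)
  have "(?S ^^ (i + j)) x = (?S ^^ j) ((?S ^^ i) x)" "(?S ^^ (i + j)) y = (?S ^^ i) ((?S ^^ j) y)"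
    using funpow_add_apply[of j i ?S x] funpow_add_apply[of i j ?S y] by (simp_all add: add.commute[of j i])
  with i j have "(?S ^^ (i + j)) (x + y) = 0" by (simp add: endo_simps[OF endo_pow[OF S]])
  then show "x + y \<in> gen_eigenspace T c" unfolding gen_eigenspace_def by (intro CollectI exI)
qed

text \<open>Induction on the number of applications of \<open>T - c\<close> that reach 0. The
  exponent stays hidden, so statements on two vectors follow by nesting instead of a binomial
  formula.\<close>

lemma gen_eigenspace_induct [consumes 2, case_names zero step]:
  assumes "v \<in> gen_eigenspace T c" "endo T"
    and "P 0" and step: "\<And>v. v \<in> gen_eigenspace T c \<Longrightarrow> P (T v - sc c v) \<Longrightarrow> P v"
  shows "P v"
proof -
  obtain k where "((\<lambda>v. T v - sc c v) ^^ k) v = 0" using assms(1) by (auto simp: gen_eigenspace_def)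
  then show ?thesis
  proof (induction k arbitrary: v)
    case 0
    then show ?case using assms(3) by simp
  next
    case (Suc k)
    have a: "((\<lambda>v. T v - sc c v) ^^ k) (T v - sc c v) = 0" using Suc.prems by (simp add: funpow_Suc_right del: funpow.simps)
    then have "T v - sc c v \<in> gen_eigenspace T c" unfolding gen_eigenspace_def by (intro CollectI exI)
    then show ?case by (rule step[OF gen_eigenspace_step Suc.IH[OF a]])
  qed
qed

lemma gen_eigenspace_map:
  assumes "v \<in> gen_eigenspace T c" "endo T" "endo S" "\<And>v. S (T v) = T (S v)"
  shows "S v \<in> gen_eigenspace T c"
  using assms(1,2)
proof (induction rule: gen_eigenspace_induct)
  case zero
  then show ?case using subspace_0[OF gen_eigenspace_subspace[OF assms(2)]] endo_0[OF assms(3)] by simp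
next
  case (step v)
  then show ?case by (auto intro: gen_eigenspace_step[of T "S v"] simp: endo_simps[OF assms(3)] assms(4))
qed

text \<open>Modulo \<open>U\<close> the operator \<open>T - c\<close> multiplies \<open>v\<close> by
  \<open>a - c\<close>. Some power of it kills \<open>v\<close>, which is not in \<open>U\<close>,
  so this factor is zero.\<close>

lemma gen_eigenspace_eigenvalue:
  assumes "v \<in> gen_eigenspace T c" "endo T" "v \<notin> U" "subspace U" "\<And>u. u \<in> U \<Longrightarrow> T u \<in> U" "T v - sc a v \<in> U"
  shows "a = c"
proof (rule ccontr)
  assume ac: "a \<noteq> c"
  let ?S = "\<lambda>v. T v - sc c v"
  have "(?S ^^ k) v - sc ((a - c) ^ k) v \<in> U" for k
  proof (induction k)
    case (Suc k)
    let ?w = "(?S ^^ k) v" and ?b = "(a - c) ^ k"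
    have 1: "T (?w - sc ?b v) - sc c (?w - sc ?b v) \<in> U"
      using Suc assms(4,5) by (auto intro: subspace_diff subspace_scale)
    have 2: "sc ?b (T v - sc a v) \<in> U" using assms(4,6) subspace_scale by blast
    from subspace_add[OF assms(4) 1 2] show ?case
      by (simp add: endo_simps[OF assms(2)] scale_right_diff_distrib left_diff_distrib scale_left_diff_distrib
          algebra_simps)
  qed (use assms(4) subspace_0 in auto)
  moreover obtain k where "(?S ^^ k) v = 0" using assms(1) by (auto simp: gen_eigenspace_def)
  ultimately have "0 - sc ((a - c) ^ k) v \<in> U" by metis
  then have "- sc ((a - c) ^ k) v \<in> U" by simp
  from subspace_scale[OF assms(4) this, of "- 1 / (a - c) ^ k"] ac assms(3) show False by simp
qed

text \<open>If the span \<open>?G\<close> were not all of \<open>W\<close>, there would be an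
  eigenvector \<open>v\<close> modulo \<open>?G\<close>, of eigenvalue \<open>a\<close>. On the
  eigenspaces for other values \<open>T - a\<close> is onto, so \<open>v\<close> can be corrected by
  an element of \<open>?G\<close> until \<open>T - a\<close> sends it into the generalized
  eigenspace of \<open>a\<close>; then \<open>v\<close> lies in \<open>?G\<close> after all.\<close>

lemma sum_gen_eigenspaces:
  assumes T: "endo T" and W: "subspace W" "\<And>w. w \<in> W \<Longrightarrow> T w \<in> W" and n: "spanned_by n W"
  shows "W \<subseteq> span (\<Union>c. W \<inter> gen_eigenspace T c)"
proof
  let ?E = "\<lambda>c. W \<inter> gen_eigenspace T c"
  let ?G = "span (\<Union>c. ?E c)"
  have subE: "subspace (?E c)" for c by (intro subspace_inter W gen_eigenspace_subspace T)
  have TE: "T g \<in> ?E c" if "g \<in> ?E c" for g c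
    using gen_eigenspace_map[OF _ T T] that W by auto
  have inv: "\<exists>g'\<in>?E c. T g' - sc a g' = g" if "g \<in> ?E c" "c \<noteq> a" for g a c
  proof -
    have "g \<in> W \<longrightarrow> ?thesis" using IntD2[OF that(1)] T
    proof (induction rule: gen_eigenspace_induct)
      case zero
      then show ?case using subspace_0[OF subE[of c]] by (auto intro!: bexI[of _ 0] simp: endo_0[OF T])
    next
      case (step v)
      show ?case
      proof
        assume v: "v \<in> W"
        have "T v - sc c v \<in> W" using v W by (auto intro: subspace_diff subspace_scale)
        then obtain g'' where g'': "g'' \<in> ?E c" "T g'' - sc a g'' = T v - sc c v" using step by auto
        \<comment> \<open>The choice comes from \<open>T - a = (T - c) + (c - a)\<close>: applying
          \<open>T - a\<close> to \<open>v\<close> minus a solution for \<open>(T - c) v\<close>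
          leaves \<open>(c - a) v\<close>.\<close>
        let ?g = "sc (1 / (c - a)) (v - g'')"
        have "v \<in> ?E c" using v step(1) by simp
        from subspace_scale[OF subE subspace_diff[OF subE this g''(1)]] have g: "?g \<in> ?E c" .
        have "T (v - g'') - sc a (v - g'') = sc (c - a) v"
          using g''(2) by (simp add: endo_simps[OF T] scale_right_diff_distrib scale_left_diff_distrib algebra_simps)
        moreover have "T ?g - sc a ?g = sc (1 / (c - a)) (T (v - g'') - sc a (v - g''))"
          by (simp add: endo_simps[OF T] scale_right_diff_distrib mult.commute)
        ultimately have "T ?g - sc a ?g = v" using \<open>c \<noteq> a\<close> by simp
        with g show "\<exists>g'\<in>?E c. T g' - sc a g' = v" by blast
      qed
    qed
    with that show ?thesis by auto
  qed
  have split: "\<exists>g'\<in>?G. \<exists>ga\<in>?E a. u = T g' - sc a g' + ga" if "u \<in> ?G" for a u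
  proof -
    let ?P = "{u. \<exists>g'\<in>?G. \<exists>ga\<in>?E a. u = T g' - sc a g' + ga}"
    have P: "u \<in> ?P" if "u = T g' - sc a g' + ga" "g' \<in> ?G" "ga \<in> ?E a" for u g' ga
      by (rule CollectI, rule bexI[of _ g'], rule bexI[of _ ga]) (rule that)+
    have "subspace ?P"
      unfolding subspace_def
    proof (intro conjI ballI allI)
      have "0 = T 0 - sc a 0 + 0" by (simp add: endo_0[OF T])
      then show "0 \<in> ?P" using span_zero subspace_0[OF subE] by (rule P)
    next
      fix x y assume "x \<in> ?P" "y \<in> ?P"
      then obtain g g1 g' g1' where g: "g \<in> ?G" "g1 \<in> ?E a" "x = T g - sc a g + g1"
        "g' \<in> ?G" "g1' \<in> ?E a" "y = T g' - sc a g' + g1'" by auto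
      have "x + y = T (g + g') - sc a (g + g') + (g1 + g1')"
        unfolding g by (simp add: endo_add[OF T] scale_right_distrib)
      then show "x + y \<in> ?P"
        by (rule P[OF _ span_add[OF g(1,4)] subspace_add[OF subE g(2,5)]])
    next
      fix c x assume "x \<in> ?P"
      then obtain g g1 where g: "g \<in> ?G" "g1 \<in> ?E a" "x = T g - sc a g + g1" by auto
      have "sc c x = T (sc c g) - sc a (sc c g) + sc c g1"
        unfolding g by (simp add: endo_scale[OF T] scale_right_distrib scale_right_diff_distrib mult.commute)
      then show "sc c x \<in> ?P"
        by (rule P[OF _ span_scale[OF g(1)] subspace_scale[OF subE g(2)]])
    qed
    moreover have "(\<Union>c. ?E c) \<subseteq> ?P"
    proof
      fix u assume "u \<in> (\<Union>c. ?E c)"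
      then obtain c where c: "u \<in> ?E c" by blast
      show "u \<in> ?P"
      proof (cases "c = a")
        case True
        have "u = T 0 - sc a 0 + u" by (simp add: endo_0[OF T])
        moreover have "u \<in> ?E a" using c True by simp
        ultimately show ?thesis by (rule P[OF _ span_zero])
      next
        case False
        then obtain g' where g': "g' \<in> ?E c" "T g' - sc a g' = u" using inv c by blast
        then have "u = T g' - sc a g' + 0" by simp
        moreover have "g' \<in> ?G" using g'(1) by (intro span_base UN_I[of c] UNIV_I)
        ultimately show ?thesis using subspace_0[OF subE] by (rule P)
      qed
    qed
    ultimately have "?G \<subseteq> ?P" by (rule span_minimal[rotated])
    then have "u \<in> ?P" using that by (rule subsetD)
    then show ?thesis by (rule CollectD)
  qed
  have GW: "?G \<subseteq> W" using W by (intro span_minimal) auto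
  have step: "w \<in> ?G" if w: "w \<in> W" "T w - sc a w \<in> ?G" for w a
  proof -
    obtain g' ga where g: "g' \<in> ?G" "ga \<in> ?E a" "T w - sc a w = T g' - sc a g' + ga"
      using split[OF w(2)] by blast
    then have "T (w - g') - sc a (w - g') = ga"
      by (simp add: endo_simps[OF T] scale_right_diff_distrib algebra_simps)
    then have "w - g' \<in> gen_eigenspace T a" using g(2) by (intro gen_eigenspace_step[of T "w - g'"]) simp
    moreover have "w - g' \<in> W" using GW g(1) by (intro subspace_diff[OF W(1) w(1)]) (rule subsetD)
    ultimately have "w - g' \<in> ?G" by (intro span_base UN_I[of a] UNIV_I IntI)
    from span_add[OF this g(1)] show ?thesis by (simp only: diff_add_cancel)
  qed
  fix w0 assume w0: "w0 \<in> W"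
  show "w0 \<in> ?G"
  proof (rule ccontr)
    assume w0': "w0 \<notin> ?G"
    obtain v a where v: "v \<in> W" "v \<notin> ?G" "T v - sc a v \<in> ?G"
      using eigenvector_mod[OF T W(1) _ n subspace_span w0 w0', OF W(2)] .
    from v(2) step[OF v(1,3)] show False by (rule notE)
  qed
qed

text \<open>The commutation rule behind the representation theory of \<open>sl\<^sub>2\<close>, for \<open>[E, F] = T\<close> and
  \<open>[T, E] = c E\<close>.\<close>

lemma power_commutator:
  assumes E: "endo E" and F: "endo F" and T: "endo T" and EF: "\<And>v. E (F v) = F (E v) + T v"
    and TE: "\<And>v. T (E v) = E (T v) + sc c (E v)"
  shows "(E ^^ Suc n) (F v) = F ((E ^^ Suc n) v) + sc (of_nat (Suc n)) (T ((E ^^ n) v))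
    - sc (c * of_nat n * of_nat (Suc n) / 2) ((E ^^ n) v)"
proof (induction n)
  case 0
  show ?case by (simp add: EF)
next
  case (Suc n)
  let ?w = "(E ^^ n) v"
  have ET: "E (T u) = T (E u) - sc c (E u)" for u using TE[of u] by simp
  have coef: "c * of_nat n * of_nat (Suc n) / 2 + of_nat (Suc n) * c = c * of_nat (Suc n) * of_nat (Suc (Suc n)) / 2"
    by (simp add: field_simps)
  have suc: "sc (of_nat (Suc (Suc n))) u = u + sc (of_nat (Suc n)) u" for u
    by (simp only: of_nat_Suc[of "Suc n"] scale_left_distrib scale_one)
  have "(E ^^ Suc (Suc n)) (F v) = E (F (E ?w) + sc (of_nat (Suc n)) (T ?w)
      - sc (c * of_nat n * of_nat (Suc n) / 2) ?w)"
    using Suc by simp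
  also have "\<dots> = F (E (E ?w)) + (T (E ?w) + sc (of_nat (Suc n)) (T (E ?w)))
      - (sc (c * of_nat n * of_nat (Suc n) / 2) (E ?w) + sc (of_nat (Suc n) * c) (E ?w))"
    by (simp add: endo_add[OF E] endo_diff[OF E] endo_scale[OF E] EF ET scale_right_diff_distrib del: of_nat_Suc)
  also have "\<dots> = F (E (E ?w)) + sc (of_nat (Suc (Suc n))) (T (E ?w))
      - sc (c * of_nat (Suc n) * of_nat (Suc (Suc n)) / 2) (E ?w)"
    by (simp only: coef[symmetric] suc scale_left_distrib)
  finally show ?case by simp
qed

end

lemma (in complex_vector_space) subspace_endo_preimage:
  assumes "endo T" "subspace W" "subspace U"
  shows "subspace {w\<in>W. T w \<in> U}"
  using assms(2,3) by (simp add: subspace_def endo_simps[OF assms(1)])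

section \<open>Weights of nilpotent Lie algebras\<close>

sublocale lie_algebra \<subseteq> complex_vector_space scale
  by unfold_locales

context lie_algebra
begin

lemma endo_bracket: "endo (bracket x)"
  by (simp add: endo_def bracket_add_right bracket_scale_right)

lemma bracket_0_right [simp]: "bracket x 0 = 0"
  and bracket_0_left [simp]: "bracket 0 x = 0"
  using bracket_scale_right[of x 0 0] bracket_scale_left[of 0 0 x] by simp_all

lemma bracket_minus_right: "bracket x (- y) = - bracket x y"
  and bracket_minus_left: "bracket (- x) y = - bracket x y"
  using bracket_scale_right[of x "-1" y] bracket_scale_left[of "-1" x y] by simp_all

lemma bracket_diff_right: "bracket x (y - z) = bracket x y - bracket x z"
  and bracket_diff_left: "bracket (x - y) z = bracket x z - bracket y z"
  using bracket_add_right[of x y "- z"] bracket_add_left[of x "- y" z]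
  by (simp_all add: bracket_minus_right bracket_minus_left)

lemma bracket_antisym: "bracket x y = - bracket y x"
proof -
  have "bracket (x + y) (x + y) = bracket x x + bracket y x + (bracket x y + bracket y y)"
    by (simp only: bracket_add_left bracket_add_right)
  then have "bracket x y + bracket y x = 0" by (simp add: bracket_self add.commute)
  then show ?thesis by (simp only: eq_neg_iff_add_eq_0)
qed

lemma bracket_deriv: "bracket x (bracket y z) = bracket (bracket x y) z + bracket y (bracket x z)"
proof -
  have "bracket y (bracket z x) = - bracket y (bracket x z)" "bracket z (bracket x y) = - bracket (bracket x y) z"
    using bracket_antisym[of z x] bracket_antisym[of z "bracket x y"] by (simp_all only: bracket_minus_right)
  then have "bracket x (bracket y z) - bracket y (bracket x z) - bracket (bracket x y) z = 0"
    using jacobi[of x y z] by (simp only: diff_conv_add_uminus)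
  then show ?thesis by (simp add: diff_diff_eq add.commute)
qed

end

text \<open>Applied to the adjoint action on the simple algebra and to the degree-zero action of
  \<open>h\<close> on a module.\<close>

locale nilpotent_action = lie_algebra scale bracket + V: complex_vector_space sV
  for scale :: "complex \<Rightarrow> 'g::ab_group_add \<Rightarrow> 'g" and bracket :: "'g \<Rightarrow> 'g \<Rightarrow> 'g"
    and sV :: "complex \<Rightarrow> 'v::ab_group_add \<Rightarrow> 'v" +
  fixes h :: "'g set" and act :: "'g \<Rightarrow> 'v \<Rightarrow> 'v"
  assumes subalgebra: "subalgebra h"
    and nilpotent: "\<exists>k. lower_central h k = {0}"
    and endo_act: "x \<in> h \<Longrightarrow> V.endo (act x)"
    and act_bracket: "x \<in> h \<Longrightarrow> y \<in> h \<Longrightarrow> act (bracket x y) v = act x (act y v) - act y (act x v)"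
begin

lemma lower_central_subset: "lower_central h k \<subseteq> h"
proof (induction k)
  case (Suc k)
  then have "{bracket x y | x y. x \<in> h \<and> y \<in> lower_central h k} \<subseteq> h"
    using subalgebra unfolding subalgebra_def by blast
  then show ?case using subalgebra span_minimal by (simp add: subalgebra_def)
qed simp

text \<open>In the irreducible case, an operator \<open>x\<close> whose commutators with \<open>h\<close> act by scalars is itself
  scalar: if \<open>[x, y]\<close> acts by \<open>\<kappa>\<close>, then \<open>[x, p(y)] = \<kappa> p'(y)\<close>, and \<open>\<kappa> = 0\<close> follows by choosing \<open>p\<close> of
  minimal degree.\<close>

lemma act_scalar_step:
  assumes W: "V.subspace W" "\<And>x w. x \<in> h \<Longrightarrow> w \<in> W \<Longrightarrow> act x w \<in> W" and n: "V.spanned_by n W"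
    and U: "V.subspace U" "\<And>x u. x \<in> h \<Longrightarrow> u \<in> U \<Longrightarrow> act x u \<in> U" "U \<subseteq> W" and w0: "w0 \<in> W" "w0 \<notin> U"
    and irred: "\<And>W'. V.subspace W' \<Longrightarrow> (\<And>x w. x \<in> h \<Longrightarrow> w \<in> W' \<Longrightarrow> act x w \<in> W') \<Longrightarrow> U \<subseteq> W' \<Longrightarrow> W' \<subseteq> W \<Longrightarrow>
      W' = U \<or> W' = W"
    and x: "x \<in> h" and comm: "\<And>y. y \<in> h \<Longrightarrow> \<exists>\<kappa>. \<forall>w\<in>W. act (bracket y x) w - sV \<kappa> w \<in> U"
  shows "\<exists>c. \<forall>w\<in>W. act x w - sV c w \<in> U"
proof -
  note ex = endo_act[OF x]
  obtain v c where v: "v \<in> W" "v \<notin> U" "act x v - sV c v \<in> U"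
    by (rule V.eigenvector_mod[OF ex W(1) _ n U(1) w0]) (use W(2) x in auto)
  let ?E = "{w\<in>W. act x w - sV c w \<in> U}"
  have 0: "act (bracket y x) w \<in> U" if y: "y \<in> h" and w: "w \<in> W" for y w
  proof -
    note ey = endo_act[OF y]
    let ?z = "bracket y x"
    obtain \<kappa> where \<kappa>: "\<And>w. w \<in> W \<Longrightarrow> act ?z w - sV \<kappa> w \<in> U" using comm[OF y] by blast
    obtain p where p: "p \<noteq> 0" "degree p > 0" "V.poly_op p (act y) v \<in> U"
      "\<And>q. q \<noteq> 0 \<Longrightarrow> degree q < degree p \<Longrightarrow> V.poly_op q (act y) v \<notin> U"
      by (rule V.minimal_annihilator_mod[OF ey _ v(1) n U(1) v(2)]) (use W(2) y in auto)
    have memW: "V.poly_op q (act y) v \<in> W" for q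
      by (rule V.poly_op_mem[OF ey W(1) _ v(1)]) (use W(2) y in auto)
    have deriv: "act x (V.poly_op q (act y) v) - sV c (V.poly_op q (act y) v)
        + sV \<kappa> (V.poly_op (pderiv q) (act y) v) \<in> U" for q
    proof (induction q)
      case 0
      show ?case using V.subspace_0[OF U(1)] by (simp add: V.endo_0[OF ex])
    next
      case (pCons a q)
      let ?w = "V.poly_op q (act y) v" and ?w' = "V.poly_op (pderiv q) (act y) v"
      have xy: "act x (act y ?w) = act y (act x ?w) - act ?z ?w"
        using act_bracket[OF y x, of ?w] by simp
      have 1: "sV a (act x v - sV c v) \<in> U" using v(3) U(1) by (rule V.subspace_scale[rotated])
      have 2: "act y (act x ?w - sV c ?w + sV \<kappa> ?w') \<in> U" using pCons.IH U(2) y by blast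
      have 3: "act ?z ?w - sV \<kappa> ?w \<in> U" using \<kappa> memW by blast
      have "act x (V.poly_op (pCons a q) (act y) v) - sV c (V.poly_op (pCons a q) (act y) v)
          + sV \<kappa> (V.poly_op (pderiv (pCons a q)) (act y) v)
        = sV a (act x v - sV c v) + act y (act x ?w - sV c ?w + sV \<kappa> ?w') - (act ?z ?w - sV \<kappa> ?w)"
        by (simp add: V.poly_op_pCons[OF ey] V.poly_op_add[OF ey] pderiv_pCons V.endo_simps[OF ex]
            V.endo_simps[OF ey] xy V.scale_right_distrib V.scale_right_diff_distrib mult.commute)
      then show ?case using 1 2 3 U(1) by (simp add: V.subspace_add V.subspace_diff)
    qed
    have "act x (V.poly_op p (act y) v) - sV c (V.poly_op p (act y) v) \<in> U"
      using p(3) U x by (simp add: V.subspace_diff V.subspace_scale)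
    from V.subspace_diff[OF U(1) deriv[of p] this]
    have "sV \<kappa> (V.poly_op (pderiv p) (act y) v) \<in> U" by simp
    from V.subspace_scale[OF U(1) this, of "1 / \<kappa>"]
    have "\<kappa> \<noteq> 0 \<Longrightarrow> V.poly_op (pderiv p) (act y) v \<in> U" by simp
    moreover have "pderiv p \<noteq> 0" "degree (pderiv p) < degree p"
      using p(2) by (simp_all add: pderiv_eq_0_iff degree_pderiv)
    ultimately have "\<kappa> = 0" using p(4)[of "pderiv p"] by blast
    then show ?thesis using \<kappa>[OF w] by simp
  qed
  have "?E = U \<or> ?E = W"
  proof (rule irred)
    show "V.subspace ?E" by (rule V.subspace_endo_preimage[OF V.endo_shift[OF ex] W(1) U(1)])
    show "U \<subseteq> ?E" using U x by (auto intro: V.subspace_diff V.subspace_scale)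
    fix y w assume y: "y \<in> h" and w: "w \<in> ?E"
    note ey = endo_act[OF y]
    have "act x (act y w) - sV c (act y w) = act y (act x w - sV c w) - act (bracket y x) w"
      using act_bracket[OF y x, of w] by (simp add: V.endo_simps[OF ey])
    moreover have "act y (act x w - sV c w) \<in> U" using w U(2) y by blast
    ultimately show "act y w \<in> ?E" using 0[OF y, of w] w W(2) y V.subspace_diff[OF U(1)] by auto
  qed auto
  moreover have "v \<in> ?E" using v by simp
  ultimately have "?E = W" using v by blast
  then show ?thesis by blast
qed

text \<open>Lie's theorem for nilpotent algebras, modulo \<open>U\<close>. Shrinking
  \<open>W\<close> makes it irreducible over \<open>U\<close>; then \<open>act_scalar_step\<close>
  shows that the terms of the lower central series act by scalars modulo \<open>U\<close>, starting
  from the zero term and ending with \<open>h\<close>.\<close>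

lemma simultaneous_eigenvector_mod:
  assumes W: "V.subspace W" "\<And>x w. x \<in> h \<Longrightarrow> w \<in> W \<Longrightarrow> act x w \<in> W" and n: "V.spanned_by n W"
    and U: "V.subspace U" "\<And>x u. x \<in> h \<Longrightarrow> u \<in> U \<Longrightarrow> act x u \<in> U" "U \<subseteq> W" and w0: "w0 \<in> W" "w0 \<notin> U"
  shows "\<exists>v \<kappa>. v \<in> W \<and> v \<notin> U \<and> (\<forall>x\<in>h. act x v - sV (\<kappa> x) v \<in> U)"
  using W n U(3) w0
proof (induction n arbitrary: W w0 rule: less_induct)
  case (less n)
  show ?case
  proof (cases "\<exists>W'. V.subspace W' \<and> (\<forall>x\<in>h. \<forall>w\<in>W'. act x w \<in> W') \<and> U \<subseteq> W' \<and> W' \<subseteq> W \<and> W' \<noteq> U \<and> W' \<noteq> W")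
    case True
    then obtain W' where W': "V.subspace W'" "\<forall>x\<in>h. \<forall>w\<in>W'. act x w \<in> W'" "U \<subseteq> W'" "W' \<subseteq> W" "W' \<noteq> U" "W' \<noteq> W"
      by blast
    obtain w1 where "w1 \<in> W" "w1 \<notin> W'" using W' by blast
    then obtain m where m: "n = Suc m" "V.spanned_by m W'"
      using V.spanned_by_proper_subspace[OF less.prems(3) W'(1,4)] by metis
    obtain w2 where w2: "w2 \<in> W'" "w2 \<notin> U" using W' by blast
    have "\<exists>v \<kappa>. v \<in> W' \<and> v \<notin> U \<and> (\<forall>x\<in>h. act x v - sV (\<kappa> x) v \<in> U)"
      by (rule less.IH[of m, OF _ W'(1) _ m(2) W'(3) w2]) (use m W'(2) in auto)
    then show ?thesis using W'(4) by blast
  next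
    case False
    obtain m where m: "lower_central h m = {0}" using nilpotent by blast
    have h0: "0 \<in> h" using lower_central_subset[of m] m by auto
    have "k \<le> m \<longrightarrow> (\<forall>x\<in>lower_central h k. \<exists>c. \<forall>w\<in>W. act x w - sV c w \<in> U)" for k
    proof (cases "k \<le> m")
      case True
      then have "\<forall>x\<in>lower_central h k. \<exists>c. \<forall>w\<in>W. act x w - sV c w \<in> U"
      proof (induction k rule: inc_induct)
        case base
        \<comment> \<open>0 is its own bracket with itself, so it acts by a commutator that
          cancels.\<close>
        have "act 0 w = 0" for w using act_bracket[OF h0 h0, of w] by simp
        then show ?case using m V.subspace_0[OF U(1)] by (auto intro!: exI[of _ 0])
      next
        case (step k)
        show ?case
        proof
          fix x assume x: "x \<in> lower_central h k"
          show "\<exists>c. \<forall>w\<in>W. act x w - sV c w \<in> U"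
          proof (rule act_scalar_step[OF less.prems(1) _ less.prems(3) U(1) _ less.prems(4-6)])
            show "x \<in> h" using x lower_central_subset by blast
            fix y assume "y \<in> h"
            then have "bracket y x \<in> lower_central h (Suc k)" using x by (auto intro: span_base)
            then show "\<exists>\<kappa>. \<forall>w\<in>W. act (bracket y x) w - sV \<kappa> w \<in> U" using step.IH by blast
          next
            fix W' assume "V.subspace W'" "\<And>x w. x \<in> h \<Longrightarrow> w \<in> W' \<Longrightarrow> act x w \<in> W'" "U \<subseteq> W'" "W' \<subseteq> W"
            then show "W' = U \<or> W' = W" using False by meson
          qed (use less.prems(2) U(2) in auto)
        qed
      qed
      then show ?thesis by blast
    qed simp
    from this[of 0] have "\<forall>x\<in>h. \<exists>c. act x w0 - sV c w0 \<in> U" using less.prems(5) by auto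
    then obtain \<kappa> where "\<forall>x\<in>h. act x w0 - sV (\<kappa> x) w0 \<in> U" by (rule bchoice[THEN exE])
    then show ?thesis using less.prems by blast
  qed
qed

lemma simultaneous_eigenvector:
  assumes W: "V.subspace W" "\<And>x w. x \<in> h \<Longrightarrow> w \<in> W \<Longrightarrow> act x w \<in> W" and n: "V.spanned_by n W"
    and w0: "w0 \<in> W" "w0 \<noteq> 0"
  obtains v \<kappa> where "v \<in> W" "v \<noteq> 0" "\<And>x. x \<in> h \<Longrightarrow> act x v = sV (\<kappa> x) v"
proof -
  have "\<exists>v \<kappa>. v \<in> W \<and> v \<notin> {0} \<and> (\<forall>x\<in>h. act x v - sV (\<kappa> x) v \<in> {0})"
    by (rule simultaneous_eigenvector_mod[OF W(1) _ n V.subspace_single_0 _ _ w0(1)])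
      (use W w0 V.subspace_0[OF W(1)] V.endo_0[OF endo_act] in auto)
  then show ?thesis using that by auto
qed

end

section \<open>Root space decomposition\<close>

context lie_algebra
begin

text \<open>As \<open>ad x\<close> is a derivation, \<open>ad x - (a + b)\<close> sends
  \<open>[u, v]\<close> to \<open>[(ad x - a) u, v] + [u, (ad x - b) v]\<close>, and the nested
  inductions handle one summand each.\<close>

lemma gen_eigenspace_bracket:
  assumes "u \<in> gen_eigenspace (bracket x) a" "v \<in> gen_eigenspace (bracket x) b"
  shows "bracket u v \<in> gen_eigenspace (bracket x) (a + b)"
proof -
  let ?E = "gen_eigenspace (bracket x)"
  note sub = gen_eigenspace_subspace[OF endo_bracket, of x "a + b"]
  have "\<forall>v\<in>?E b. bracket u v \<in> ?E (a + b)"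
    using assms(1) endo_bracket
  proof (induction rule: gen_eigenspace_induct)
    case zero
    then show ?case using subspace_0[OF sub] by simp
  next
    case (step u)
    show ?case
    proof
      fix v assume "v \<in> ?E b"
      then show "bracket u v \<in> ?E (a + b)" using endo_bracket
      proof (induction rule: gen_eigenspace_induct)
        case zero
        then show ?case using subspace_0[OF sub] by simp
      next
        case (step v)
        have "bracket x (bracket u v) - scale (a + b) (bracket u v)
            = bracket (bracket x u - scale a u) v + bracket u (bracket x v - scale b v)"
          by (simp add: bracket_deriv[of x u v] bracket_diff_left bracket_diff_right bracket_scale_left
              bracket_scale_right scale_left_distrib)
        also have "\<dots> \<in> ?E (a + b)"
          using \<open>\<forall>v\<in>?E b. bracket (bracket x u - scale a u) v \<in> ?E (a + b)\<close> step
          by (intro subspace_add[OF sub]) blast+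
        finally show ?case by (rule gen_eigenspace_step)
      qed
    qed
  qed
  then show ?thesis using assms(2) by blast
qed

end

locale cartan_decomposition = lie_algebra scale bracket
  for scale :: "complex \<Rightarrow> 'g::ab_group_add \<Rightarrow> 'g" and bracket :: "'g \<Rightarrow> 'g \<Rightarrow> 'g" +
  fixes h :: "'g set" and form :: "'g \<Rightarrow> 'g \<Rightarrow> complex"
  assumes finite_dimensional: "\<exists>B. finite B \<and> span B = UNIV"
    and simple: "simple"
    and cartan: "cartan_subalgebra h"
    and form: "invariant_form form"

sublocale normalized_simple_lie_algebra \<subseteq> cartan_decomposition scale bracket h form
  by unfold_locales (rule finite_dimensional simple cartan form)+

context cartan_decomposition
begin

text \<open>An arbitrary bound on the dimension; it serves as an exponent for nilpotent
  operators.\<close>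

definition dimension :: nat
  where "dimension = (SOME n. spanned_by n UNIV)"

lemma spanned: "spanned_by dimension W"
proof -
  have "\<exists>n. spanned_by n (UNIV :: 'g set)"
    using finite_dimensional unfolding spanned_by_def by (metis order_refl)
  then have "spanned_by dimension UNIV" unfolding dimension_def by (rule someI_ex)
  then show ?thesis by (rule spanned_by_mono) auto
qed

lemma subalgebra_h: "subalgebra h"
  and nilpotent_h: "\<exists>k. lower_central h k = {0}"
  and self_normalizing: "{x. \<forall>y\<in>h. bracket x y \<in> h} = h"
  using cartan by (auto simp: cartan_subalgebra_def)

lemma subspace_h: "subspace h"
  and h_bracket: "x \<in> h \<Longrightarrow> y \<in> h \<Longrightarrow> bracket x y \<in> h"
  using subalgebra_h by (auto simp: subalgebra_def)

sublocale ad: nilpotent_action scale bracket scale h bracket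
proof
  show "subalgebra h" by (rule subalgebra_h)
  show "\<exists>k. lower_central h k = {0}" by (rule nilpotent_h)
  show "endo (bracket x)" for x by (rule endo_bracket)
  show "bracket (bracket x y) v = bracket x (bracket y v) - bracket y (bracket x v)" for x y v
    by (simp add: bracket_deriv[of x y v])
qed

section \<open>The invariant form\<close>

lemma form_add_right: "form x (y + z) = form x y + form x z"
  and form_scale_right: "form x (scale c y) = c * form x y"
  and form_sym: "form x y = form y x"
  and form_invariant: "form (bracket x y) z = form x (bracket y z)"
  and form_nondegenerate: "(\<And>y. form x y = 0) \<Longrightarrow> x = 0"
  using form by (auto simp: invariant_form_def linear_functional_on_def)

lemma form_add_left: "form (x + y) z = form x z + form y z"
  and form_scale_left: "form (scale c x) z = c * form x z"
  by (simp_all add: form_sym[of _ z] form_add_right form_scale_right)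

lemma form_0_right [simp]: "form x 0 = 0"
  and form_0_left [simp]: "form 0 x = 0"
  using form_scale_right[of x 0 0] form_scale_left[of 0 0 x] by simp_all

lemma form_minus_left: "form (- x) z = - form x z"
  and form_minus_right: "form z (- x) = - form z x"
  using form_scale_left[of "-1" x z] form_scale_right[of z "-1" x] by simp_all

lemma form_diff_left: "form (x - y) z = form x z - form y z"
  and form_diff_right: "form z (x - y) = form z x - form z y"
  using form_add_left[of x "- y" z] form_add_right[of z x "- y"] by (simp_all add: form_minus_left form_minus_right)

lemma form_skew: "form (bracket x u) v = - form u (bracket x v)"
  using bracket_antisym[of x u] by (simp add: form_minus_left form_invariant)

text \<open>The same nested induction: by invariance \<open>- (a + b) * form u v\<close> is the sum
  of the values of the form on \<open>(ad x - a) u, v\<close> and on \<open>u, (ad x - b) v\<close>,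
  which both vanish by induction.\<close>

lemma form_gen_eigenspaces:
  assumes "u \<in> gen_eigenspace (bracket x) a" "v \<in> gen_eigenspace (bracket x) b" "a + b \<noteq> 0"
  shows "form u v = 0"
proof -
  let ?E = "gen_eigenspace (bracket x)"
  have "\<forall>v\<in>?E b. form u v = 0"
    using assms(1) endo_bracket
  proof (induction rule: gen_eigenspace_induct)
    case zero
    then show ?case by simp
  next
    case (step u)
    show ?case
    proof
      fix v assume "v \<in> ?E b"
      then show "form u v = 0" using endo_bracket
      proof (induction rule: gen_eigenspace_induct)
        case zero
        then show ?case by simp
      next
        case (step v)
        have "form (bracket x u - scale a u) v + form u (bracket x v - scale b v) = - (a + b) * form u v"
          using form_skew[of x u v]
          by (simp add: form_diff_left form_diff_right form_scale_left form_scale_right algebra_simps)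
        moreover have "form (bracket x u - scale a u) v = 0"
          using \<open>\<forall>v\<in>?E b. form (bracket x u - scale a u) v = 0\<close> step(1) by blast
        ultimately have "- (a + b) * form u v = 0" using step(2) by simp
        with assms(3) show ?case by (simp only: mult_eq_0_iff neg_equal_0_iff_equal) blast
      qed
    qed
  qed
  then show ?thesis using assms(2) by blast
qed

text \<open>Generalized weight spaces, for arbitrary functions \<open>\<alpha>\<close>. Values off
  \<open>h\<close> do not matter, and additivity on \<open>h\<close> is derived in
  \<open>weight_additive\<close> when the space is nonzero.\<close>

definition weight_space :: "('g \<Rightarrow> complex) \<Rightarrow> 'g set"
  where "weight_space \<alpha> = {v. \<forall>x\<in>h. v \<in> gen_eigenspace (bracket x) (\<alpha> x)}"

lemma weight_spaceD: "v \<in> weight_space \<alpha> \<Longrightarrow> x \<in> h \<Longrightarrow> v \<in> gen_eigenspace (bracket x) (\<alpha> x)"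
  by (simp add: weight_space_def)

lemma weight_space_cong: "(\<And>x. x \<in> h \<Longrightarrow> \<alpha> x = \<beta> x) \<Longrightarrow> weight_space \<alpha> = weight_space \<beta>"
  by (simp add: weight_space_def)

lemma subspace_weight_space: "subspace (weight_space \<alpha>)"
proof -
  have "weight_space \<alpha> = \<Inter> ((\<lambda>x. gen_eigenspace (bracket x) (\<alpha> x)) ` h)"
    by (auto simp: weight_space_def)
  then show ?thesis
    by (auto intro!: subspace_Inter gen_eigenspace_subspace endo_bracket)
qed

lemma root_space_subset: "root_space scale bracket h \<alpha> \<subseteq> weight_space \<alpha>"
  by (auto simp: root_space_def weight_space_def intro: eigen_gen_eigenspace)

lemma weight_space_bracket:
  "u \<in> weight_space \<alpha> \<Longrightarrow> v \<in> weight_space \<beta> \<Longrightarrow> bracket u v \<in> weight_space (\<lambda>x. \<alpha> x + \<beta> x)"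
  by (simp add: weight_space_def gen_eigenspace_bracket)

text \<open>Each application of \<open>ad x\<close> to an element of \<open>h\<close> descends one
  term of the lower central series.\<close>

lemma h_gen_eigenspace:
  assumes "x \<in> h" "y \<in> h"
  shows "y \<in> gen_eigenspace (bracket x) 0"
proof -
  obtain k where k: "lower_central h k = {0}" using nilpotent_h by blast
  have "(bracket x ^^ j) y \<in> lower_central h j" for j
    by (induction j) (use assms in \<open>auto intro!: span_base\<close>)
  from this[of k] k show ?thesis by (auto simp: gen_eigenspace_def intro!: exI[of _ k])
qed

lemma weight_space_h_stable:
  assumes "y \<in> h" "v \<in> weight_space \<alpha>"
  shows "bracket y v \<in> weight_space \<alpha>"
proof -
  have "y \<in> weight_space (\<lambda>_. 0)" using assms(1) by (simp add: weight_space_def h_gen_eigenspace)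
  from weight_space_bracket[OF this assms(2)] show ?thesis by simp
qed

text \<open>If \<open>W\<close> lies in no single generalized eigenspace of some \<open>x\<close> in
  \<open>h\<close>, its intersections with these eigenspaces are smaller and
  \<open>h\<close>-stable, and they span \<open>W\<close>. Otherwise \<open>W\<close> lies in one
  weight space.\<close>

lemma sum_weight_spaces_aux:
  assumes "subspace W" "\<And>x w. x \<in> h \<Longrightarrow> w \<in> W \<Longrightarrow> bracket x w \<in> W" "spanned_by n W"
  shows "W \<subseteq> span (\<Union>\<alpha>. weight_space \<alpha>)"
  using assms
proof (induction n arbitrary: W rule: less_induct)
  case (less n)
  show ?case
  proof (cases "\<forall>x\<in>h. \<exists>c. W \<subseteq> gen_eigenspace (bracket x) c")
    case True
    then obtain \<alpha> where "\<forall>x\<in>h. W \<subseteq> gen_eigenspace (bracket x) (\<alpha> x)" by (rule bchoice[THEN exE])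
    then have "W \<subseteq> weight_space \<alpha>" by (auto simp: weight_space_def)
    also have "\<dots> \<subseteq> (\<Union>\<alpha>. weight_space \<alpha>)" by blast
    also have "\<dots> \<subseteq> span (\<Union>\<alpha>. weight_space \<alpha>)" by (rule span_superset)
    finally show ?thesis .
  next
    case False
    then obtain x where x: "x \<in> h" "\<And>c. \<not> W \<subseteq> gen_eigenspace (bracket x) c" by blast
    have "W \<inter> gen_eigenspace (bracket x) c \<subseteq> span (\<Union>\<alpha>. weight_space \<alpha>)" for c
    proof -
      let ?E = "gen_eigenspace (bracket x) c"
      have sub: "subspace (W \<inter> ?E)"
        by (intro subspace_inter less.prems(1) gen_eigenspace_subspace endo_bracket)
      obtain w where "w \<in> W" "w \<notin> W \<inter> ?E" using x(2)[of c] by blast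
      then obtain m where m: "n = Suc m" "spanned_by m (W \<inter> ?E)"
        by (rule spanned_by_proper_subspace[OF less.prems(3) sub Int_lower1])
      have "bracket y w \<in> W \<inter> ?E" if "y \<in> h" "w \<in> W \<inter> ?E" for y w
        using that less.prems(2) gen_eigenspace_bracket[OF h_gen_eigenspace[OF x(1) that(1)], of w c] by simp
      with m show ?thesis by (intro less.IH[OF _ sub]) auto
    qed
    then have "(\<Union>c. W \<inter> gen_eigenspace (bracket x) c) \<subseteq> span (\<Union>\<alpha>. weight_space \<alpha>)" by (rule UN_least)
    then have "span (\<Union>c. W \<inter> gen_eigenspace (bracket x) c) \<subseteq> span (\<Union>\<alpha>. weight_space \<alpha>)"
      using span_minimal subspace_span by simp
    moreover have "W \<subseteq> span (\<Union>c. W \<inter> gen_eigenspace (bracket x) c)"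
      by (rule sum_gen_eigenspaces[OF endo_bracket less.prems(1) _ less.prems(3)]) (rule less.prems(2)[OF x(1)])
    ultimately show ?thesis by (rule order_trans[rotated])
  qed
qed

lemma sum_weight_spaces: "span (\<Union>\<alpha>. weight_space \<alpha>) = UNIV"
  using sum_weight_spaces_aux[OF subspace_UNIV UNIV_I spanned] by blast

text \<open>Otherwise \<open>h\<close> has an eigenvector modulo \<open>h\<close> in this space. Its
  weight is zero, so it normalizes \<open>h\<close> and must belong to \<open>h\<close>.\<close>

lemma zero_weight_space: "weight_space (\<lambda>_. 0) = h"
proof (rule ccontr)
  assume ne: "weight_space (\<lambda>_. 0) \<noteq> h"
  have sub: "h \<subseteq> weight_space (\<lambda>_. 0)" by (auto simp: weight_space_def h_gen_eigenspace)
  with ne obtain w where w: "w \<in> weight_space (\<lambda>_. 0)" "w \<notin> h" by blast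
  obtain v \<kappa> where v: "v \<in> weight_space (\<lambda>_. 0)" "v \<notin> h" "\<forall>x\<in>h. bracket x v - scale (\<kappa> x) v \<in> h"
    using ad.simultaneous_eigenvector_mod[OF subspace_weight_space weight_space_h_stable spanned subspace_h
      h_bracket sub w] by blast
  have "\<kappa> x = 0" if "x \<in> h" for x
    by (rule gen_eigenspace_eigenvalue[OF weight_spaceD[OF v(1) that] endo_bracket v(2) subspace_h])
      (use that v(3) h_bracket in auto)
  then have "\<forall>x\<in>h. bracket x v \<in> h" using v(3) by simp
  then have "\<forall>x\<in>h. bracket v x \<in> h" using bracket_antisym[of v] subspace_neg[OF subspace_h] by simp
  then have "v \<in> {x. \<forall>y\<in>h. bracket x y \<in> h}" by blast
  then show False using v(2) self_normalizing by blast
qed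

lemma root_vector:
  assumes "u \<in> weight_space \<alpha>" "u \<noteq> 0"
  obtains e where "e \<noteq> 0" "e \<in> root_space scale bracket h \<alpha>"
proof -
  obtain e \<kappa> where e: "e \<in> weight_space \<alpha>" "e \<noteq> 0" "\<And>x. x \<in> h \<Longrightarrow> bracket x e = scale (\<kappa> x) e"
    using ad.simultaneous_eigenvector[OF subspace_weight_space weight_space_h_stable spanned assms] by blast
  have "\<kappa> x = \<alpha> x" if "x \<in> h" for x
    by (rule gen_eigenspace_eigenvalue[OF weight_spaceD[OF e(1) that] endo_bracket, of "{0}"])
      (use that e in auto)
  with e that show ?thesis by (simp add: root_space_def)
qed

text \<open>Read off from a root vector, on which \<open>\<alpha>\<close> gives true
  eigenvalues.\<close>

lemma weight_additive:
  assumes "u \<in> weight_space \<alpha>" "u \<noteq> 0" "x \<in> h" "y \<in> h"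
  shows "\<alpha> (x + y) = \<alpha> x + \<alpha> y"
proof -
  obtain e where e: "e \<noteq> 0" "e \<in> root_space scale bracket h \<alpha>" by (rule root_vector[OF assms(1,2)])
  have "x + y \<in> h" using subspace_add[OF subspace_h] assms by blast
  then have "scale (\<alpha> (x + y)) e = scale (\<alpha> x) e + scale (\<alpha> y) e"
    using e(2) assms(3,4) unfolding root_space_def by (metis (mono_tags, lifting) bracket_add_left mem_Collect_eq)
  then show ?thesis using e(1) by (simp flip: scale_left_distrib)
qed

text \<open>Only weight spaces with opposite weights pair nontrivially, and all weight spaces
  together span, so nondegeneracy provides a partner in the opposite space.\<close>

lemma weight_space_dual:
  assumes "u \<in> weight_space \<alpha>" "u \<noteq> 0"
  obtains f where "f \<in> weight_space (\<lambda>x. - \<alpha> x)" "form u f = 1"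
proof -
  have "\<exists>f\<in>weight_space (\<lambda>x. - \<alpha> x). form u f \<noteq> 0"
  proof (rule ccontr)
    assume "\<not> ?thesis"
    then have opp: "form u f = 0" if "f \<in> weight_space (\<lambda>x. - \<alpha> x)" for f using that by blast
    have "form u v = 0" if v: "v \<in> weight_space \<beta>" for v \<beta>
    proof (cases "\<forall>x\<in>h. \<alpha> x + \<beta> x = 0")
      case True
      then have "weight_space \<beta> = weight_space (\<lambda>x. - \<alpha> x)"
        by (intro weight_space_cong) (simp add: eq_neg_iff_add_eq_0 add.commute)
      then show ?thesis using opp v by simp
    next
      case False
      then obtain x where "x \<in> h" "\<alpha> x + \<beta> x \<noteq> 0" by blast
      then show ?thesis using form_gen_eigenspaces weight_spaceD assms(1) v by blast
    qed
    then have "(\<Union>\<beta>. weight_space \<beta>) \<subseteq> {v. form u v = 0}" by blast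
    moreover have "subspace {v. form u v = 0}"
      by (simp add: subspace_def form_add_right form_scale_right)
    ultimately have "span (\<Union>\<beta>. weight_space \<beta>) \<subseteq> {v. form u v = 0}" by (rule span_minimal)
    then have "u = 0" unfolding sum_weight_spaces by (intro form_nondegenerate) blast
    with assms(2) show False ..
  qed
  then obtain f where f: "f \<in> weight_space (\<lambda>x. - \<alpha> x)" "form u f \<noteq> 0" by blast
  have "scale (1 / form u f) f \<in> weight_space (\<lambda>x. - \<alpha> x)"
    using f(1) by (rule subspace_scale[OF subspace_weight_space])
  moreover have "form u (scale (1 / form u f) f) = 1" using f(2) by (simp add: form_scale_right)
  ultimately show ?thesis by (rule that)
qed

text \<open>Since \<open>h\<close> is the zero weight space, a partner of \<open>t\<close> is again
  in \<open>h\<close>.\<close>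

lemma form_h_nondegenerate:
  assumes "t \<in> h" "\<And>y. y \<in> h \<Longrightarrow> form t y = 0"
  shows "t = 0"
proof (rule ccontr)
  assume "t \<noteq> 0"
  have "t \<in> weight_space (\<lambda>_. 0)" using assms(1) zero_weight_space by simp
  then obtain f where "f \<in> weight_space (\<lambda>_. - 0)" "form t f = 1" by (rule weight_space_dual[OF _ \<open>t \<noteq> 0\<close>])
  then show False using assms(2)[of f] zero_weight_space by simp
qed

text \<open>\<open>t\<close> corresponds to \<open>\<alpha>\<close> under the form, and
  \<open>\<alpha> t\<close> is the squared length of \<open>\<alpha>\<close>.\<close>

definition represents :: "'g \<Rightarrow> ('g \<Rightarrow> complex) \<Rightarrow> bool"
  where "represents t \<alpha> \<longleftrightarrow> t \<in> h \<and> (\<forall>y\<in>h. form t y = \<alpha> y)"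

lemma represents_unique: "represents t \<alpha> \<Longrightarrow> represents t' \<alpha> \<Longrightarrow> t = t'"
  using form_h_nondegenerate[of "t - t'"]
  by (simp add: represents_def form_diff_left subspace_diff[OF subspace_h])

section \<open>Root vectors and isotropy of weights\<close>

lemma root_opposite_bracket:
  assumes e: "e \<in> root_space scale bracket h \<alpha>" and f: "f \<in> weight_space (\<lambda>x. - \<alpha> x)"
  shows "bracket e f \<in> h" "y \<in> h \<Longrightarrow> form (bracket e f) y = form e f * \<alpha> y"
proof -
  have "bracket e f \<in> weight_space (\<lambda>x. \<alpha> x + - \<alpha> x)"
    using e f root_space_subset by (intro weight_space_bracket) auto
  then show "bracket e f \<in> h" by (simp add: zero_weight_space)
  assume "y \<in> h"
  then have ye: "bracket y e = scale (\<alpha> y) e" using e by (simp add: root_space_def)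
  have "form (bracket e f) y = form e (bracket f y)" by (rule form_invariant)
  also have "\<dots> = - form e (bracket y f)" using bracket_antisym[of f y] by (simp add: form_minus_right)
  also have "\<dots> = form (bracket y e) f" by (simp add: form_skew)
  also have "\<dots> = form e f * \<alpha> y" by (simp add: ye form_scale_left)
  finally show "form (bracket e f) y = form e f * \<alpha> y" .
qed

lemma root_bracket_represents:
  assumes "e \<in> root_space scale bracket h \<alpha>" "f \<in> weight_space (\<lambda>x. - \<alpha> x)" "represents t \<alpha>"
  shows "bracket e f = scale (form e f) t"
proof -
  have "bracket e f - scale (form e f) t \<in> h"
    using root_opposite_bracket(1)[OF assms(1,2)] assms(3)
    by (auto simp: represents_def intro: subspace_diff[OF subspace_h] subspace_scale[OF subspace_h])
  then have "bracket e f - scale (form e f) t = 0"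
    using root_opposite_bracket(2)[OF assms(1,2)] assms(3)
    by (intro form_h_nondegenerate) (simp_all add: represents_def form_diff_left form_scale_left)
  then show ?thesis by simp
qed

text \<open>The representing element is the bracket of a root vector with a partner of pairing 1, so
  no basis of \<open>h\<close> has to be chosen.\<close>

lemma represents_exists:
  assumes "u \<in> weight_space \<alpha>" "u \<noteq> 0"
  obtains t where "represents t \<alpha>"
proof -
  obtain e where e: "e \<noteq> 0" "e \<in> root_space scale bracket h \<alpha>" by (rule root_vector[OF assms])
  then obtain f where f: "f \<in> weight_space (\<lambda>x. - \<alpha> x)" "form e f = 1"
    using weight_space_dual[of e \<alpha>] root_space_subset by blast
  have "represents (bracket e f) \<alpha>"
    using root_opposite_bracket[OF e(2) f(1)] f(2) by (simp add: represents_def)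
  then show ?thesis by (rule that)
qed

lemma root_vector_nilpotent:
  assumes "e \<in> root_space scale bracket h \<alpha>" "y \<in> h" "\<alpha> y \<noteq> 0"
  shows "(bracket e ^^ dimension) v = 0"
proof (rule shift_nilpotent[OF endo_bracket endo_bracket subspace_UNIV UNIV_I UNIV_I spanned assms(3)])
  show "bracket y (bracket e w) = bracket e (bracket y w) + scale (\<alpha> y) (bracket e w)" for w
    using assms(1,2) by (simp add: bracket_deriv[of y e w] root_space_def bracket_scale_left)
qed auto

text \<open>Makes the opposite weight space at most one-dimensional. An eigenvector
  \<open>f'\<close> of \<open>t\<close> in the kernel of the pairing is killed by
  \<open>ad e\<close> and has weight \<open>- \<alpha> t\<close>. The commutator formula then places
  it in the image of every power of \<open>ad e\<close>, against nilpotency.\<close>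

lemma nonisotropic_pairing:
  assumes e: "e \<in> root_space scale bracket h \<alpha>" "e \<noteq> 0" and t: "represents t \<alpha>" "\<alpha> t \<noteq> 0"
    and f0: "f0 \<in> weight_space (\<lambda>x. - \<alpha> x)" "form e f0 = 0"
  shows "f0 = 0"
proof (rule ccontr)
  assume "f0 \<noteq> 0"
  have th: "t \<in> h" using t by (simp add: represents_def)
  have te: "bracket t e = scale (\<alpha> t) e" using e th by (simp add: root_space_def)
  let ?F = "{f \<in> weight_space (\<lambda>x. - \<alpha> x). form e f \<in> {0}}"
  have subF: "subspace ?F"
    using subspace_weight_space[of "\<lambda>x. - \<alpha> x"] by (simp add: subspace_def form_add_right form_scale_right)
  have tF: "bracket t f \<in> ?F" if "f \<in> ?F" for f
  proof -
    have "form e (bracket t f) = - form (bracket t e) f" by (simp add: form_skew)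
    also have "\<dots> = 0" using that by (simp add: te form_scale_left)
    finally show ?thesis using that weight_space_h_stable[OF th] by blast
  qed
  have "f0 \<in> ?F" using f0 by simp
  then obtain f' a where f': "f' \<in> ?F" "f' \<noteq> 0" "bracket t f' = scale a f'"
    using eigenvector[OF endo_bracket subF tF spanned _ \<open>f0 \<noteq> 0\<close>] by blast
  have "a = - \<alpha> t"
    by (rule gen_eigenspace_eigenvalue[OF weight_spaceD[of f' "\<lambda>x. - \<alpha> x" t] endo_bracket, of "{0}"])
      (use f' th in auto)
  obtain f where f: "f \<in> weight_space (\<lambda>x. - \<alpha> x)" "form e f = 1"
    using weight_space_dual[OF _ e(2)] e(1) root_space_subset by blast
  have ef: "bracket e f = t" using root_bracket_represents[OF e(1) f(1) t(1)] f(2) by simp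
  have ef': "bracket e f' = 0" using root_bracket_represents[OF e(1) _ t(1), of f'] f'(1) by simp
  have "\<exists>w. f' = (bracket e ^^ n) w" for n
  proof (induction n)
    case (Suc n)
    then obtain w where w: "f' = (bracket e ^^ n) w" by blast
    have 0: "(bracket e ^^ Suc n) w = 0" using ef' w by simp
    have "(bracket e ^^ Suc n) (bracket f w) = bracket f ((bracket e ^^ Suc n) w)
        + scale (of_nat (Suc n)) (bracket t ((bracket e ^^ n) w))
        - scale (\<alpha> t * of_nat n * of_nat (Suc n) / 2) ((bracket e ^^ n) w)"
      by (rule power_commutator[OF endo_bracket endo_bracket endo_bracket])
        (simp_all add: bracket_deriv[of e f] bracket_deriv[of t e] ef te bracket_scale_left add.commute)
    \<comment> \<open>With \<open>N = n + 1\<close> the factors combine as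
      \<open>- \<alpha> t N - \<alpha> t n N / 2\<close>, that is
      \<open>- \<alpha> t N (N + 1) / 2\<close>, which is nonzero with
      \<open>\<alpha> t\<close>.\<close>
    also have "\<dots> = scale (- \<alpha> t * (of_nat (Suc n) * of_nat (Suc (Suc n)) / 2)) f'"
      unfolding 0 w[symmetric] f'(3) \<open>a = - \<alpha> t\<close> bracket_0_right scale_scale scale_left_diff_distrib[symmetric] add_0_left
      by (rule arg_cong[of _ _ "\<lambda>c. scale c f'"]) (simp add: field_simps)
    finally have "(bracket e ^^ Suc n) (bracket f w) = scale (- \<alpha> t * (of_nat (Suc n) * of_nat (Suc (Suc n)) / 2)) f'" .
    moreover have "- \<alpha> t * (of_nat (Suc n) * of_nat (Suc (Suc n)) / 2) \<noteq> 0"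
      using t(2) by (simp del: of_nat_Suc)
    ultimately have "f' = scale (1 / (- \<alpha> t * (of_nat (Suc n) * of_nat (Suc (Suc n)) / 2))) ((bracket e ^^ Suc n) (bracket f w))"
      by (simp del: of_nat_Suc funpow.simps)
    also have "\<dots> = (bracket e ^^ Suc n) (scale (1 / (- \<alpha> t * (of_nat (Suc n) * of_nat (Suc (Suc n)) / 2))) (bracket f w))"
      by (rule endo_scale[OF endo_pow[OF endo_bracket], symmetric])
    finally show ?case by (rule exI)
  qed auto
  then obtain w where "f' = (bracket e ^^ dimension) w" by blast
  then show False using root_vector_nilpotent[OF e(1) th t(2)] f'(2) by simp
qed

text \<open>For \<open>x\<close> in \<open>h\<close>, subtracting a suitable multiple of
  \<open>v\<close> from \<open>[x, v]\<close> puts it into the kernel of the pairing with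
  \<open>e\<close>, so \<open>v\<close> is an eigenvector of \<open>x\<close>.\<close>

lemma nonisotropic_opposite:
  assumes "u \<in> weight_space \<alpha>" "u \<noteq> 0" and t: "represents t \<alpha>" "\<alpha> t \<noteq> 0"
  shows "weight_space (\<lambda>x. - \<alpha> x) \<subseteq> root_space scale bracket h (\<lambda>x. - \<alpha> x)"
proof
  fix v assume v: "v \<in> weight_space (\<lambda>x. - \<alpha> x)"
  obtain e where e: "e \<noteq> 0" "e \<in> root_space scale bracket h \<alpha>" by (rule root_vector[OF assms(1,2)])
  show "v \<in> root_space scale bracket h (\<lambda>x. - \<alpha> x)"
  proof (cases "v = 0")
    case True
    then show ?thesis by (simp add: root_space_def)
  next
    case False
    have "form e v \<noteq> 0" using nonisotropic_pairing[OF e(2,1) t v] False by blast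
    have "bracket x v = scale (- \<alpha> x) v" if x: "x \<in> h" for x
    proof -
      let ?c = "form e (bracket x v) / form e v"
      have 0: "bracket x v - scale ?c v = 0"
      proof (rule nonisotropic_pairing[OF e(2,1) t])
        show "bracket x v - scale ?c v \<in> weight_space (\<lambda>x. - \<alpha> x)"
          by (intro subspace_diff[OF subspace_weight_space] subspace_scale[OF subspace_weight_space]
              weight_space_h_stable x v)
        show "form e (bracket x v - scale ?c v) = 0"
          using \<open>form e v \<noteq> 0\<close> by (simp add: form_diff_right form_scale_right)
      qed
      then have c: "?c = - \<alpha> x"
        by (intro gen_eigenspace_eigenvalue[OF weight_spaceD[OF v x] endo_bracket, of "{0}"]) (use False in auto)
      from 0 show ?thesis by (simp only: c right_minus_eq)
    qed
    then show ?thesis by (simp add: root_space_def)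
  qed
qed

text \<open>The previous lemma for \<open>- \<alpha>\<close>, which \<open>- t\<close> represents
  with the same squared length.\<close>

lemma nonisotropic_root_space:
  assumes "u \<in> weight_space \<alpha>" "u \<noteq> 0" and t: "represents t \<alpha>" "\<alpha> t \<noteq> 0"
  shows "weight_space \<alpha> \<subseteq> root_space scale bracket h \<alpha>"
proof -
  obtain f where f: "f \<in> weight_space (\<lambda>x. - \<alpha> x)" "form u f = 1" by (rule weight_space_dual[OF assms(1,2)])
  then have "f \<noteq> 0" by auto
  have th: "t \<in> h" using t by (simp add: represents_def)
  have t': "represents (- t) (\<lambda>x. - \<alpha> x)"
    using t by (simp add: represents_def form_minus_left subspace_neg[OF subspace_h])
  have "\<alpha> (- t) = - \<alpha> t"
    using weight_additive[OF assms(1,2) th, of "- t"] weight_additive[OF assms(1,2), of 0 0] subspace_0[OF subspace_h]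
      subspace_neg[OF subspace_h th] by (simp add: eq_neg_iff_add_eq_0 add.commute)
  with t(2) have "- \<alpha> (- t) \<noteq> 0" by simp
  from nonisotropic_opposite[OF f(1) \<open>f \<noteq> 0\<close> t' this] show ?thesis by simp
qed

text \<open>As in a Heisenberg algebra, \<open>e\<close> and \<open>f\<close> have bracket
  \<open>t\<close>, which commutes with \<open>e\<close>. On the generalized eigenspace
  \<open>?M\<close> of \<open>t\<close> for a nonzero \<open>\<beta> t\<close>, the operator
  \<open>ad t\<close> is injective, and \<open>[e^(n+1), f] = (n + 1) t e^n\<close> lowers the
  nilpotency exponent of \<open>e\<close> step by step to 0, so \<open>?M = 0\<close>.\<close>

lemma isotropic_orthogonal:
  assumes u: "u \<in> weight_space \<alpha>" "u \<noteq> 0" and t: "represents t \<alpha>" "\<alpha> t = 0"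
    and v: "v \<in> weight_space \<beta>" "v \<noteq> 0"
  shows "\<beta> t = 0"
proof (cases "\<forall>y\<in>h. \<alpha> y = 0")
  case True
  then have "t = 0" using t(1) by (intro form_h_nondegenerate) (auto simp: represents_def)
  then show ?thesis using weight_additive[OF v, of 0 0] subspace_0[OF subspace_h] by simp
next
  case False
  then obtain y where y: "y \<in> h" "\<alpha> y \<noteq> 0" by blast
  have th: "t \<in> h" using t by (simp add: represents_def)
  obtain e where e: "e \<noteq> 0" "e \<in> root_space scale bracket h \<alpha>" by (rule root_vector[OF u])
  obtain f where f: "f \<in> weight_space (\<lambda>x. - \<alpha> x)" "form e f = 1"
    using weight_space_dual[OF _ e(1)] e(2) root_space_subset by blast
  have ef: "bracket e f = t" using root_bracket_represents[OF e(2) f(1) t(1)] f(2) by simp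
  have te: "bracket t e = 0" using e th t(2) by (simp add: root_space_def)
  show ?thesis
  proof (rule ccontr)
    assume b: "\<beta> t \<noteq> 0"
    let ?M = "gen_eigenspace (bracket t) (\<beta> t)"
    have eM: "bracket e w \<in> ?M" if "w \<in> ?M" for w
      using gen_eigenspace_bracket[OF eigen_gen_eigenspace[of "bracket t" e 0] that] te by simp
    have fM: "bracket f w \<in> ?M" if "w \<in> ?M" for w
      using gen_eigenspace_bracket[OF weight_spaceD[OF f(1) th] that] t(2) by simp
    have "w = 0" if "\<forall>w\<in>?M. (bracket e ^^ n) w = 0" "w \<in> ?M" for w n
      using that
    proof (induction n arbitrary: w)
      case (Suc n)
      have "(bracket e ^^ n) w = 0" if w: "w \<in> ?M" for w
      proof (rule ccontr)
        assume ne: "(bracket e ^^ n) w \<noteq> 0"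
        have "(bracket e ^^ Suc n) (bracket f w) = bracket f ((bracket e ^^ Suc n) w)
            + scale (of_nat (Suc n)) (bracket t ((bracket e ^^ n) w))
            - scale (0 * of_nat n * of_nat (Suc n) / 2) ((bracket e ^^ n) w)"
          by (rule power_commutator[OF endo_bracket endo_bracket endo_bracket])
            (simp_all add: bracket_deriv[of e f] bracket_deriv[of t e] ef te add.commute)
        moreover have "(bracket e ^^ Suc n) (bracket f w) = 0" "(bracket e ^^ Suc n) w = 0"
          using Suc.prems(1) fM w by blast+
        ultimately have "scale (of_nat (Suc n)) (bracket t ((bracket e ^^ n) w)) = 0"
          by (simp only: bracket_0_right mult_zero_left div_0 scale_zero_left add_0_left diff_zero)
        then have 0: "bracket t ((bracket e ^^ n) w) = 0" by (simp del: of_nat_Suc)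
        have "(bracket e ^^ n) w \<in> ?M" by (rule pow_mem[OF eM w])
        then have "0 = \<beta> t"
          by (rule gen_eigenspace_eigenvalue[OF _ endo_bracket, of _ _ _ "{0}"]) (use ne 0 in auto)
        with b show False by simp
      qed
      then show ?case using Suc.IH Suc.prems(2) by blast
    qed simp
    moreover have "\<forall>w\<in>?M. (bracket e ^^ dimension) w = 0"
      using root_vector_nilpotent[OF e(2) y] by blast
    ultimately have "v = 0" using weight_spaceD[OF v(1) th] by blast
    with v(2) show False ..
  qed
qed

definition root_span :: "'g set"
  where "root_span = span (\<Union>\<alpha>. root_space scale bracket h \<alpha>)"

lemma root_space_bracket:
  assumes "u \<in> root_space scale bracket h \<alpha>" "v \<in> root_space scale bracket h \<beta>"
  shows "bracket u v \<in> root_space scale bracket h (\<lambda>x. \<alpha> x + \<beta> x)"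
  using assms
  by (simp add: root_space_def bracket_deriv[of _ u v] bracket_scale_left bracket_scale_right scale_left_distrib)

lemma root_span_bracket:
  assumes s: "s \<in> root_space scale bracket h \<alpha>" and w: "w \<in> root_span"
  shows "bracket s w \<in> root_span"
proof (rule endo_stable_span[OF endo_bracket _ _ w[unfolded root_span_def]])
  fix b assume "b \<in> (\<Union>\<alpha>. root_space scale bracket h \<alpha>)"
  then obtain \<beta> where "b \<in> root_space scale bracket h \<beta>" by blast
  from root_space_bracket[OF s this] show "bracket s b \<in> root_span"
    unfolding root_span_def by (intro span_base UN_I UNIV_I)
qed (simp add: root_span_def)

text \<open>The isotropic weights form the radical of the form on the weights, so the subalgebra generated by
  the nonisotropic weight spaces is an ideal. It is nonzero as soon as one weight is nonisotropic, and
  nonisotropic weight spaces are root spaces.\<close>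

lemma root_span_UNIV:
  assumes \<theta>: "u0 \<in> weight_space \<theta>" "u0 \<noteq> 0" "represents t0 \<theta>" "\<theta> t0 \<noteq> 0"
  shows "root_span = UNIV"
proof -
  define S where "S = {s. \<exists>\<alpha> t. s \<in> weight_space \<alpha> \<and> represents t \<alpha> \<and> \<alpha> t \<noteq> 0}"
  define closed where "closed W \<longleftrightarrow> subspace W \<and> S \<subseteq> W \<and> (\<forall>s\<in>S. \<forall>w\<in>W. bracket s w \<in> W)" for W
  \<comment> \<open>As the least closed subspace, \<open>J\<close> is bounded from above by
    exhibiting any closed subspace.\<close>
  define J where "J = \<Inter> {W. closed W}"
  have J_least: "J \<subseteq> W" if "closed W" for W using that by (auto simp: J_def)
  have subJ: "subspace J" unfolding J_def by (rule subspace_Inter) (simp add: closed_def)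
  have SJ: "s \<in> J" if "s \<in> S" for s using that by (auto simp: J_def closed_def)
  have S_bracket: "bracket s w \<in> J" if "s \<in> S" "w \<in> J" for s w
    using that by (auto simp: J_def closed_def)
  \<comment> \<open>A weight vector outside \<open>S\<close> has isotropic weight, orthogonal to all
    weights, so adding this weight to that of \<open>s\<close> leaves the squared length
    unchanged.\<close>
  have S_or: "y \<in> S \<or> (\<forall>s\<in>S. bracket y s \<in> S)" if y: "y \<in> weight_space \<beta>" for y \<beta>
  proof (unfold disj_imp, rule impI)
    assume yS: "y \<notin> S"
    show "\<forall>s\<in>S. bracket y s \<in> S"
    proof
      fix s assume "s \<in> S"
      then obtain \<alpha> t where s: "s \<in> weight_space \<alpha>" "represents t \<alpha>" "\<alpha> t \<noteq> 0" by (auto simp: S_def)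
      show "bracket y s \<in> S"
      proof (cases "bracket y s = 0")
        case True
        \<comment> \<open>\<open>S\<close> asks for a nonisotropic weight even for the zero vector;
          \<open>\<theta>\<close> provides one.\<close>
        then show ?thesis using \<theta>(3,4) subspace_0[OF subspace_weight_space[of \<theta>]] by (auto simp: S_def)
      next
        case False
        then have y0: "y \<noteq> 0" and s0: "s \<noteq> 0" by auto
        obtain t' where t': "represents t' \<beta>" by (rule represents_exists[OF y y0])
        have "\<beta> t' = 0" using yS y t' by (auto simp: S_def)
        then have \<alpha>t': "\<alpha> t' = 0" by (rule isotropic_orthogonal[OF y y0 t' _ s(1) s0])
        have th: "t \<in> h" "t' \<in> h" using s t' by (simp_all add: represents_def)
        have "\<beta> t = form t' t" using t' th by (simp add: represents_def)
        also have "\<dots> = \<alpha> t'" using s(2) th by (simp add: represents_def form_sym[of t'])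
        finally have \<beta>t: "\<beta> t = 0" using \<alpha>t' by simp
        have "represents (t' + t) (\<lambda>x. \<beta> x + \<alpha> x)"
          using s(2) t' by (simp add: represents_def form_add_left subspace_add[OF subspace_h])
        moreover have "\<beta> (t' + t) + \<alpha> (t' + t) \<noteq> 0"
          using weight_additive[OF y y0 th(2,1)] weight_additive[OF s(1) s0 th(2,1)] \<alpha>t' \<beta>t \<open>\<beta> t' = 0\<close> s(3)
          by simp
        moreover have "bracket y s \<in> weight_space (\<lambda>x. \<beta> x + \<alpha> x)" by (rule weight_space_bracket[OF y s(1)])
        ultimately show ?thesis unfolding S_def by blast
      qed
    qed
  qed
  \<comment> \<open>The part of \<open>J\<close> that all weight vectors bracket back into
    \<open>J\<close>. It is closed, so by minimality it is all of \<open>J\<close>, which makes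
    \<open>J\<close> an ideal.\<close>
  define W where "W = {w\<in>J. \<forall>y\<in>(\<Union>\<beta>. weight_space \<beta>). bracket y w \<in> J}"
  have "closed W"
    unfolding closed_def
  proof (intro conjI ballI)
    show "subspace W"
      using subJ by (auto simp: W_def subspace_def bracket_add_right bracket_scale_right)
    show "S \<subseteq> W"
    proof
      fix s assume s: "s \<in> S"
      have "bracket y s \<in> J" if "y \<in> weight_space \<beta>" for y \<beta>
        using S_or[OF that] s SJ S_bracket[OF _ SJ[OF s]] by blast
      with SJ[OF s] show "s \<in> W" by (auto simp: W_def)
    qed
    fix s w assume s: "s \<in> S" and w: "w \<in> W"
    have wJ: "w \<in> J" using w by (simp add: W_def)
    have "bracket y (bracket s w) \<in> J" if y: "y \<in> weight_space \<beta>" for y \<beta>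
    proof (cases "y \<in> S")
      case True
      then show ?thesis using S_bracket s wJ by blast
    next
      case False
      then have "bracket (bracket y s) w \<in> J" using S_or[OF y] s S_bracket wJ by blast
      moreover have "bracket y w \<in> J" using w y by (auto simp: W_def)
      ultimately show ?thesis unfolding bracket_deriv[of y s w]
        using S_bracket[OF s] subspace_add[OF subJ] by blast
    qed
    then show "bracket s w \<in> W" using S_bracket[OF s wJ] by (auto simp: W_def)
  qed
  then have JW: "J \<subseteq> W" by (rule J_least)
  have "bracket x w \<in> J" if "w \<in> J" for x w
  proof -
    have "(\<Union>\<beta>. weight_space \<beta>) \<subseteq> {y. bracket y w \<in> J}" using JW that by (auto simp: W_def)
    moreover have "subspace {y. bracket y w \<in> J}"
      using subJ by (auto simp: subspace_def bracket_add_left bracket_scale_left)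
    ultimately have "span (\<Union>\<beta>. weight_space \<beta>) \<subseteq> {y. bracket y w \<in> J}" by (rule span_minimal)
    then show ?thesis unfolding sum_weight_spaces by blast
  qed
  then have "ideal J" using subJ by (simp add: ideal_def)
  moreover have "u0 \<in> S" using \<theta> by (auto simp: S_def)
  then have "J \<noteq> {0}" using SJ \<theta>(2) by blast
  ultimately have "J = UNIV" using simple by (auto simp: simple_def)
  have S_root: "\<exists>\<alpha>. s \<in> root_space scale bracket h \<alpha>" if "s \<in> S" for s
  proof (cases "s = 0")
    case True
    then show ?thesis by (auto simp: root_space_def)
  next
    case False
    obtain \<alpha> t where "s \<in> weight_space \<alpha>" "represents t \<alpha>" "\<alpha> t \<noteq> 0" using \<open>s \<in> S\<close> by (auto simp: S_def)
    then show ?thesis using nonisotropic_root_space[of s \<alpha> t] False by blast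
  qed
  have "closed root_span"
    unfolding closed_def
  proof (intro conjI ballI subsetI)
    show "subspace root_span" by (simp add: root_span_def)
    fix s assume "s \<in> S"
    then obtain \<alpha> where s: "s \<in> root_space scale bracket h \<alpha>" using S_root by blast
    show "s \<in> root_span" unfolding root_span_def using s by (intro span_base UN_I UNIV_I)
    show "bracket s w \<in> root_span" if "w \<in> root_span" for w by (rule root_span_bracket[OF s that])
  qed
  then show ?thesis using J_least \<open>J = UNIV\<close> by blast
qed

lemma perfect: "span {bracket x y | x y. True} = UNIV"
proof -
  have "ideal (span {bracket x y | x y. True})"
    unfolding ideal_def by (auto intro!: span_base)
  moreover obtain x y where "bracket x y \<noteq> 0" using simple by (auto simp: simple_def)
  then have "span {bracket x y | x y. True} \<noteq> {0}"
    by (metis (mono_tags, lifting) mem_Collect_eq singletonD span_base)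
  ultimately show ?thesis using simple by (auto simp: simple_def)
qed

text \<open>By polarization. Such an \<open>x\<close> gives access to the centre: in the bracket of
  two loop elements built from the same \<open>x\<close> only the central term survives.\<close>

lemma form_square_nonzero: "\<exists>x. form x x \<noteq> 0"
proof (rule ccontr)
  assume "\<not> ?thesis"
  then have sq: "form x x = 0" for x by blast
  have zero: "form x y = 0" for x y
    using sq[of "x + y"] sq[of x] sq[of y] form_sym[of x y] by (simp add: form_add_left form_add_right)
  have "x = 0" for x :: 'g by (rule form_nondegenerate) (rule zero)
  then show False using simple by (metis simple_def)
qed

text \<open>In both cases the weights do not add up to zero. This removes the central terms from
  brackets of loop elements over \<open>x\<close> with each other and with those over
  \<open>h\<close>.\<close>

lemma form_root_vectors:
  assumes "x \<in> root_space scale bracket h \<alpha>" "y0 \<in> h" "\<alpha> y0 \<noteq> 0"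
  shows "form x x = 0" "y \<in> h \<Longrightarrow> form y x = 0"
proof -
  have x: "x \<in> gen_eigenspace (bracket y0) (\<alpha> y0)"
    using assms root_space_subset by (blast dest: weight_spaceD)
  show "form x x = 0" using form_gen_eigenspaces[OF x x] assms(3) by simp
  show "form y x = 0" if "y \<in> h"
    using form_gen_eigenspaces[OF h_gen_eigenspace[OF assms(2) that] x] assms(3) by simp
qed

end

context normalized_simple_lie_algebra
begin

text \<open>The normalization gives \<open>\<theta> t = 2\<close>, so this is an
  \<open>sl_2\<close>-triple. With \<open>form e f = 1\<close>, its version in degrees
  \<open>r\<close> and \<open>-r\<close> has middle element \<open>t\<close> plus the central
  element of \<open>vec_of_int r\<close>.\<close>

lemma highest_root_triple:
  obtains e f t where "e \<in> root_space scale bracket h \<theta>" "f \<in> root_space scale bracket h (\<lambda>x. - \<theta> x)"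
    "t \<in> h" "bracket e f = t" "form e f = 1" "\<theta> t = 2" "root_span = UNIV"
proof -
  have "\<theta> \<in> roots h" using highest by (simp add: highest_root_def)
  then obtain e where e: "e \<noteq> 0" "e \<in> root_space scale bracket h \<theta>"
    by (auto simp: roots_def root_space_def)
  then have ew: "e \<in> weight_space \<theta>" using root_space_subset by blast
  obtain f where f: "f \<in> weight_space (\<lambda>x. - \<theta> x)" "form e f = 1" by (rule weight_space_dual[OF ew e(1)])
  obtain t where t: "represents t \<theta>" by (rule represents_exists[OF ew e(1)])
  \<comment> \<open>\<open>dual_form\<close> is defined through a definite description, evaluated
    here by uniqueness of the representing element.\<close>
  have "(THE t. t \<in> h \<and> (\<forall>y\<in>h. form t y = \<theta> y)) = t"
    using t represents_unique[OF _ t] unfolding represents_def by (intro the_equality)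
  then have "form t t = 2" using normalized by (simp add: dual_form_def Let_def)
  then have 2: "\<theta> t = 2" using t by (simp add: represents_def)
  then have t2: "\<theta> t \<noteq> 0" by simp
  have "f \<in> root_space scale bracket h (\<lambda>x. - \<theta> x)"
    using nonisotropic_opposite[OF ew e(1) t t2] f(1) by blast
  moreover have "t \<in> h" using t by (simp add: represents_def)
  moreover have "bracket e f = t" using root_bracket_represents[OF e(2) f(1) t] f(2) by simp
  ultimately show ?thesis using that e(2) f(2) 2 root_span_UNIV[OF ew e(1) t t2] by blast
qed

end

section \<open>Bases of the lattice\<close>

text \<open>The linear map \<open>m \<mapsto> m + l(m) u\<close>, with \<open>l\<close> read as a
  functional.\<close>

definition transvection :: "int ^ 'n \<Rightarrow> int ^ 'n \<Rightarrow> int ^ 'n ^ 'n"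
  where "transvection u l = (\<chi> i j. (if i = j then 1 else 0) + u $ i * l $ j)"

lemma transvection_mult:
  "transvection u l *v m = m + (\<Sum>j\<in>UNIV. l $ j * m $ j) *s u"
proof -
  have "(\<Sum>j\<in>UNIV. ((if i = j then 1 else 0) + u $ i * l $ j) * m $ j) = m $ i + (\<Sum>j\<in>UNIV. l $ j * m $ j) * u $ i"
    for i
  proof -
    have "(\<Sum>j\<in>UNIV. ((if i = j then 1 else 0) + u $ i * l $ j) * m $ j)
        = (\<Sum>j\<in>UNIV. (if j = i then m $ i else 0) + (l $ j * m $ j) * u $ i)"
      by (intro sum.cong) (auto simp: algebra_simps)
    then show ?thesis by (simp add: sum.distrib sum_distrib_right)
  qed
  then show ?thesis by (simp add: transvection_def matrix_vector_mult_def vec_eq_iff)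
qed

text \<open>As \<open>l\<close> vanishes on \<open>u\<close>, the transvection by \<open>- u\<close>
  undoes the one by \<open>u\<close>.\<close>

lemma invertible_transvection:
  assumes "(\<Sum>j\<in>UNIV. l $ j * u $ j) = 0"
  shows "invertible (transvection u (l :: int ^ 'n))"
proof -
  have 1: "(\<Sum>j\<in>UNIV. l $ j * (m + c *s u) $ j) = (\<Sum>j\<in>UNIV. l $ j * m $ j)" for c m
  proof -
    have "(\<Sum>j\<in>UNIV. l $ j * (m + c *s u) $ j) = (\<Sum>j\<in>UNIV. l $ j * m $ j) + c * (\<Sum>j\<in>UNIV. l $ j * u $ j)"
      by (simp add: distrib_left sum.distrib sum_distrib_left mult.left_commute)
    then show ?thesis using assms by simp
  qed
  have neg: "transvection (- u) l *v m = m + (- (\<Sum>j\<in>UNIV. l $ j * m $ j)) *s u" for m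
    by (simp add: transvection_mult vec_eq_iff)
  have "transvection u l ** transvection (- u) l = mat 1" "transvection (- u) l ** transvection u l = mat 1"
    unfolding matrix_eq matrix_vector_mul_assoc[symmetric]
    by (simp_all only: neg transvection_mult[of u] 1) (simp_all add: vec_eq_iff algebra_simps)
  then show ?thesis unfolding invertible_def by blast
qed

lemma invertible_matrix_inv:
  assumes "invertible (A :: int ^ 'n ^ 'n)"
  shows "invertible (matrix_inv A)" "matrix_inv (matrix_inv A) = A"
proof -
  show inv: "invertible (matrix_inv A)"
    unfolding invertible_def using matrix_inv_int[OF assms] by blast
  have "matrix_inv (matrix_inv A) = matrix_inv (matrix_inv A) ** (matrix_inv A ** A)"
    by (simp add: matrix_inv_int[OF assms])
  then show "matrix_inv (matrix_inv A) = A"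
    by (simp only: matrix_mul_assoc matrix_inv_int[OF inv] matrix_mul_lid)
qed

lemma matrix_vector_scale_int: "(A :: int ^ 'n ^ 'm) *v (c *s m) = c *s (A *v m)"
  by (simp add: matrix_vector_mult_def vec_eq_iff sum_distrib_left mult.left_commute)

text \<open>Euclid's algorithm by elementary matrices, with the sum of absolute values as measure.
  It stops at a vector with at most one nonzero entry.\<close>

lemma multiple_of_basis_vector:
  fixes k :: "int ^ 'n"
  shows "\<exists>(P :: int ^ 'n ^ 'n) i g. invertible P \<and> k = g *s (P *v axis i 1)"
proof (induction "nat (\<Sum>i\<in>UNIV. \<bar>k $ i\<bar>)" arbitrary: k rule: less_induct)
  case less
  show ?case
  proof (cases "\<exists>a b. a \<noteq> b \<and> k $ a \<noteq> 0 \<and> k $ b \<noteq> 0")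
    case True
    then obtain a b where ab: "a \<noteq> b" "k $ b \<noteq> 0" "\<bar>k $ b\<bar> \<le> \<bar>k $ a\<bar>"
      by (metis linorder_le_cases)
    \<comment> \<open>\<open>c * k $ b\<close> has the absolute value of \<open>k $ b\<close> and
      the sign opposite to \<open>k $ a\<close>, so adding it makes the larger entry strictly
      smaller in absolute value.\<close>
    define c where "c = - (sgn (k $ a) * sgn (k $ b))"
    let ?T = "transvection (axis a 1) (axis b c)"
    have "(\<Sum>j\<in>UNIV. axis b c $ j * axis a (1 :: int) $ j) = 0"
      using ab(1) by (intro sum.neutral) (auto simp: axis_def)
    then have inv: "invertible ?T" by (rule invertible_transvection)
    have Tk: "?T *v k = k + (c * k $ b) *s axis a 1"
    proof -
      have "(\<Sum>j\<in>UNIV. axis b c $ j * k $ j) = (\<Sum>j\<in>UNIV. if j = b then c * k $ b else 0)"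
        by (intro sum.cong) (auto simp: axis_def)
      then show ?thesis by (simp add: transvection_mult)
    qed
    have Tki: "(?T *v k) $ i = k $ i + (if i = a then c * k $ b else 0)" for i
      unfolding Tk by (simp add: axis_def)
    have abs_a: "\<bar>k $ a + c * k $ b\<bar> < \<bar>k $ a\<bar>"
      using ab(2,3) by (auto simp: c_def sgn_if abs_if split: if_splits)
    have "(\<Sum>i\<in>UNIV. \<bar>(?T *v k) $ i\<bar>) < (\<Sum>i\<in>UNIV. \<bar>k $ i\<bar>)"
    proof (rule sum_strict_mono_ex1)
      show "\<forall>i\<in>UNIV. \<bar>(?T *v k) $ i\<bar> \<le> \<bar>k $ i\<bar>" using abs_a by (simp add: Tki)
      show "\<exists>i\<in>UNIV. \<bar>(?T *v k) $ i\<bar> < \<bar>k $ i\<bar>" using abs_a by (intro bexI[of _ a]) (simp_all add: Tki)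
    qed simp
    moreover have "0 \<le> (\<Sum>i\<in>UNIV. \<bar>(?T *v k) $ i\<bar>)" by (rule sum_nonneg) simp
    ultimately have "nat (\<Sum>i\<in>UNIV. \<bar>(?T *v k) $ i\<bar>) < nat (\<Sum>i\<in>UNIV. \<bar>k $ i\<bar>)" by linarith
    then obtain P :: "int ^ 'n ^ 'n" and i g where P: "invertible P" "?T *v k = g *s (P *v axis i 1)"
      using less[of "?T *v k"] by blast
    have "k = matrix_inv ?T *v (?T *v k)"
      by (simp add: matrix_vector_mul_assoc matrix_inv_int[OF inv])
    also have "\<dots> = g *s ((matrix_inv ?T ** P) *v axis i 1)"
      by (simp add: P(2) matrix_vector_scale_int matrix_vector_mul_assoc)
    finally have "k = g *s ((matrix_inv ?T ** P) *v axis i 1)" .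
    moreover have "invertible (matrix_inv ?T ** P)"
      by (intro invertible_mult invertible_matrix_inv(1) inv P(1))
    ultimately show ?thesis by blast
  next
    case False
    then obtain i where "\<forall>j. j \<noteq> i \<longrightarrow> k $ j = 0" by metis
    then have "k = k $ i *s (mat 1 *v axis i 1)" by (auto simp: vec_eq_iff axis_def)
    moreover have "invertible (mat 1 :: int ^ 'n ^ 'n)" by (auto simp: invertible_def intro: exI[of _ "mat 1"])
    ultimately show ?thesis by blast
  qed
qed

text \<open>The basis \<open>p\<^sub>a + p\<^sub>b - j p\<^sub>a\<close>, \<open>p\<^sub>i - j p\<^sub>a\<close> (\<open>i \<noteq> a\<close>) obtained from a basis \<open>(p\<^sub>i)\<close>: up to the common
  shift by \<open>- j p\<^sub>a\<close> it does not depend on \<open>j\<close>.\<close>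

lemma shifted_basis:
  fixes P :: "int ^ 'n ^ 'n"
  assumes P: "invertible P" and ab: "a \<noteq> b"
  shows "\<exists>Q. invertible Q \<and> (\<forall>i. Q *v axis i 1 =
    P *v (axis i 1 + (if i = a then axis b 1 else 0)) - j *s (P *v axis a 1))"
proof -
  let ?l = "\<chi> i. if i = a then 0 else - j"
  \<comment> \<open>\<open>?A\<close> replaces the unit vector \<open>a\<close> by the sum of those
    at \<open>a\<close> and \<open>b\<close>. Then \<open>?B\<close> subtracts \<open>j\<close>
    times the unit vector \<open>a\<close> from every other one; in the sum, the summand at
    \<open>b\<close> carries this shift.\<close>
  let ?A = "transvection (axis b 1) (axis a 1)" and ?B = "transvection (axis a 1) ?l"
  have "invertible ?A" using ab
    by (intro invertible_transvection sum.neutral) (auto simp: axis_def)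
  moreover have "invertible ?B"
    by (intro invertible_transvection sum.neutral) (auto simp: axis_def)
  ultimately have inv: "invertible (P ** (?B ** ?A))" using P by (intro invertible_mult)
  have "(P ** (?B ** ?A)) *v axis i 1 =
    P *v (axis i 1 + (if i = a then axis b 1 else 0)) - j *s (P *v axis a 1)" for i
  proof -
    have "(\<Sum>k\<in>UNIV. axis a 1 $ k * axis i (1 :: int) $ k) = (\<Sum>k\<in>UNIV. if k = i then (if i = a then 1 else 0) else 0)"
      by (intro sum.cong) (auto simp: axis_def)
    then have A: "?A *v axis i 1 = axis i 1 + (if i = a then axis b 1 else 0)"
      by (simp add: transvection_mult)
    have "(\<Sum>k\<in>UNIV. ?l $ k * axis i (1 :: int) $ k) = (\<Sum>k\<in>UNIV. if k = i then (if i = a then 0 else - j) else 0)" for i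
      by (intro sum.cong) (auto simp: axis_def)
    then have "(\<Sum>k\<in>UNIV. ?l $ k * axis i (1 :: int) $ k) = (if i = a then 0 else - j)" for i
      by simp
    then have B: "?B *v axis i 1 = axis i 1 - (if i = a then 0 else j) *s axis a 1" for i
      by (simp add: transvection_mult vec_eq_iff)
    have "?B *v (?A *v axis i 1) = axis i 1 + (if i = a then axis b 1 else 0) - j *s axis a 1"
      using ab by (auto simp: A B matrix_vector_right_distrib)
    then show ?thesis
      by (simp only: matrix_vector_mul_assoc[symmetric] matrix_vector_mult_diff_distrib matrix_vector_scale_int)
  qed
  with inv show ?thesis by blast
qed

lemma vec_of_int_add: "vec_of_int (r + s) = vec_of_int r + vec_of_int s"
  and vec_of_int_0 [simp]: "vec_of_int 0 = 0"
  by (simp_all add: vec_of_int_def vec_eq_iff axis_def)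

section \<open>Nilpotency lemmas\<close>

context complex_vector_space
begin

lemma scale_Suc: "sc (of_nat (Suc n)) v = v + sc (of_nat n) v"
  by (simp add: scale_left_distrib)

text \<open>In the application, \<open>p\<close>, \<open>q\<close>, \<open>r\<close> and \<open>H\<close> are the actions of \<open>x \<otimes> t\<^sup>k\<close>, \<open>x \<otimes> t\<^sup>-\<^sup>k\<close>, \<open>x \<otimes> t\<^sup>3\<^sup>k\<close> and
  \<open>y \<otimes> t\<^sup>2\<^sup>k\<close> with \<open>[y, x] = x\<close>: commuting a relation \<open>p\<^sup>a q\<^sup>b = 0\<close> with \<open>H\<close> trades a factor \<open>q\<close> for two
  factors \<open>p\<close>.\<close>

lemma monomial_relation_step:
  assumes p: "endo p" and q: "endo q" and r: "endo r"
    and pr: "\<And>v. p (r v) = r (p v)" and pq: "\<And>v. p (q v) = q (p v)"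
    and Hp: "\<And>v. H (p v) = p (H v) + r v" and Hq: "\<And>v. H (q v) = q (H v) + p v" and H0: "H 0 = 0"
    and rel: "\<And>v. v \<in> U \<Longrightarrow> (p ^^ a) ((q ^^ Suc b) v) = 0" and HU: "\<And>v. v \<in> U \<Longrightarrow> H v \<in> U" and v: "v \<in> U"
  shows "(p ^^ (a + 2)) ((q ^^ b) v) = 0"
proof -
  \<comment> \<open>The extra factor \<open>p\<close> in front completes the power of
    \<open>p\<close> next to \<open>r\<close>, so the term with \<open>r\<close> is killed by the
    relation.\<close>
  have A: "p (H ((p ^^ n) w)) = p ((p ^^ n) (H w)) + sc (of_nat n) (r ((p ^^ n) w))" for n w
  proof (induction n)
    case (Suc n)
    have "p (H (p ((p ^^ n) w))) = p (p (H ((p ^^ n) w))) + p (r ((p ^^ n) w))"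
      by (simp add: Hp endo_add[OF p])
    also have "\<dots> = p (p ((p ^^ n) (H w))) + sc (of_nat n) (p (r ((p ^^ n) w))) + p (r ((p ^^ n) w))"
      by (simp add: Suc endo_add[OF p] endo_scale[OF p])
    finally show ?case by (simp add: pr scale_left_distrib add.commute)
  qed simp
  have B: "H ((q ^^ Suc n) w) = (q ^^ Suc n) (H w) + sc (of_nat (Suc n)) (p ((q ^^ n) w))" for n w
  proof (induction n)
    case (Suc n)
    have "H (q ((q ^^ Suc n) w)) = q (H ((q ^^ Suc n) w)) + p ((q ^^ Suc n) w)" by (rule Hq)
    also have "\<dots> = q ((q ^^ Suc n) (H w)) + sc (of_nat (Suc n)) (q (p ((q ^^ n) w))) + p ((q ^^ Suc n) w)"
      by (simp only: Suc endo_add[OF q] endo_scale[OF q])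
    also have "q (p ((q ^^ n) w)) = p ((q ^^ Suc n) w)" by (simp add: pq)
    finally show ?case unfolding scale_Suc[of "Suc n"] by (simp add: ac_simps del: of_nat_Suc)
  qed (simp add: Hq)
  have "0 = p (H ((p ^^ a) ((q ^^ Suc b) v)))" using rel[OF v] H0 endo_0[OF p] by simp
  also have "\<dots> = p ((p ^^ a) (H ((q ^^ Suc b) v)))"
    by (subst A) (simp only: rel[OF v] endo_0[OF r] scale_zero_right add_0_right)
  also have "\<dots> = p ((p ^^ a) ((q ^^ Suc b) (H v))) + sc (of_nat (Suc b)) (p ((p ^^ a) (p ((q ^^ b) v))))"
    by (simp only: B endo_add[OF p] endo_add[OF endo_pow[OF p]] endo_scale[OF p] endo_scale[OF endo_pow[OF p]])
  also have "\<dots> = sc (of_nat (Suc b)) (p ((p ^^ a) (p ((q ^^ b) v))))"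
    using rel[OF HU[OF v]] by (simp only: endo_0[OF p] add_0_left)
  also have "p ((p ^^ a) (p ((q ^^ b) v))) = (p ^^ (a + 2)) ((q ^^ b) v)"
    by (simp add: funpow_swap1)
  finally show ?thesis by (simp del: of_nat_Suc)
qed

text \<open>The step is applied \<open>b\<close> times. The relation has to be kept on all of
  \<open>U\<close>, because each step evaluates it at \<open>H v\<close> too.\<close>

lemma monomial_relation:
  assumes "endo p" "endo q" "endo r"
    and "\<And>v. p (r v) = r (p v)" "\<And>v. p (q v) = q (p v)"
    and "\<And>v. H (p v) = p (H v) + r v" "\<And>v. H (q v) = q (H v) + p v" "H 0 = 0"
    and "\<And>v. v \<in> U \<Longrightarrow> H v \<in> U"
    and rel: "\<And>v. v \<in> U \<Longrightarrow> (p ^^ a) ((q ^^ b) v) = 0" and v: "v \<in> U"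
  shows "(p ^^ (a + 2 * b)) v = 0"
  using rel v
proof (induction b arbitrary: a v)
  case (Suc b)
  have "(p ^^ (a + 2)) ((q ^^ b) v) = 0" if "v \<in> U" for v
    by (rule monomial_relation_step[OF assms(1-8) Suc.prems(1) assms(9) that])
  from Suc.IH[OF this Suc.prems(2)] show ?case by (simp add: ac_simps)
qed simp

text \<open>Climb with \<open>E\<close> to the last nonzero vector, after \<open>q\<close> steps,
  then descend with \<open>F\<close> to the last nonzero one, after \<open>n\<close> steps. The
  commutator formula at the bottom forces the top weight \<open>\<zeta> + 2 q\<close> to equal
  \<open>n\<close>, and both step counts are below \<open>N\<close>.\<close>

lemma sl2_weight:
  assumes E: "endo E" and F: "endo F" and T: "endo T" and EF: "\<And>v. E (F v) = F (E v) + T v"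
    and TE: "\<And>v. T (E v) = E (T v) + sc 2 (E v)" and TF: "\<And>v. T (F v) = F (T v) - sc 2 (F v)"
    and v: "v \<noteq> 0" "T v = sc \<zeta> v" and EN: "(E ^^ N) v = 0" and FN: "\<And>q. (F ^^ N) ((E ^^ q) v) = 0"
  shows "\<exists>a b. a < N \<and> b < N \<and> \<zeta> = of_nat a - 2 * of_nat b"
proof -
  have least: "\<exists>q<N. (S ^^ q) u \<noteq> 0 \<and> (S ^^ Suc q) u = 0" if "u \<noteq> 0" "(S ^^ N) u = 0" for S :: "'v \<Rightarrow> 'v" and u
    using that(2)
  proof (induction N)
    case (Suc N)
    then show ?case by (cases "(S ^^ N) u = 0") (use less_Suc_eq in blast)+
  qed (use that in simp)
  obtain q where q: "q < N" "(E ^^ q) v \<noteq> 0" "(E ^^ Suc q) v = 0" using least[OF v(1) EN] by blast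
  let ?u = "(E ^^ q) v"
  have Tu: "T ((E ^^ i) v) = sc (\<zeta> + 2 * of_nat i) ((E ^^ i) v)" for i
  proof (induction i)
    case (Suc i)
    have "T (E ((E ^^ i) v)) = sc (\<zeta> + 2 * of_nat i) (E ((E ^^ i) v)) + sc 2 (E ((E ^^ i) v))"
      by (simp only: TE Suc endo_scale[OF E])
    also have "\<dots> = sc (\<zeta> + 2 * of_nat (Suc i)) (E ((E ^^ i) v))"
      unfolding scale_left_distrib[symmetric] by (simp add: algebra_simps)
    finally show ?case by simp
  qed (simp add: v(2))
  obtain n where n: "n < N" "(F ^^ n) ?u \<noteq> 0" "(F ^^ Suc n) ?u = 0" using least[OF q(2) FN] by blast
  let ?w = "(F ^^ n) ?u"
  have Tw: "T ((F ^^ i) ?u) = sc (\<zeta> + 2 * of_nat q - 2 * of_nat i) ((F ^^ i) ?u)" for i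
  proof (induction i)
    case (Suc i)
    let ?x = "(F ^^ i) ?u"
    have "T (F ?x) = sc (\<zeta> + 2 * of_nat q - 2 * of_nat i) (F ?x) - sc 2 (F ?x)"
      by (simp only: TF Suc endo_scale[OF F])
    also have "\<dots> = sc (\<zeta> + 2 * of_nat q - 2 * of_nat (Suc i)) (F ?x)"
      unfolding scale_left_diff_distrib[symmetric] by (simp add: algebra_simps)
    finally show ?case by simp
  qed (simp add: Tu)
  \<comment> \<open>The commutator formula is used with \<open>E\<close> and \<open>F\<close>
    exchanged, which turns \<open>T\<close> into \<open>- T\<close>.\<close>
  have nT: "endo (\<lambda>v. - T v)" using T by (simp add: endo_def)
  have "(F ^^ Suc n) (E ?u) = E ((F ^^ Suc n) ?u) + sc (of_nat (Suc n)) (- T ?w)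
      - sc (2 * of_nat n * of_nat (Suc n) / 2) ?w"
    by (rule power_commutator[OF F E nT]) (simp_all add: EF TF endo_minus[OF F])
  moreover have "E ?u = 0" using q(3) by simp
  ultimately have "0 = sc (of_nat (Suc n)) (- T ?w) - sc (of_nat (Suc n) * of_nat n) ?w"
    using n(3) by (simp add: endo_0[OF E] endo_0[OF endo_pow[OF F]] endo_0[OF F] mult.commute del: of_nat_Suc)
  also have "\<dots> = sc (of_nat (Suc n) * - (\<zeta> + 2 * of_nat q - 2 * of_nat n) - of_nat (Suc n) * of_nat n) ?w"
    by (simp only: Tw scale_minus_left[symmetric] scale_scale scale_left_diff_distrib[symmetric])
  finally have "of_nat (Suc n) * (- (\<zeta> + 2 * of_nat q - 2 * of_nat n) - of_nat n) = 0"
    using n(2) by (simp only: right_diff_distrib) (metis scale_eq_0_iff)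
  then have "- (\<zeta> + 2 * of_nat q - 2 * of_nat n) - of_nat n = 0" by (simp only: mult_eq_0_iff) (simp del: of_nat_Suc)
  then have "\<zeta> = of_nat n - 2 * of_nat q" by (simp add: algebra_simps)
  with q(1) n(1) show ?thesis by blast
qed

end

section \<open>Modules over the core\<close>

text \<open>\<open>X x r\<close> and \<open>Z u r\<close> are the actions of \<open>x \<otimes> t\<^sup>r\<close> and \<open>\<Sum>\<^sub>i u\<^sub>i t\<^sup>r K\<^sub>i\<close>, and \<open>ops\<close> are the actions of
  homogeneous generators of the whole algebra.\<close>

locale core_module = normalized_simple_lie_algebra scale bracket h form \<Delta> \<theta> + V: complex_vector_space sV
  for scale :: "complex \<Rightarrow> 'g::ab_group_add \<Rightarrow> 'g" and bracket :: "'g \<Rightarrow> 'g \<Rightarrow> 'g"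
    and h :: "'g set" and form :: "'g \<Rightarrow> 'g \<Rightarrow> complex"
    and \<Delta> :: "('g \<Rightarrow> complex) set" and \<theta> :: "'g \<Rightarrow> complex"
    and sV :: "complex \<Rightarrow> 'v::ab_group_add \<Rightarrow> 'v" +
  fixes X :: "'g \<Rightarrow> int ^ 'n::finite \<Rightarrow> 'v \<Rightarrow> 'v" and Z :: "complex ^ 'n \<Rightarrow> int ^ 'n \<Rightarrow> 'v \<Rightarrow> 'v"
    and wt :: "complex ^ 'n \<Rightarrow> 'v set" and ops :: "('v \<Rightarrow> 'v) set"
  assumes card: "CARD('n) \<ge> 2"
    and X_endo: "V.endo (X x r)"
    and X_add: "X (x + y) r v = X x r v + X y r v"
    and X_scale: "X (scale c x) r v = sV c (X x r v)"
    and Z_endo: "V.endo (Z u r)"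
    and Z_add: "Z (u + w) r v = Z u r v + Z w r v"
    and Z_scale: "Z (c *s u) r v = sV c (Z u r v)"
    and X_X: "X x r (X y s v) - X y s (X x r v) =
      X (bracket x y) (r + s) v + sV (form x y) (Z (vec_of_int r) (r + s) v)"
    and Z_X: "Z u k (X x r v) = X x r (Z u k v)"
    and wt_subspace: "V.subspace (wt \<mu>)"
    and wt_finite: "\<exists>m. V.spanned_by m (wt \<mu>)"
    and wt_span: "V.span (\<Union>\<mu>. wt \<mu>) = UNIV"
    and X_wt: "v \<in> wt \<mu> \<Longrightarrow> X x r v \<in> wt (\<mu> + vec_of_int r)"
    and Z_wt: "v \<in> wt \<mu> \<Longrightarrow> Z u 0 v \<in> wt \<mu>"
    and nonzero: "\<exists>v :: 'v. v \<noteq> 0"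
    and ops_endo: "T \<in> ops \<Longrightarrow> V.endo T"
    and ops_wt: "T \<in> ops \<Longrightarrow> \<exists>r. \<forall>\<mu>. \<forall>v\<in>wt \<mu>. T v \<in> wt (\<mu> + r)"
    and ops_h: "T \<in> ops \<Longrightarrow> \<exists>\<alpha>. \<forall>y\<in>h. \<forall>v. X y 0 (T v) = T (X y 0 v) + sV (\<alpha> y) (T v)"
    and ops_Z: "T \<in> ops \<Longrightarrow> Z u 0 (T v) = T (Z u 0 v)"
    and irreducible: "V.subspace W \<Longrightarrow> (\<And>T w. T \<in> ops \<Longrightarrow> w \<in> W \<Longrightarrow> T w \<in> W) \<Longrightarrow> W = {0} \<or> W = UNIV"
begin

lemma X_0 [simp]: "X 0 r v = 0"
  using X_scale[of 0 0 r v] by simp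

lemma Z_0 [simp]: "Z 0 r v = 0"
  using Z_scale[of 0 0 r v] by simp

lemma X_minus: "X (- x) r v = - X x r v"
  using X_scale[of "-1" x r v] by simp

text \<open>Nullity at least two enters as the choice of a second lattice direction.\<close>

lemma other_index: "\<exists>j :: 'n. j \<noteq> i"
proof (rule ccontr)
  assume "\<nexists>j. j \<noteq> i"
  then have "(UNIV :: 'n set) = {i}" by auto
  then have "CARD('n) = card {i}" by (rule arg_cong)
  with card show False by simp
qed

text \<open>The twist by the inverse of \<open>P\<close>, written out: degree \<open>k\<close> of
  the twisted algebra is degree \<open>P *v k\<close> of the original one.\<close>

definition ghw :: bool
  where "ghw \<longleftrightarrow> (\<exists>(P :: int ^ 'n ^ 'n) \<mu> v (N :: nat). invertible P \<and> v \<in> wt \<mu> \<and> v \<noteq> 0 \<and>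
    (\<forall>k. (\<forall>i. k $ i \<ge> int N) \<longrightarrow> (\<forall>x. X x (P *v k) v = 0) \<and> (\<forall>u. Z u (P *v k) v = 0)))"

text \<open>Swapping \<open>a\<close> and \<open>b\<close> changes the sign of the loop term in the
  bracket but not that of the central term, so the loop term vanishes by itself;
  \<open>perfect\<close> then gives every \<open>x\<close>.\<close>

lemma X_annihilate_sum:
  assumes "\<And>x. X x r v = 0" "\<And>x. X x s v = 0"
  shows "X x (r + s) v = 0"
proof -
  have "X (bracket a b) (r + s) v = 0" for a b
  proof -
    have ab: "X (bracket a b) (r + s) v + sV (form a b) (Z (vec_of_int r) (r + s) v) = 0" for a b
      using X_X[of a r b s v] by (simp add: assms V.endo_0[OF X_endo])
    have "X (bracket a b) (r + s) v = X (bracket b a) (r + s) v"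
      using ab[of a b] ab[of b a] by (simp add: form_sym[of b a] eq_neg_iff_add_eq_0[symmetric])
    also have "\<dots> = - X (bracket a b) (r + s) v"
      by (subst bracket_antisym) (rule X_minus)
    finally have "sV 2 (X (bracket a b) (r + s) v) = 0"
      by (metis V.scale_left_distrib V.scale_one add.right_inverse one_add_one)
    then show ?thesis by simp
  qed
  then have "{bracket a b | a b. True} \<subseteq> {x. X x (r + s) v = 0}" by blast
  moreover have "subspace {x. X x (r + s) v = 0}" by (simp add: subspace_def X_add X_scale)
  ultimately have "span {bracket a b | a b. True} \<subseteq> {x. X x (r + s) v = 0}" by (rule span_minimal)
  then show ?thesis unfolding perfect by blast
qed

text \<open>The cone is reached by adding one basis vector at a time. For the centre, an
  \<open>x\<close> with \<open>form x x \<noteq> 0\<close> is bracketed with itself in degree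
  \<open>P *v axis i 1\<close> and the remaining degree; this works for every \<open>i\<close> once
  all coordinates are at least 1, whence \<open>N = 1\<close>.\<close>

lemma ghw_criterion:
  assumes P: "invertible (P :: int ^ 'n ^ 'n)" and v: "v \<in> wt \<mu>" "v \<noteq> 0"
    and ann: "\<And>i x. X x (P *v axis i 1) v = 0"
  shows ghw
proof -
  have cone: "X x (P *v m) v = 0" if "\<And>i. 0 \<le> m $ i" "m \<noteq> 0" for m x
    using that
  proof (induction "nat (\<Sum>i\<in>UNIV. m $ i)" arbitrary: m x rule: less_induct)
    case less
    obtain i where "m $ i \<noteq> 0" using less.prems(2) by (auto simp: vec_eq_iff)
    then have i: "m $ i \<ge> 1" using less.prems(1)[of i] by simp
    let ?m = "m - axis i 1"
    have m: "m = ?m + axis i 1" by simp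
    have m0: "0 \<le> ?m $ j" for j using less.prems(1)[of j] i by (simp add: axis_def)
    show ?case
    proof (cases "?m = 0")
      case True
      then have "m = axis i 1" by simp
      then show ?thesis using ann by simp
    next
      case False
      have "(\<Sum>j\<in>UNIV. axis i (1 :: int) $ j) = 1" by (simp add: axis_def)
      then have s: "(\<Sum>j\<in>UNIV. ?m $ j) = (\<Sum>j\<in>UNIV. m $ j) - 1" by (simp add: sum_subtractf)
      moreover have "0 \<le> (\<Sum>j\<in>UNIV. ?m $ j)" using m0 by (intro sum_nonneg) simp
      ultimately have "nat (\<Sum>j\<in>UNIV. ?m $ j) < nat (\<Sum>j\<in>UNIV. m $ j)" by linarith
      from less.hyps[OF this m0 False] have "X x (P *v ?m) v = 0" for x .
      from X_annihilate_sum[OF this ann] have "X x (P *v ?m + P *v axis i 1) v = 0" .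
      then show ?thesis by (simp only: matrix_vector_right_distrib[symmetric] m[symmetric])
    qed
  qed
  have "Z u (P *v m) v = 0" if m: "\<And>i. 1 \<le> m $ i" for m u
  proof -
    let ?k = "P *v m"
    obtain x where x: "form x x \<noteq> 0" using form_square_nonzero by blast
    have gen: "Z (vec_of_int (P *v axis i 1)) ?k v = 0" for i
    proof -
      let ?m = "m - axis i 1"
      \<comment> \<open>A second index keeps \<open>m - axis i 1\<close> nonzero, so the first part
        applies to it.\<close>
      obtain j where "j \<noteq> i" using other_index by blast
      then have "?m $ j \<noteq> 0" using m[of j] by (simp add: axis_def)
      then have "?m \<noteq> 0" by (metis zero_index)
      moreover have "0 \<le> ?m $ j" for j using m[of j] m[of i] by (simp add: axis_def)
      ultimately have "X x (P *v ?m) v = 0" for x using cone by blast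
      moreover have "P *v axis i 1 + P *v ?m = ?k" by (simp flip: matrix_vector_right_distrib)
      ultimately show ?thesis
        using X_X[of x "P *v axis i 1" x "P *v ?m" v] x by (simp add: ann V.endo_0[OF X_endo] bracket_self)
    qed
    \<comment> \<open>The coordinates of \<open>u\<close> in the basis given by \<open>P\<close>,
      for whose members the vanishing has just been shown.\<close>
    define w where "w = complex_matrix (matrix_inv P) *v u"
    have "complex_matrix (mat 1 :: int ^ 'n ^ 'n) = mat 1"
      by (simp add: complex_matrix_def mat_def vec_eq_iff)
    then have "u = complex_matrix P *v w"
      by (simp add: w_def matrix_vector_mul_assoc complex_matrix_mult matrix_inv_int[OF P])
    also have "\<dots> = (\<Sum>i\<in>UNIV. w $ i *s vec_of_int (P *v axis i 1))"
    proof -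
      have "(P *v axis i 1) $ j = P $ j $ i" for i j
        by (simp add: matrix_vector_mult_def axis_def if_distrib[of "\<lambda>x. _ * x"] cong: if_cong)
      then have "vec_of_int (P *v axis i 1) = column i (complex_matrix P)" for i
        by (simp add: vec_of_int_def column_def complex_matrix_def vec_eq_iff)
      then show ?thesis by (simp add: matrix_mult_sum)
    qed
    also have "Z \<dots> ?k v = (\<Sum>i\<in>UNIV. Z (w $ i *s vec_of_int (P *v axis i 1)) ?k v)"
    proof -
      have "Z (sum F I) ?k v = (\<Sum>i\<in>I. Z (F i) ?k v)" for F and I :: "'n set"
        by (induction I rule: infinite_finite_induct) (simp_all add: Z_add)
      then show ?thesis .
    qed
    also have "\<dots> = 0" by (simp add: Z_scale gen)
    finally show ?thesis .
  qed
  moreover have "m \<noteq> 0" if "\<And>i. 1 \<le> m $ i" for m :: "int ^ 'n"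
    using that by (metis not_one_le_zero zero_index)
  moreover have "0 \<le> m $ i" if "\<And>i. 1 \<le> m $ i" for m :: "int ^ 'n" and i
    using that[of i] by simp
  ultimately have "\<forall>m. (\<forall>i. m $ i \<ge> int 1) \<longrightarrow> (\<forall>x. X x (P *v m) v = 0) \<and> (\<forall>u. Z u (P *v m) v = 0)"
    using cone by simp
  then show ?thesis unfolding ghw_def using P v by blast
qed

section \<open>Uniform bounds for weight spaces along a line\<close>

lemma bounded_along_basis_vector:
  assumes "\<not> ghw" and P: "invertible (P :: int ^ 'n ^ 'n)"
  shows "\<exists>M. \<forall>j. V.spanned_by M (wt (\<mu> + vec_of_int (j *s (P *v axis a 1))))"
proof -
  obtain b where b: "a \<noteq> b" using other_index by metis
  define s where "s i = P *v (axis i 1 + (if i = a then axis b 1 else 0))" for i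
  obtain B where B: "finite B" "span B = UNIV" using finite_dimensional by blast
  have "\<forall>i. \<exists>m. V.spanned_by m (wt (\<mu> + vec_of_int (s i)))" using wt_finite by blast
  then obtain m where "\<forall>i. V.spanned_by (m i) (wt (\<mu> + vec_of_int (s i)))" by (rule choice[THEN exE])
  then have m: "V.spanned_by (m i) (wt (\<mu> + vec_of_int (s i)))" for i by blast
  have "V.spanned_by (\<Sum>(i, b)\<in>UNIV \<times> B. m i) (wt (\<mu> + vec_of_int (j *s (P *v axis a 1))))" for j
  proof -
    let ?p = "P *v axis a 1"
    let ?\<nu> = "\<mu> + vec_of_int (j *s ?p)"
    obtain Q where Q: "invertible Q" "\<And>i. Q *v axis i 1 = s i - j *s ?p"
      using shifted_basis[OF P b, of j] unfolding s_def by blast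
    \<comment> \<open>One operator for each lattice basis vector and each member of the finite
      spanning set \<open>B\<close>; linearity in \<open>x\<close> recovers all other
      operators.\<close>
    have "V.spanned_by (\<Sum>z\<in>UNIV \<times> B. m (fst z)) (wt ?\<nu>)"
    proof (rule V.spanned_by_joint_kernel[where T = "\<lambda>z. X (snd z) (Q *v axis (fst z) 1)"
          and U = "\<lambda>z. wt (\<mu> + vec_of_int (s (fst z)))"])
      show "finite ((UNIV :: 'n set) \<times> B)" using B by simp
      show "V.subspace (wt ?\<nu>)" by (rule wt_subspace)
      show "V.endo (X (snd z) (Q *v axis (fst z) 1))" for z by (rule X_endo)
      show "V.spanned_by (m (fst z)) (wt (\<mu> + vec_of_int (s (fst z))))" for z by (rule m)
      show "X (snd z) (Q *v axis (fst z) 1) w \<in> wt (\<mu> + vec_of_int (s (fst z)))" if "w \<in> wt ?\<nu>" for z w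
      proof -
        have "?\<nu> + vec_of_int (Q *v axis (fst z) 1) = \<mu> + vec_of_int (s (fst z))"
          by (simp add: Q(2) add.assoc flip: vec_of_int_add)
        with X_wt[OF that, of "snd z" "Q *v axis (fst z) 1"] show ?thesis by simp
      qed
      fix w assume w: "w \<in> wt ?\<nu>" and ker: "\<And>z. z \<in> UNIV \<times> B \<Longrightarrow> X (snd z) (Q *v axis (fst z) 1) w = 0"
      have "X x (Q *v axis i 1) w = 0" for i x
      proof -
        have "B \<subseteq> {x. X x (Q *v axis i 1) w = 0}" using ker[of "(i, _)"] by auto
        moreover have "subspace {x. X x (Q *v axis i 1) w = 0}" by (simp add: subspace_def X_add X_scale)
        ultimately have "span B \<subseteq> {x. X x (Q *v axis i 1) w = 0}" by (rule span_minimal)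
        then show ?thesis unfolding B(2) by blast
      qed
      then show "w = 0" using ghw_criterion[OF Q(1) w] assms(1) by blast
    qed
    then show ?thesis by (simp add: case_prod_unfold)
  qed
  then show ?thesis by blast
qed

text \<open>\<open>k\<close> is a multiple of a basis vector, so its line is contained in the line
  of that vector.\<close>

lemma bounded_along_line:
  assumes "\<not> ghw"
  shows "\<exists>M. \<forall>j. V.spanned_by M (wt (\<mu> + vec_of_int (j *s k)))"
proof -
  obtain P :: "int ^ 'n ^ 'n" and i g where P: "invertible P" "k = g *s (P *v axis i 1)"
    using multiple_of_basis_vector[of k] by blast
  obtain M where "\<forall>j. V.spanned_by M (wt (\<mu> + vec_of_int (j *s (P *v axis i 1))))"
    using bounded_along_basis_vector[OF assms P(1)] by blast
  then have "V.spanned_by M (wt (\<mu> + vec_of_int (j *s k)))" for j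
    unfolding P(2) by (simp only: vector_smult_assoc)
  then show ?thesis by blast
qed

section \<open>Nilpotency of root vectors\<close>

lemma root_vector_commutator:
  assumes x: "x \<in> root_space scale bracket h \<alpha>" and y0: "y0 \<in> h" "\<alpha> y0 \<noteq> 0"
  shows "X x r (X x s v) = X x s (X x r v)"
    and "y \<in> h \<Longrightarrow> X y r (X x s v) = X x s (X y r v) + sV (\<alpha> y) (X x (r + s) v)"
proof -
  show "X x r (X x s v) = X x s (X x r v)"
    using X_X[of x r x s v] form_root_vectors(1)[OF x y0] by (simp add: bracket_self)
  assume y: "y \<in> h"
  have "bracket y x = scale (\<alpha> y) x" using x y by (simp add: root_space_def)
  then show "X y r (X x s v) = X x s (X y r v) + sV (\<alpha> y) (X x (r + s) v)"
    using X_X[of y r x s v] form_root_vectors(2)[OF x y0 y] by (simp add: X_scale diff_eq_eq add.commute)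
qed

text \<open>A union and no sum: the relations are evaluated at homogeneous vectors, and operators of
  degree a multiple of \<open>k\<close> keep these inside the union.\<close>

definition line :: "complex ^ 'n \<Rightarrow> int ^ 'n \<Rightarrow> 'v set"
  where "line \<mu> k = (\<Union>j. wt (\<mu> + vec_of_int (j *s k)))"

lemma line_stable: "v \<in> line \<mu> k \<Longrightarrow> X x (j *s k) v \<in> line \<mu> k"
proof -
  assume "v \<in> line \<mu> k"
  then obtain i where "v \<in> wt (\<mu> + vec_of_int (i *s k))" by (auto simp: line_def)
  from X_wt[OF this, of x "j *s k"] have "X x (j *s k) v \<in> wt (\<mu> + vec_of_int ((i + j) *s k))"
    by (simp add: vector_sadd_rdistrib vec_of_int_add add.assoc)
  then show ?thesis by (auto simp: line_def)
qed

lemma root_vector_nilpotent_line: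
  assumes x: "x \<in> root_space scale bracket h \<alpha>" and y0: "y0 \<in> h" "\<alpha> y0 \<noteq> 0"
    and M: "\<forall>j. V.spanned_by M (wt (\<mu> + vec_of_int (j *s k)))" and v: "v \<in> line \<mu> k"
  shows "(X x (m *s k) ^^ (3 * M)) v = 0"
proof -
  let ?k = "m *s k"
  let ?p = "X x ?k" and ?q = "X x (- ?k)" and ?r = "X x (3 *s ?k)"
  \<comment> \<open>Rescaled so that \<open>[y, x] = x\<close>, the normalization that
    \<open>monomial_relation\<close> expects of \<open>H\<close>.\<close>
  define y where "y = scale (1 / \<alpha> y0) y0"
  have y: "y \<in> h" unfolding y_def by (rule subspace_scale[OF subspace_h y0(1)])
  have "bracket y x = x"
    using x y0 unfolding y_def by (simp add: root_space_def bracket_scale_left)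
  moreover have "form y x = 0" by (rule form_root_vectors(2)[OF x y0 y])
  ultimately have yx: "X y r (X x s v) = X x s (X y r v) + X x (r + s) v" for r s v
    using X_X[of y r x s v] by (simp add: diff_eq_eq add.commute)
  note xx = root_vector_commutator(1)[OF x y0]
  have pow: "((\<lambda>v. ?p (?q v)) ^^ n) v = (?p ^^ n) ((?q ^^ n) v)" for n v
  proof (induction n arbitrary: v)
    case (Suc n)
    have q: "?q ((?p ^^ n) w) = (?p ^^ n) (?q w)" for w
      by (induction n) (simp_all add: xx[of "- ?k" ?k])
    show ?case by (simp add: Suc q)
  qed simp
  have rel: "(?p ^^ M) ((?q ^^ M) v) = 0" if "v \<in> line \<mu> k" for v
  proof -
    obtain j where j: "v \<in> wt (\<mu> + vec_of_int (j *s k))" using \<open>v \<in> line \<mu> k\<close> by (auto simp: line_def)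
    let ?W = "wt (\<mu> + vec_of_int (j *s k))"
    have "((\<lambda>v. ?p (?q v)) ^^ M) v = 0"
    \<comment> \<open>The product has degree zero, so it preserves the weight space, and
      \<open>y\<close> shifts it by 2, once for each factor.\<close>
    proof (rule V.shift_nilpotent[where Y = "X y 0" and c = 2 and W = ?W])
      show "V.endo (\<lambda>v. ?p (?q v))" by (rule V.endo_comp[OF X_endo X_endo])
      show "V.endo (X y 0)" by (rule X_endo)
      show "V.subspace ?W" by (rule wt_subspace)
      show "V.spanned_by M ?W" using M by blast
      show "v \<in> ?W" by (rule j)
      show "?p (?q w) \<in> ?W" if "w \<in> ?W" for w
        using X_wt[OF X_wt[OF that, of x "- ?k"], of x ?k]
        by (simp only: add.assoc vec_of_int_add[symmetric]) simp
      show "X y 0 w \<in> ?W" if "w \<in> ?W" for w using X_wt[OF that, of y 0] by simp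
      show "X y 0 (?p (?q w)) = ?p (?q (X y 0 w)) + sV 2 (?p (?q w))" for w
      proof -
        have "X y 0 (?p (?q w)) = ?p (?q (X y 0 w)) + (?p (?q w) + ?p (?q w))"
          by (simp add: yx V.endo_add[OF X_endo] add.assoc)
        also have "?p (?q w) + ?p (?q w) = sV 2 (?p (?q w))"
          by (metis V.scale_left_distrib V.scale_one one_add_one)
        finally show ?thesis .
      qed
    qed simp
    then show ?thesis by (simp only: pow)
  qed
  have "(?p ^^ (M + 2 * M)) v = 0"
  \<comment> \<open>Degree \<open>2 m k\<close> carries \<open>-m k\<close> to \<open>m k\<close>
    and \<open>m k\<close> to \<open>3 m k\<close>, the degrees of \<open>q\<close>,
    \<open>p\<close> and \<open>r\<close>.\<close>
  proof (rule V.monomial_relation[where q = ?q and r = ?r and H = "X y (2 *s ?k)" and U = "line \<mu> k"])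
    show "X y (2 *s ?k) (?p w) = ?p (X y (2 *s ?k) w) + ?r w" for w
    proof -
      have "2 *s ?k + ?k = 3 *s ?k" by (simp add: vec_eq_iff)
      then show ?thesis using yx[of "2 *s ?k" ?k w] by simp
    qed
    show "X y (2 *s ?k) (?q w) = ?q (X y (2 *s ?k) w) + ?p w" for w
    proof -
      have "2 *s ?k + - ?k = ?k" by (simp add: vec_eq_iff)
      then show ?thesis using yx[of "2 *s ?k" "- ?k" w] by simp
    qed
    show "X y (2 *s ?k) w \<in> line \<mu> k" if "w \<in> line \<mu> k" for w
      using line_stable[OF that, of y "2 * m"] by (simp add: vector_smult_assoc)
  qed (use X_endo xx rel v V.endo_0[OF X_endo] in auto)
  then show ?thesis by simp
qed

section \<open>Level zero and weight vectors for the Cartan subalgebra\<close>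

lemma wt_nonzero: "\<exists>\<mu>. \<exists>v\<in>wt \<mu>. v \<noteq> 0"
proof (rule ccontr)
  assume "\<not> ?thesis"
  then have "(\<Union>\<mu>. wt \<mu>) \<subseteq> {0}" by blast
  then have "V.span (\<Union>\<mu>. wt \<mu>) \<subseteq> {0}" by (rule V.span_minimal) (rule V.subspace_single_0)
  with wt_span nonzero show False by auto
qed

text \<open>The exponent depends on the weight, but the vectors killed by some power form a
  subspace, the generalized eigenspace of 0, which contains all weight spaces.\<close>

lemma locally_nilpotent:
  assumes "\<not> ghw" and x: "x \<in> root_space scale bracket h \<alpha>" and y0: "y0 \<in> h" "\<alpha> y0 \<noteq> 0"
  shows "\<exists>m. (X x k ^^ m) v = 0"
proof -
  have "wt \<mu> \<subseteq> V.gen_eigenspace (X x k) 0" for \<mu>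
  proof
    fix v assume "v \<in> wt \<mu>"
    then have "v \<in> wt (\<mu> + vec_of_int (0 *s k))" by simp
    then have "v \<in> line \<mu> k" unfolding line_def by blast
    moreover obtain M where "\<forall>j. V.spanned_by M (wt (\<mu> + vec_of_int (j *s k)))"
      using bounded_along_line[OF assms(1)] by blast
    ultimately have "(X x (1 *s k) ^^ (3 * M)) v = 0" by (intro root_vector_nilpotent_line[OF x y0])
    then show "v \<in> V.gen_eigenspace (X x k) 0" by (auto simp: V.gen_eigenspace_def)
  qed
  then have "(\<Union>\<mu>. wt \<mu>) \<subseteq> V.gen_eigenspace (X x k) 0" by (rule UN_least)
  then have "V.span (\<Union>\<mu>. wt \<mu>) \<subseteq> V.gen_eigenspace (X x k) 0"
    by (rule V.span_minimal) (rule V.gen_eigenspace_subspace[OF X_endo])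
  then have "v \<in> V.gen_eigenspace (X x k) 0" unfolding wt_span by blast
  then show ?thesis by (simp add: V.gen_eigenspace_def)
qed

text \<open>Schur's lemma: a finite-dimensional weight space supplies an eigenvector, and its
  eigenspace is stable under the generators because these commute with the degree-zero
  centre.\<close>

lemma Z_scalar: "\<exists>c. \<forall>v. Z u 0 v = sV c v"
proof -
  obtain \<mu> v0 where v0: "v0 \<in> wt \<mu>" "v0 \<noteq> 0" using wt_nonzero by blast
  obtain m where m: "V.spanned_by m (wt \<mu>)" using wt_finite by blast
  obtain v c where v: "v \<in> wt \<mu>" "v \<noteq> 0" "Z u 0 v = sV c v"
    using V.eigenvector[OF Z_endo wt_subspace Z_wt m v0] by blast
  let ?W = "{v\<in>UNIV. Z u 0 v - sV c v \<in> {0}}"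
  have sub: "V.subspace ?W"
    by (rule V.subspace_endo_preimage[OF V.endo_shift[OF Z_endo] V.subspace_UNIV V.subspace_single_0])
  have stable: "T w \<in> ?W" if "T \<in> ops" "w \<in> ?W" for T w
    using that ops_Z[OF that(1), of u w] by (simp add: V.endo_scale[OF ops_endo[OF that(1)]])
  have "?W = {0} \<or> ?W = UNIV" by (rule irreducible[OF sub]) (rule stable)
  with v show ?thesis by auto
qed

lemma level_zero:
  assumes "\<not> ghw"
  shows "Z (axis i 1) 0 v = 0"
proof -
  obtain e f t where efx: "e \<in> root_space scale bracket h \<theta>" "f \<in> root_space scale bracket h (\<lambda>x. - \<theta> x)"
    "t \<in> h" "bracket e f = t" "form e f = 1" "\<theta> t = 2" by (rule highest_root_triple)
  have th: "\<theta> t \<noteq> 0" "- \<theta> t \<noteq> 0" using efx(6) by simp_all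
  obtain c where c: "\<And>v. Z (axis i 1) 0 v = sV c v" using Z_scalar by blast
  obtain \<mu> v0 where v0: "v0 \<in> wt \<mu>" "v0 \<noteq> 0" using wt_nonzero by blast
  obtain d where d: "V.spanned_by d (wt \<mu>)" using wt_finite by blast
  have "X t 0 w \<in> wt \<mu>" if "w \<in> wt \<mu>" for w using X_wt[OF that, of t 0] by simp
  then obtain v1 \<eta> where v1: "v1 \<in> wt \<mu>" "v1 \<noteq> 0" "X t 0 v1 = sV \<eta> v1"
    using V.eigenvector[OF X_endo wt_subspace _ d v0] by blast
  let ?k = "axis i (1 :: int)"
  obtain M where M: "\<forall>j. V.spanned_by M (wt (\<mu> + vec_of_int (j *s ?k)))"
    using bounded_along_line[OF assms] by blast
  \<comment> \<open>The triple moved to degrees \<open>m\<close> and \<open>-m\<close> acts with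
    middle element \<open>t + m c\<close>. Since \<open>v1\<close> and the exponent are the same for
    all \<open>m\<close>, so is the finite set of possible weights.\<close>
  have ab: "\<exists>a b. a < 3 * M \<and> b < 3 * M \<and> \<eta> + of_nat m * c = of_nat a - 2 * of_nat b" for m :: nat
  proof (rule V.sl2_weight[where v = v1 and T = "\<lambda>v. X t 0 v + sV (of_nat m * c) v"])
    let ?E = "X e (int m *s ?k)" and ?F = "X f (- int m *s ?k)"
    have Z: "Z (vec_of_int (int m *s ?k)) 0 v = sV (of_nat m * c) v" for v
    proof -
      have "vec_of_int (int m *s ?k) = of_nat m *s axis i 1"
        by (simp add: vec_of_int_def vec_eq_iff axis_def)
      then show ?thesis by (simp add: Z_scale c)
    qed
    show "V.endo ?E" "V.endo ?F" by (rule X_endo)+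
    show "V.endo (\<lambda>v. X t 0 v + sV (of_nat m * c) v)"
      using X_endo[of t 0] by (simp add: V.endo_def V.scale_right_distrib ac_simps)
    show "?E (?F v) = ?F (?E v) + (X t 0 v + sV (of_nat m * c) v)" for v
    proof -
      have "int m *s ?k + - int m *s ?k = 0" by (simp add: vec_eq_iff)
      then show ?thesis using X_X[of e "int m *s ?k" f "- int m *s ?k" v] by (simp add: efx Z diff_eq_eq add.commute)
    qed
    show "X t 0 (?E v) + sV (of_nat m * c) (?E v) = ?E (X t 0 v + sV (of_nat m * c) v) + sV 2 (?E v)" for v
      using root_vector_commutator(2)[OF efx(1,3) th(1) efx(3), of 0 "int m *s ?k" v]
      by (simp add: V.endo_add[OF X_endo] V.endo_scale[OF X_endo] efx(6) ac_simps)
    show "X t 0 (?F v) + sV (of_nat m * c) (?F v) = ?F (X t 0 v + sV (of_nat m * c) v) - sV 2 (?F v)" for v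
      using root_vector_commutator(2)[OF efx(2,3) th(2) efx(3), of 0 "- int m *s ?k" v]
      by (simp add: V.endo_add[OF X_endo] V.endo_scale[OF X_endo] efx(6) algebra_simps)
    show "v1 \<noteq> 0" by (rule v1(2))
    show "X t 0 v1 + sV (of_nat m * c) v1 = sV (\<eta> + of_nat m * c) v1"
      by (simp add: v1(3) V.scale_left_distrib)
    have "v1 \<in> wt (\<mu> + vec_of_int (0 *s ?k))" using v1(1) by simp
    then have line: "v1 \<in> line \<mu> ?k" unfolding line_def by blast
    then show "(?E ^^ (3 * M)) v1 = 0" by (rule root_vector_nilpotent_line[OF efx(1,3) th(1) M])
    have "(?E ^^ q) v1 \<in> line \<mu> ?k" for q by (rule pow_mem) (rule line_stable, assumption, rule line)
    then show "(?F ^^ (3 * M)) ((?E ^^ q) v1) = 0" for q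
      by (rule root_vector_nilpotent_line[OF efx(2,3) th(2) M])
  qed
  have "range (\<lambda>m :: nat. \<eta> + of_nat m * c) \<subseteq>
      (\<lambda>(a, b). of_nat a - 2 * of_nat b) ` ({..<3 * M} \<times> {..<3 * M})"
  proof (rule image_subsetI)
    fix m :: nat
    obtain a b where "a < 3 * M" "b < 3 * M" "\<eta> + of_nat m * c = of_nat a - 2 * of_nat b" using ab by blast
    then show "\<eta> + of_nat m * c \<in> (\<lambda>(a, b). of_nat a - 2 * of_nat b) ` ({..<3 * M} \<times> {..<3 * M})"
      by (intro image_eqI[of _ _ "(a, b)"]) simp_all
  qed
  \<comment> \<open>An arithmetic progression with finitely many values has difference 0.\<close>
  then have "finite (range (\<lambda>m :: nat. \<eta> + of_nat m * c))" by (rule finite_subset) simp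
  then have "\<not> inj (\<lambda>m :: nat. \<eta> + of_nat m * c)" using range_inj_infinite by blast
  then have "c = 0" by (auto simp: inj_def)
  then show ?thesis by (simp add: c)
qed

text \<open>The span is a nonzero submodule: the generators are shifted by \<open>h\<close> through
  scalars, so they move eigenvectors of \<open>h\<close> to eigenvectors of \<open>h\<close>, and a
  nonzero weight space contains one by nilpotency of \<open>h\<close>.\<close>

lemma h_weight_vectors_span:
  "V.span {v. (\<exists>\<mu>. v \<in> wt \<mu>) \<and> (\<exists>\<eta>. \<forall>y\<in>h. X y 0 v = sV (\<eta> y) v)} = UNIV"
proof -
  let ?S = "{v. (\<exists>\<mu>. v \<in> wt \<mu>) \<and> (\<exists>\<eta>. \<forall>y\<in>h. X y 0 v = sV (\<eta> y) v)}"
  interpret act: nilpotent_action scale bracket sV h "\<lambda>x. X x 0"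
  proof
    show "subalgebra h" by (rule subalgebra_h)
    show "\<exists>k. lower_central h k = {0}" by (rule nilpotent_h)
    show "V.endo (X x 0)" for x by (rule X_endo)
    show "X (bracket x y) 0 v = X x 0 (X y 0 v) - X y 0 (X x 0 v)" for x y v
      using X_X[of x 0 y 0 v] by simp
  qed
  have "T w \<in> V.span ?S" if T: "T \<in> ops" and w: "w \<in> V.span ?S" for T w
  proof (rule V.endo_stable_span[OF ops_endo[OF T] _ V.subspace_span w])
    fix v assume "v \<in> ?S"
    then obtain \<mu> \<eta> where v: "v \<in> wt \<mu>" "\<And>y. y \<in> h \<Longrightarrow> X y 0 v = sV (\<eta> y) v" by blast
    obtain r where r: "\<And>\<mu> v. v \<in> wt \<mu> \<Longrightarrow> T v \<in> wt (\<mu> + r)" using ops_wt[OF T] by blast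
    obtain \<alpha> where \<alpha>: "\<And>y v. y \<in> h \<Longrightarrow> X y 0 (T v) = T (X y 0 v) + sV (\<alpha> y) (T v)" using ops_h[OF T] by blast
    have "\<forall>y\<in>h. X y 0 (T v) = sV (\<eta> y + \<alpha> y) (T v)"
      by (simp add: \<alpha> v(2) V.endo_scale[OF ops_endo[OF T]] V.scale_left_distrib)
    then have "\<exists>\<eta>. \<forall>y\<in>h. X y 0 (T v) = sV (\<eta> y) (T v)" by (rule exI[of _ "\<lambda>y. \<eta> y + \<alpha> y"])
    moreover have "\<exists>\<mu>. T v \<in> wt \<mu>" using r[OF v(1)] by (rule exI)
    ultimately show "T v \<in> V.span ?S" by (intro V.span_base CollectI conjI)
  qed
  then have "V.span ?S = {0} \<or> V.span ?S = UNIV" by (intro irreducible V.subspace_span)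
  moreover have "V.span ?S \<noteq> {0}"
  proof -
    obtain \<mu> v0 where v0: "v0 \<in> wt \<mu>" "v0 \<noteq> 0" using wt_nonzero by blast
    obtain d where d: "V.spanned_by d (wt \<mu>)" using wt_finite by blast
    have "X x 0 w \<in> wt \<mu>" if "w \<in> wt \<mu>" for w x using X_wt[OF that, of x 0] by simp
    then obtain v \<kappa> where v: "v \<in> wt \<mu>" "v \<noteq> 0" "\<And>x. x \<in> h \<Longrightarrow> X x 0 v = sV (\<kappa> x) v"
      using act.simultaneous_eigenvector[OF wt_subspace _ d v0] by blast
    have "v \<in> V.span ?S" by (rule V.span_base) (use v in blast)
    with v(2) show ?thesis by blast
  qed
  ultimately show ?thesis by blast
qed

end

section \<open>Integrability\<close>

locale lie_rep =
  fixes sL :: "complex \<Rightarrow> 'l::ab_group_add \<Rightarrow> 'l" and L :: "'l set" and br :: "'l \<Rightarrow> 'l \<Rightarrow> 'l"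
    and sV :: "complex \<Rightarrow> 'v::ab_group_add \<Rightarrow> 'v" and \<rho> :: "'l \<Rightarrow> 'v \<Rightarrow> 'v"
  assumes lie_module: "lie_module sL L br sV \<rho>"

sublocale lie_rep \<subseteq> V: complex_vector_space sV
  using lie_module by (simp add: lie_module_def complex_vector_space_def)

context lie_rep
begin

lemma rho_endo: "x \<in> L \<Longrightarrow> V.endo (\<rho> x)"
  using lie_module by (simp add: lie_module_def V.endo_linear)

lemma rho_add: "x \<in> L \<Longrightarrow> y \<in> L \<Longrightarrow> \<rho> (x + y) v = \<rho> x v + \<rho> y v"
  and rho_scale: "x \<in> L \<Longrightarrow> \<rho> (sL c x) v = sV c (\<rho> x v)"
  and rho_bracket: "x \<in> L \<Longrightarrow> y \<in> L \<Longrightarrow> \<rho> (br x y) v = \<rho> x (\<rho> y v) - \<rho> y (\<rho> x v)"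
  using lie_module by (simp_all add: lie_module_def)

lemma rho_0:
  assumes "0 \<in> L"
  shows "\<rho> 0 v = 0"
  using rho_add[OF assms assms, of v] by simp

lemma weight_space_shift:
  assumes L: "\<And>i. d i \<in> L" "y \<in> L" and y: "\<And>i. br (d i) y = sL (of_int (r $ i)) y"
    and v: "v \<in> D_weight_space d sV \<rho> \<mu>"
  shows "\<rho> y v \<in> D_weight_space d sV \<rho> (\<mu> + vec_of_int r)"
proof -
  have "\<rho> (d i) (\<rho> y v) = sV ((\<mu> + vec_of_int r) $ i) (\<rho> y v)" for i
  proof -
    have "\<rho> (d i) (\<rho> y v) = \<rho> (br (d i) y) v + \<rho> y (\<rho> (d i) v)"
      using rho_bracket[OF L(1,2), of i v] by simp
    also have "\<rho> (d i) v = sV (\<mu> $ i) v" using v by (simp add: D_weight_space_def)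
    finally show ?thesis
      by (simp add: y rho_scale[OF L(2)] V.endo_scale[OF rho_endo[OF L(2)]] vec_of_int_def V.scale_left_distrib add.commute)
  qed
  then show ?thesis by (simp add: D_weight_space_def)
qed

lemma subspace_D_weight_space:
  assumes L: "\<And>i. d i \<in> L"
  shows "V.subspace (D_weight_space d sV \<rho> \<mu>)"
  by (simp add: V.subspace_def D_weight_space_def V.endo_simps[OF rho_endo[OF L]] V.scale_right_distrib mult.commute)

lemma commute_shift:
  assumes "x \<in> L" "y \<in> L" "br x y = sL c y"
  shows "\<rho> x (\<rho> y v) = \<rho> y (\<rho> x v) + sV c (\<rho> y v)"
  using rho_bracket[OF assms(1,2), of v] by (simp add: assms(3) rho_scale[OF assms(2)] diff_eq_eq add.commute)

end

text \<open>An \<open>H\<close>-weight fixes the degrees, so each \<open>H\<close>-weight space sits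
  inside a finite-dimensional \<open>wt\<close>. Conversely, an \<open>h\<close>-eigenvector in some
  \<open>wt\<close> is an eigenvector of all of \<open>H\<close>.\<close>

lemma (in core_module) integrable_module_criterion:
  fixes sL :: "complex \<Rightarrow> 'l::ab_group_add \<Rightarrow> 'l"
  assumes not_ghw: "\<not> ghw"
    and H_add: "\<And>x y. x \<in> H \<Longrightarrow> y \<in> H \<Longrightarrow> x + y \<in> H" and H_scale: "\<And>c x. x \<in> H \<Longrightarrow> sL c x \<in> H"
    and rho_add: "\<And>x y v. x \<in> H \<Longrightarrow> y \<in> H \<Longrightarrow> \<rho> (x + y) v = \<rho> x v + \<rho> y v"
    and rho_scale: "\<And>c x v. x \<in> H \<Longrightarrow> \<rho> (sL c x) v = sV c (\<rho> x v)"
    and H_act: "\<And>y. y \<in> H \<Longrightarrow> \<exists>x\<in>h. \<exists>b. \<forall>\<mu>. \<forall>v\<in>wt \<mu>. \<rho> y v = X x 0 v + sV (\<Sum>i\<in>UNIV. b $ i * \<mu> $ i) v"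
    and wt: "wt = D_weight_space d sV \<rho>" and d: "\<And>i. d i \<in> H"
    and R: "\<And>y. y \<in> R \<Longrightarrow> \<exists>k x \<alpha> y0. x \<in> root_space scale bracket h \<alpha> \<and> y0 \<in> h \<and> \<alpha> y0 \<noteq> 0 \<and> \<rho> y = X x k"
  shows "integrable_module sL H R sV \<rho>"
  unfolding integrable_module_def
proof (intro conjI ballI allI)
  let ?W = "\<Union>\<mu>\<in>dual_space sL H. H_weight_space H sV \<rho> \<mu>"
  have "{v. (\<exists>\<mu>. v \<in> wt \<mu>) \<and> (\<exists>\<eta>. \<forall>y\<in>h. X y 0 v = sV (\<eta> y) v)} \<subseteq> V.span ?W"
  proof
    fix v assume v: "v \<in> {v. (\<exists>\<mu>. v \<in> wt \<mu>) \<and> (\<exists>\<eta>. \<forall>y\<in>h. X y 0 v = sV (\<eta> y) v)}"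
    show "v \<in> V.span ?W"
    \<comment> \<open>Only a nonzero vector determines its weight, and so makes it linear on
      \<open>H\<close>.\<close>
    proof (cases "v = 0")
      case True
      then show ?thesis by (simp add: V.span_zero)
    next
      case False
      obtain \<mu> \<eta> where v: "v \<in> wt \<mu>" "\<And>y. y \<in> h \<Longrightarrow> X y 0 v = sV (\<eta> y) v" using v by blast
      have "\<exists>c. \<rho> y v = sV c v" if y: "y \<in> H" for y
      proof -
        obtain x b where "x \<in> h" "\<rho> y v = X x 0 v + sV (\<Sum>i\<in>UNIV. b $ i * \<mu> $ i) v"
          using H_act[OF y] v(1) by blast
        then have "\<rho> y v = sV (\<eta> x + (\<Sum>i\<in>UNIV. b $ i * \<mu> $ i)) v" by (simp add: v(2) V.scale_left_distrib)
        then show ?thesis by (rule exI)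
      qed
      then have "\<forall>y\<in>H. \<exists>c. \<rho> y v = sV c v" by blast
      then obtain f where f: "\<forall>y\<in>H. \<rho> y v = sV (f y) v" by (rule bchoice[THEN exE])
      let ?f = "\<lambda>y. if y \<in> H then f y else 0"
      have "f (x + y) = f x + f y" if "x \<in> H" "y \<in> H" for x y
      proof -
        have "sV (f (x + y)) v = sV (f x + f y) v"
          using f H_add[OF that] that rho_add[OF that, of v] by (simp add: V.scale_left_distrib)
        then show ?thesis using False V.scale_cancel_right by blast
      qed
      moreover have "f (sL c x) = c * f x" if "x \<in> H" for c x
      proof -
        have "sV (f (sL c x)) v = sV (c * f x) v"
          using f H_scale[OF that] that rho_scale[OF that, of c v] by simp
        then show ?thesis using False V.scale_cancel_right by blast
      qed
      ultimately have "?f \<in> dual_space sL H"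
        by (simp add: dual_space_def linear_functional_on_def H_add H_scale)
      moreover have "v \<in> H_weight_space H sV \<rho> ?f" using f by (simp add: H_weight_space_def)
      ultimately have "v \<in> ?W" by (rule UN_I[of ?f])
      then show ?thesis by (rule V.span_base)
    qed
  qed
  then have "V.span {v. (\<exists>\<mu>. v \<in> wt \<mu>) \<and> (\<exists>\<eta>. \<forall>y\<in>h. X y 0 v = sV (\<eta> y) v)} \<subseteq> V.span ?W"
    by (rule V.span_minimal) (rule V.subspace_span)
  then show "V.span ?W = UNIV" unfolding h_weight_vectors_span by blast
next
  fix f
  have "H_weight_space H sV \<rho> f \<subseteq> wt (\<chi> i. f (d i))"
    using d by (auto simp: wt H_weight_space_def D_weight_space_def)
  moreover obtain m where "V.spanned_by m (wt (\<chi> i. f (d i)))" using wt_finite by blast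
  ultimately have "V.spanned_by m (H_weight_space H sV \<rho> f)" using V.spanned_by_mono by blast
  then show "finite_dim sV (H_weight_space H sV \<rho> f)" by (auto simp: V.finite_dim_iff)
next
  fix y v assume "y \<in> R"
  then obtain k x \<alpha> y0 where "x \<in> root_space scale bracket h \<alpha>" "y0 \<in> h" "\<alpha> y0 \<noteq> 0" "\<rho> y = X x k"
    using R by blast
  then show "\<exists>m. (\<rho> y ^^ m) v = 0" using locally_nilpotent[OF not_ghw] by metis
qed

lemma pairing_axis: "pairing (axis i 1) r = of_int (r $ i)"
  by (simp add: pairing_def axis_def if_distrib[of "\<lambda>x. x * _"] cong: if_cong)

text \<open>The common features of modules over extended affine and over toroidal Lie algebras: \<open>loop\<close> embeds the
  loop algebra, \<open>cent u r\<close> is \<open>\<Sum>\<^sub>i u\<^sub>i t\<^sup>r K\<^sub>i\<close> and \<open>deg u\<close> is \<open>\<Sum>\<^sub>i u\<^sub>i d\<^sub>i\<close>.\<close>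

locale graded_rep = normalized_simple_lie_algebra scale bracket h form \<Delta> \<theta> + lie_rep sL L br sV \<rho>
  for scale :: "complex \<Rightarrow> 'g::ab_group_add \<Rightarrow> 'g" and bracket :: "'g \<Rightarrow> 'g \<Rightarrow> 'g"
    and h :: "'g set" and form :: "'g \<Rightarrow> 'g \<Rightarrow> complex"
    and \<Delta> :: "('g \<Rightarrow> complex) set" and \<theta> :: "'g \<Rightarrow> complex"
    and sL :: "complex \<Rightarrow> 'l::ab_group_add \<Rightarrow> 'l" and L :: "'l set" and br :: "'l \<Rightarrow> 'l \<Rightarrow> 'l"
    and sV :: "complex \<Rightarrow> 'v::ab_group_add \<Rightarrow> 'v" and \<rho> :: "'l \<Rightarrow> 'v \<Rightarrow> 'v" +
  fixes loop :: "('g, 'n::finite) loop \<Rightarrow> 'l" and cent :: "complex ^ 'n \<Rightarrow> int ^ 'n \<Rightarrow> 'l"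
    and deg :: "complex ^ 'n \<Rightarrow> 'l" and gens :: "'l set"
  assumes card: "CARD('n) \<ge> 2"
    and irreducible: "irreducible_module sL L br sV \<rho>"
    and quasi_finite: "quasi_finite (\<lambda>i. deg (axis i 1)) sV \<rho>"
    and zero_mem: "0 \<in> L"
    and add_mem: "z \<in> L \<Longrightarrow> z' \<in> L \<Longrightarrow> z + z' \<in> L"
    and loop_mem: "loop l \<in> L" and cent_mem: "cent u r \<in> L" and deg_mem: "deg u \<in> L"
    and gens_mem: "z \<in> gens \<Longrightarrow> z \<in> L"
    and scale_add: "sL c (z + z') = sL c z + sL c z'"
    and loop_add: "loop (l + l') = loop l + loop l'"
    and loop_scale: "sL c (loop (single r x)) = loop (single r (scale c x))"
    and cent_add: "cent (u + w) r = cent u r + cent w r"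
    and cent_scale: "sL c (cent u r) = cent (c *s u) r"
    and deg_add: "deg (u + w) = deg u + deg w"
    and deg_scale: "sL c (deg u) = deg (c *s u)"
    and bracket_loop: "br (loop (single r x)) (loop (single s y)) =
      loop (single (r + s) (bracket x y)) + sL (form x y) (cent (vec_of_int r) (r + s))"
    and bracket_cent: "br (cent u r) (loop l) = 0"
    and degree_loop: "br (deg (axis i 1)) (loop (single r x)) =
      sL (of_int (r $ i)) (loop (single r x))"
    and degree_cent: "br (deg (axis i 1)) (cent u r) = sL (of_int (r $ i)) (cent u r)"
    and degree_gens: "z \<in> gens \<Longrightarrow> \<exists>r. \<forall>i. br (deg (axis i 1)) z = sL (of_int (r $ i :: int)) z"
    and loop_gens: "z \<in> gens \<Longrightarrow> br (loop (single 0 x)) z = 0"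
    and cent_gens: "z \<in> gens \<Longrightarrow> br (cent u 0) z = 0"
    and generate: "V.subspace W \<Longrightarrow> (\<And>l w. w \<in> W \<Longrightarrow> \<rho> (loop l) w \<in> W) \<Longrightarrow>
      (\<And>z w. z \<in> gens \<Longrightarrow> w \<in> W \<Longrightarrow> \<rho> z w \<in> W) \<Longrightarrow> z \<in> L \<Longrightarrow> v \<in> W \<Longrightarrow> \<rho> z v \<in> W"
begin

abbreviation "loop_act x r \<equiv> \<rho> (loop (single r x))"
abbreviation "cent_act u r \<equiv> \<rho> (cent u r)"

definition wt :: "complex ^ 'n \<Rightarrow> 'v set"
  where "wt = D_weight_space (\<lambda>i. deg (axis i 1)) sV \<rho>"

text \<open>Loop elements are restricted to root vectors because each generator has to be an
  eigenvector of \<open>ad h\<close>.\<close>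

definition generators :: "'l set"
  where "generators = {loop (single r x) | r x. \<exists>\<alpha>. x \<in> root_space scale bracket h \<alpha>} \<union> gens"

lemma generators_cases:
  assumes "y \<in> generators"
  obtains (loop) r x \<alpha> where "y = loop (single r x)" "x \<in> root_space scale bracket h \<alpha>"
  | (gens) "y \<in> gens"
  using assms by (auto simp: generators_def)

lemma generators_mem: "y \<in> generators \<Longrightarrow> y \<in> L"
  by (auto simp: generators_def loop_mem gens_mem)

lemma loop_act_add: "loop_act (x + y) r v = loop_act x r v + loop_act y r v"
  by (simp add: single_add loop_add rho_add[OF loop_mem loop_mem])

lemma loop_act_scale: "loop_act (scale c x) r v = sV c (loop_act x r v)"
  by (simp add: rho_scale[OF loop_mem] flip: loop_scale)

lemma cent_act_add: "cent_act (u + w) r v = cent_act u r v + cent_act w r v"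
  by (simp add: cent_add rho_add[OF cent_mem cent_mem])

lemma cent_act_scale: "cent_act (c *s u) r v = sV c (cent_act u r v)"
  by (simp add: rho_scale[OF cent_mem] flip: cent_scale)

text \<open>Root vectors span the simple algebra, so stability under the generators extends to the
  loop algebra and, by \<open>generate\<close>, to everything.\<close>

lemma generators_irreducible:
  assumes W: "V.subspace W" "\<And>y w. y \<in> generators \<Longrightarrow> w \<in> W \<Longrightarrow> \<rho> y w \<in> W"
  shows "W = {0} \<or> W = UNIV"
proof -
  obtain e f t :: 'g where "root_span = UNIV" by (rule highest_root_triple)
  have loop1: "loop_act x r w \<in> W" if w: "w \<in> W" for x r w
  proof -
    have "loop_act x r w \<in> W" if "x \<in> root_space scale bracket h \<alpha>" for x \<alpha>
      by (rule W(2)[OF _ w]) (use that in \<open>auto simp: generators_def\<close>)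
    then have "(\<Union>\<alpha>. root_space scale bracket h \<alpha>) \<subseteq> {x. loop_act x r w \<in> W}" by blast
    moreover have "subspace {x. loop_act x r w \<in> W}"
    proof -
      have "loop_act 0 r w = 0" using loop_act_scale[of r 0 0 w] by simp
      then show ?thesis
        using W(1) by (simp add: subspace_def V.subspace_def loop_act_add loop_act_scale)
    qed
    ultimately have "root_span \<subseteq> {x. loop_act x r w \<in> W}" unfolding root_span_def by (rule span_minimal)
    then show ?thesis unfolding \<open>root_span = UNIV\<close> by blast
  qed
  have loop: "\<rho> (loop l) w \<in> W" if w: "w \<in> W" for l w
  proof (induction l rule: pm_induct)
    case (single r x)
    show ?case by (rule loop1[OF w])
  next
    case (add p q)
    then show ?case by (simp add: loop_add rho_add[OF loop_mem loop_mem] V.subspace_add[OF W(1)])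
  qed
  have "\<rho> y w \<in> W" if "y \<in> L" "w \<in> W" for y w
    by (rule generate[OF W(1) loop _ that]) (use W(2) in \<open>auto simp: generators_def\<close>)
  then show ?thesis using irreducible W(1) unfolding irreducible_module_def by blast
qed

lemma commute_zero:
  assumes "x \<in> L" "y \<in> L" "br x y = 0"
  shows "\<rho> x (\<rho> y v) = \<rho> y (\<rho> x v)"
  using rho_bracket[OF assms(1,2), of v] by (simp add: assms(3) rho_0[OF zero_mem])

lemma generators_degree:
  assumes "y \<in> generators"
  shows "\<exists>r. \<forall>i. br (deg (axis i 1)) y = sL (of_int (r $ i)) y"
  using assms by (cases rule: generators_cases) (use degree_loop degree_gens in blast)+

lemma generators_h:
  assumes "y \<in> generators"
  shows "\<exists>\<alpha>. \<forall>x\<in>h. \<forall>v. loop_act x 0 (\<rho> y v) = \<rho> y (loop_act x 0 v) + sV (\<alpha> x) (\<rho> y v)"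
  using assms
proof (cases rule: generators_cases)
  case (loop r z \<alpha>)
  have "loop_act x 0 (\<rho> y v) = \<rho> y (loop_act x 0 v) + sV (\<alpha> x) (\<rho> y v)" if "x \<in> h" for x v
  proof -
    \<comment> \<open>A degree-zero element has central term \<open>cent 0 r\<close> in its
      brackets; additivity of \<open>cent\<close> shows that this is 0.\<close>
    have "cent 0 r + cent 0 r = cent 0 r" using cent_add[of 0 0 r] by simp
    then have "cent 0 r = 0" by simp
    moreover have "sL (form x z) (cent 0 r) = cent 0 r" by (simp add: cent_scale)
    moreover have "bracket x z = scale (\<alpha> x) z" using loop(2) that by (simp add: root_space_def)
    ultimately have "br (loop (single 0 x)) y = sL (\<alpha> x) y"
      by (simp add: loop(1) bracket_loop loop_scale)
    then show ?thesis by (rule commute_shift[OF loop_mem generators_mem[OF assms]])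
  qed
  then show ?thesis by blast
next
  case gens
  then have "loop_act x 0 (\<rho> y v) = \<rho> y (loop_act x 0 v)" for x v
    using commute_zero[OF loop_mem gens_mem loop_gens] by blast
  then show ?thesis by (intro exI[of _ "\<lambda>_. 0"]) simp
qed

sublocale core: core_module scale bracket h form \<Delta> \<theta> sV "\<lambda>x r. loop_act x r" "\<lambda>u r. cent_act u r" wt "\<rho> ` generators"
proof
  show "CARD('n) \<ge> 2" by (rule card)
  show "V.endo (loop_act x r)" for x r by (rule rho_endo[OF loop_mem])
  show "V.endo (cent_act u r)" for u r by (rule rho_endo[OF cent_mem])
  show "loop_act (x + y) r v = loop_act x r v + loop_act y r v" for x y r v by (rule loop_act_add)
  show "loop_act (scale c x) r v = sV c (loop_act x r v)" for c x r v by (rule loop_act_scale)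
  show "cent_act (u + w) r v = cent_act u r v + cent_act w r v" for u w r v by (rule cent_act_add)
  show "cent_act (c *s u) r v = sV c (cent_act u r v)" for c u r v by (rule cent_act_scale)
  show "loop_act x r (loop_act y s v) - loop_act y s (loop_act x r v) =
      loop_act (bracket x y) (r + s) v + sV (form x y) (cent_act (vec_of_int r) (r + s) v)" for x y r s v
    by (simp only: rho_bracket[OF loop_mem loop_mem, symmetric] bracket_loop cent_scale rho_add[OF loop_mem cent_mem]
        cent_act_scale)
  show "cent_act u k (loop_act x r v) = loop_act x r (cent_act u k v)" for u k x r v
    by (rule commute_zero[OF cent_mem loop_mem bracket_cent])
  show "V.subspace (wt \<mu>)" for \<mu> unfolding wt_def by (rule subspace_D_weight_space[OF deg_mem])
  show "\<exists>m. V.spanned_by m (wt \<mu>)" for \<mu>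
    using quasi_finite by (simp add: quasi_finite_def wt_def V.finite_dim_iff)
  show "V.span (\<Union>\<mu>. wt \<mu>) = UNIV" using quasi_finite by (simp add: quasi_finite_def wt_def)
  show "loop_act x r v \<in> wt (\<mu> + vec_of_int r)" if "v \<in> wt \<mu>" for x r v \<mu>
    using that unfolding wt_def by (rule weight_space_shift[OF deg_mem loop_mem degree_loop])
  show "cent_act u 0 v \<in> wt \<mu>" if "v \<in> wt \<mu>" for u v \<mu>
    using weight_space_shift[OF deg_mem cent_mem degree_cent that[unfolded wt_def], of u 0] by (simp add: wt_def)
  show "\<exists>v :: 'v. v \<noteq> 0" using irreducible by (simp add: irreducible_module_def)
  show "V.endo T" if "T \<in> \<rho> ` generators" for T using that generators_mem rho_endo by blast
  show "\<exists>r. \<forall>\<mu>. \<forall>v\<in>wt \<mu>. T v \<in> wt (\<mu> + r)" if T: "T \<in> \<rho> ` generators" for T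
  proof -
    obtain y where y: "y \<in> generators" "T = \<rho> y" using T by blast
    obtain r where "\<And>i. br (deg (axis i 1)) y = sL (of_int (r $ i)) y"
      using generators_degree[OF y(1)] by blast
    from weight_space_shift[where d = "\<lambda>i. deg (axis i 1)", OF deg_mem generators_mem[OF y(1)] this]
    show ?thesis unfolding y(2) wt_def by blast
  qed
  show "\<exists>\<alpha>. \<forall>y\<in>h. \<forall>v. loop_act y 0 (T v) = T (loop_act y 0 v) + sV (\<alpha> y) (T v)" if "T \<in> \<rho> ` generators" for T
    using that generators_h by blast
  show "cent_act u 0 (T v) = T (cent_act u 0 v)" if T: "T \<in> \<rho> ` generators" for T u v
  proof -
    obtain y where y: "y \<in> generators" "T = \<rho> y" using T by blast
    have "br (cent u 0) y = 0"
      using y(1) by (cases rule: generators_cases) (simp_all add: bracket_cent cent_gens)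
    then show ?thesis unfolding y(2) by (rule commute_zero[OF cent_mem generators_mem[OF y(1)]])
  qed
  show "W = {0} \<or> W = UNIV" if "V.subspace W" "\<And>T w. T \<in> \<rho> ` generators \<Longrightarrow> w \<in> W \<Longrightarrow> T w \<in> W" for W
    using that by (intro generators_irreducible) auto
qed

lemma deg_act:
  assumes "v \<in> wt \<mu>"
  shows "\<rho> (deg u) v = sV (\<Sum>i\<in>UNIV. u $ i * \<mu> $ i) v"
proof -
  have axis: "\<rho> (deg (c *s axis i 1)) v = sV (c * \<mu> $ i) v" for c i
    using assms by (simp add: rho_scale[OF deg_mem] wt_def D_weight_space_def flip: deg_scale)
  have "deg 0 + deg 0 = deg 0" using deg_add[of 0 0] by simp
  then have 0: "\<rho> (deg 0) v = 0" using rho_0[OF zero_mem] by simp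
  have "\<rho> (deg (\<Sum>i\<in>I. u $ i *s axis i 1)) v = sV (\<Sum>i\<in>I. u $ i * \<mu> $ i) v" for I
    by (induction I rule: infinite_finite_induct)
      (simp_all add: 0 axis deg_add rho_add[OF deg_mem deg_mem] V.scale_left_distrib)
  from this[of UNIV] show ?thesis unfolding basis_expansion .
qed

text \<open>The twisting matrix is the inverse of \<open>P\<close>, since the inverse twist sends
  degree \<open>k\<close> to \<open>matrix_inv A *v k\<close>.\<close>

lemma ghw_twist:
  assumes core.ghw
  obtains A :: "int ^ 'n ^ 'n" and \<mu> v and N :: nat where "invertible A" "v \<noteq> 0"
    "\<And>u. \<rho> (deg u) v = sV (\<Sum>i\<in>UNIV. u $ i * \<mu> $ i) v"
    "\<And>k x u. \<forall>i. int N \<le> k $ i \<Longrightarrow>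
      \<rho> (loop (single (matrix_inv A *v k) x) + cent u (matrix_inv A *v k)) v = 0"
proof -
  obtain P :: "int ^ 'n ^ 'n" and \<mu> v and N :: nat where P: "invertible P" "v \<in> wt \<mu>" "v \<noteq> 0"
    "\<forall>k. (\<forall>i. int N \<le> k $ i) \<longrightarrow> (\<forall>x. loop_act x (P *v k) v = 0) \<and> (\<forall>u. cent_act u (P *v k) v = 0)"
    using assms unfolding core.ghw_def by blast
  show ?thesis
    by (rule that[of "matrix_inv P" v \<mu> N])
      (use P in \<open>simp_all add: invertible_matrix_inv deg_act rho_add[OF loop_mem cent_mem]\<close>)
qed

lemma integrable:
  assumes "\<not> core.ghw"
  shows "integrable_module sL {loop (single 0 x) + cent a 0 + deg u | x a u. x \<in> h}
    (loop ` real_root_vectors scale bracket h) sV \<rho>"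
proof (rule core.integrable_module_criterion[OF assms, where d = "\<lambda>i. deg (axis i 1)"])
  let ?H = "{loop (single 0 x) + cent a 0 + deg u | x a u. x \<in> h}"
  have HL: "y \<in> L" if "y \<in> ?H" for y using that by (auto intro!: add_mem loop_mem cent_mem deg_mem)
  have HI: "loop (single 0 x) + cent a 0 + deg u \<in> ?H" if "x \<in> h" for x a u using that by blast
  show "x + y \<in> ?H" if xy: "x \<in> ?H" "y \<in> ?H" for x y
  proof -
    obtain x1 a1 u1 x2 a2 u2 where *: "x = loop (single 0 x1) + cent a1 0 + deg u1"
      "y = loop (single 0 x2) + cent a2 0 + deg u2" "x1 \<in> h" "x2 \<in> h"
      using xy by blast
    have "x + y = loop (single 0 (x1 + x2)) + cent (a1 + a2) 0 + deg (u1 + u2)"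
      by (simp add: *(1,2) single_add loop_add cent_add deg_add)
    then show ?thesis using HI[OF subspace_add[OF subspace_h *(3,4)]] by simp
  qed
  show "sL c x \<in> ?H" if x: "x \<in> ?H" for c x
  proof -
    obtain x1 a u where *: "x = loop (single 0 x1) + cent a 0 + deg u" "x1 \<in> h" using x by blast
    have "sL c x = loop (single 0 (scale c x1)) + cent (c *s a) 0 + deg (c *s u)"
      by (simp add: *(1) scale_add loop_scale cent_scale deg_scale)
    then show ?thesis using HI[OF subspace_scale[OF subspace_h *(2)]] by simp
  qed
  show "\<rho> (x + y) v = \<rho> x v + \<rho> y v" if "x \<in> ?H" "y \<in> ?H" for x y v
    using that by (intro rho_add HL)
  show "\<rho> (sL c x) v = sV c (\<rho> x v)" if "x \<in> ?H" for c x v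
    using that by (intro rho_scale HL)
  show "\<exists>x\<in>h. \<exists>b. \<forall>\<mu>. \<forall>v\<in>wt \<mu>. \<rho> y v = loop_act x 0 v + sV (\<Sum>i\<in>UNIV. b $ i * \<mu> $ i) v" if y: "y \<in> ?H" for y
  proof -
    obtain x a u where y: "y = loop (single 0 x) + cent a 0 + deg u" "x \<in> h" using y by blast
    \<comment> \<open>By level zero only the parts of \<open>y\<close> in \<open>h\<close> and among
      the degree operators act.\<close>
    have cent: "cent_act a 0 v = 0" for v
    proof -
      have "cent_act (\<Sum>i\<in>I. a $ i *s axis i 1) 0 v = 0" for I
        by (induction I rule: infinite_finite_induct)
          (simp_all add: cent_act_add cent_act_scale core.level_zero[OF assms])
      from this[of UNIV] show ?thesis by (simp add: basis_expansion)
    qed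
    have "\<rho> y v = loop_act x 0 v + sV (\<Sum>i\<in>UNIV. u $ i * \<mu> $ i) v" if "v \<in> wt \<mu>" for \<mu> v
      by (simp add: y(1) rho_add add_mem loop_mem cent_mem deg_mem cent deg_act[OF that])
    then show ?thesis using y(2) by blast
  qed
  show "wt = D_weight_space (\<lambda>i. deg (axis i 1)) sV \<rho>" by (rule wt_def)
  show "deg (axis i 1) \<in> ?H" for i
  proof -
    have "loop 0 + loop 0 = loop 0" "cent 0 0 + cent 0 0 = cent 0 0"
      using loop_add[of 0 0] cent_add[of 0 0 0] by simp_all
    then show ?thesis using HI[OF subspace_0[OF subspace_h], of 0 "axis i 1"] by simp
  qed
  fix y assume "y \<in> loop ` real_root_vectors scale bracket h"
  then obtain k x \<alpha> where y: "y = loop (single k x)" "\<alpha> \<in> dual_space scale h" "\<alpha> \<noteq> 0"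
    "x \<in> root_space scale bracket h \<alpha>" unfolding real_root_vectors_def by blast
  obtain y0 where "\<alpha> y0 \<noteq> 0" using y(3) by (auto simp: fun_eq_iff)
  moreover from this have "y0 \<in> h" using y(2) by (auto simp: dual_space_def)
  ultimately show "\<exists>k x \<alpha> y0. x \<in> root_space scale bracket h \<alpha> \<and> y0 \<in> h \<and> \<alpha> y0 \<noteq> 0 \<and> \<rho> y = loop_act x k"
    using y(1,4) by blast
qed

end

section \<open>Twists\<close>

lemma matrix_inv_cancel:
  assumes "invertible (A :: int ^ 'n ^ 'n)"
  shows "A *v (matrix_inv A *v m) = m" "matrix_inv A *v (A *v m) = m"
  by (simp_all add: matrix_vector_mul_assoc matrix_inv_int[OF assms])

lemma loop_twist_single: "loop_twist A (single m x) = single (A *v m) x"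
  by (simp add: loop_twist_def)

lemma loop_twist_add: "loop_twist A (p + q) = loop_twist A p + loop_twist A q"
  unfolding loop_twist_def by (rule lin_ext_add) (simp_all add: single_add)

lemma loop_twist_inverse:
  assumes "invertible (A :: int ^ 'n ^ 'n)"
  shows "loop_twist (matrix_inv A) (loop_twist A l) = l"
proof (induction l rule: pm_induct)
  case (single m x)
  show ?case by (simp add: loop_twist_single matrix_inv_cancel[OF assms])
next
  case (add p q)
  then show ?case by (simp add: loop_twist_add)
qed

lemma loop_twist_inj:
  assumes "invertible (A :: int ^ 'n ^ 'n)"
  shows "inj (loop_twist A)"
  by (rule inj_on_inverseI) (rule loop_twist_inverse[OF assms])

lemma D_twist_0: "D_twist A 0 = 0"
  by (simp add: D_twist_def)

lemma der_twist_single: "der_twist A (single m u) = single (A *v m) (D_twist A u)"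
  by (simp add: der_twist_def D_twist_0)

lemma der_twist_add: "der_twist A (p + q) = der_twist A p + der_twist A q"
  unfolding der_twist_def
  by (rule lin_ext_add) (simp_all add: D_twist_0 single_add, simp add: D_twist_def vector_matrix_left_distrib single_add)

lemma der_twist_scale: "der_twist A (der_scale c p) = der_scale c (der_twist A p)"
  unfolding der_twist_def
  by (rule lin_ext_scale)
    (simp_all add: D_twist_0 vec.vector_space_axioms der.module_axioms pm_scale_single,
      simp add: D_twist_def scalar_vector_matrix_assoc)

text \<open>The inverse twist is later evaluated by exhibiting a preimage, which injectivity makes
  unique.\<close>

lemma eala_twist_inj:
  assumes "invertible (A :: int ^ 'n ^ 'n)"
  shows "inj (eala_twist A :: ('g::ab_group_add, 'n) eala_elem \<Rightarrow> _)"
proof (rule injI)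
  fix x y :: "('g, 'n) eala_elem"
  assume eq: "eala_twist A x = eala_twist A y"
  obtain l f d l' f' d' where xy: "x = (l, f, d)" "y = (l', f', d')" by (metis prod_cases3)
  note bij = der_twist_inverse(2)[OF assms]
  have "l = l'" using eq loop_twist_inj[OF assms] by (auto simp: xy eala_twist_def dest: injD)
  moreover have "d = d'" using eq bij_is_inj[OF bij] by (auto simp: xy eala_twist_def dest: injD)
  moreover have "f = f'"
  proof
    fix e
    have "(f \<circ> inv (der_twist A)) (der_twist A e) = (f' \<circ> inv (der_twist A)) (der_twist A e)"
      using eq by (simp add: xy eala_twist_def)
    then show "f e = f' e" by (simp add: inv_f_f[OF bij_is_inj[OF bij]])
  qed
  ultimately show "x = y" by (simp add: xy)
qed

section \<open>The graded dual\<close>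

lemma graded_prod_0: "graded_prod b 0 q = 0" "graded_prod b p 0 = 0"
  by (simp_all add: graded_prod_def lin_ext_def)

lemma sum_fun_apply: "(\<Sum>i\<in>I. F i) x = (\<Sum>i\<in>I. F i x)"
  for F :: "'i \<Rightarrow> 'a \<Rightarrow> 'b::comm_monoid_add"
  by (induction I rule: infinite_finite_induct) simp_all

lemma poly_mapping_sum_single: "(\<Sum>q\<in>keys d. single q (lookup d q)) = d"
  by (rule poly_mapping_eqI) (auto simp: lookup_sum lookup_single when_def in_keys_iff)

lemma der_bracket_add: "der_bracket d (p + q) = der_bracket d p + der_bracket d q"
  "der_bracket (p + q) d = der_bracket p d + der_bracket q d"
  unfolding der_bracket_def
  by (rule graded_prod_add_right graded_prod_add_left;
      simp add: vec.scale_right_distrib vec.scale_left_distrib algebra_simps)+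

lemma der_bracket_single: "der_bracket (single r u) (single s v) =
    single (r + s) (pairing u s *s v - pairing v r *s u)"
  unfolding der_bracket_def by (rule graded_prod_single) simp_all

lemma der_bracket_0: "der_bracket 0 d = 0" "der_bracket d 0 = 0"
  by (simp_all add: der_bracket_def graded_prod_0)

lemma lookup_der_bracket_single:
  "lookup (der_bracket (single r w) d) q =
    pairing w (q - r) *s lookup d (q - r) - pairing (lookup d (q - r)) r *s w"
proof (induction d rule: pm_induct)
  case (single k x)
  have "r + k = q \<longleftrightarrow> k = q - r" by (auto simp: algebra_simps)
  then show ?case by (auto simp: der_bracket_single lookup_single when_def)
next
  case (add p q)
  then show ?case
    by (simp add: der_bracket_add lookup_add vec.scale_right_distrib vec.scale_left_distrib algebra_simps)
qed

text \<open>The functional \<open>\<Sum>\<^sub>i u\<^sub>i t\<^sup>r K\<^sub>i\<close>. It reads the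
  component of degree \<open>- r\<close>, because degree \<open>r\<close> of the graded dual is dual
  to degree \<open>- r\<close> of \<open>\<D>\<close>.\<close>

definition center_functional :: "('n::finite) der set \<Rightarrow> complex ^ 'n \<Rightarrow> int ^ 'n \<Rightarrow> 'n der \<Rightarrow> complex"
  where "center_functional \<D> u r = (\<lambda>d. if d \<in> \<D> then \<Sum>i\<in>UNIV. u $ i * lookup d (- r) $ i else 0)"

lemma center_functional_eq:
  "(\<Sum>i\<in>UNIV. fun_scale (u $ i) (K_functional \<D> r i)) = center_functional \<D> u r"
  by (rule ext) (simp add: sum_fun_apply fun_scale_def K_functional_def center_functional_def)

lemma center_functional_axis: "center_functional \<D> (axis i 1) r = K_functional \<D> r i"
  by (rule ext) (simp add: center_functional_def K_functional_def axis_def if_distrib[of "\<lambda>x. x * _"] cong: if_cong)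

lemma center_functional_add: "center_functional \<D> (u + w) r = center_functional \<D> u r + center_functional \<D> w r"
  and center_functional_scale: "center_functional \<D> (c *s u) r = fun_scale c (center_functional \<D> u r)"
  by (rule ext, simp add: center_functional_def fun_scale_def distrib_right sum.distrib sum_distrib_left mult.assoc)+

locale graded_derivations =
  fixes \<D> :: "('n::finite) der set"
  assumes graded: "graded_der_subalgebra \<D>"
begin

lemma subspace_D: "der.subspace \<D>"
  and skew_D: "d \<in> \<D> \<Longrightarrow> pairing (lookup d r) r = 0"
  and bracket_D: "d \<in> \<D> \<Longrightarrow> d' \<in> \<D> \<Longrightarrow> der_bracket d d' \<in> \<D>"
  and homogeneous_D: "d \<in> \<D> \<Longrightarrow> single r (lookup d r) \<in> \<D>"
  using graded by (auto simp: graded_der_subalgebra_def skew_der_def)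

lemma zero_D: "0 \<in> \<D>"
  by (rule der.subspace_0[OF subspace_D])

lemma skew_single: "single r w \<in> \<D> \<Longrightarrow> pairing w r = 0"
  using skew_D[of "single r w" r] by simp

lemma graded_dual_add: "f \<in> graded_dual \<D> \<Longrightarrow> d \<in> \<D> \<Longrightarrow> d' \<in> \<D> \<Longrightarrow> f (d + d') = f d + f d'"
  and graded_dual_scale: "f \<in> graded_dual \<D> \<Longrightarrow> d \<in> \<D> \<Longrightarrow> f (der_scale c d) = c * f d"
  and graded_dual_outside: "f \<in> graded_dual \<D> \<Longrightarrow> d \<notin> \<D> \<Longrightarrow> f d = 0"
  by (auto simp: graded_dual_def dual_space_def linear_functional_on_def)

lemma graded_dual_0: "f \<in> graded_dual \<D> \<Longrightarrow> f 0 = 0"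
  using graded_dual_scale[of f 0 0] zero_D by simp

lemma linear_homogeneous_sum:
  assumes "linear_functional_on der_scale \<D> f" "d \<in> \<D>"
  shows "f d = (\<Sum>q\<in>keys d. f (single q (lookup d q)))"
proof -
  let ?s = "\<lambda>q. single q (lookup d q)"
  have f0: "f 0 = 0" using assms(1) zero_D unfolding linear_functional_on_def
    by (metis der.scale_zero_left mult_zero_left)
  have "sum ?s I \<in> \<D> \<and> f (sum ?s I) = (\<Sum>q\<in>I. f (?s q))" for I
    using assms homogeneous_D[OF assms(2)] f0 zero_D der.subspace_add[OF subspace_D]
    by (induction I rule: infinite_finite_induct) (auto simp: linear_functional_on_def)
  from this[of "keys d"] show ?thesis by (simp add: poly_mapping_sum_single)
qed

lemma graded_dual_linear: "f \<in> graded_dual \<D> \<Longrightarrow> linear_functional_on der_scale \<D> f"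
  by (simp add: graded_dual_def dual_space_def)

lemma graded_dualI:
  assumes "linear_functional_on der_scale \<D> f" "\<And>d. d \<notin> \<D> \<Longrightarrow> f d = 0"
    and "finite R" "\<And>r d. r \<notin> R \<Longrightarrow> d \<in> der_component \<D> r \<Longrightarrow> f d = 0"
  shows "f \<in> graded_dual \<D>"
proof -
  have "{r. \<exists>d\<in>der_component \<D> r. f d \<noteq> 0} \<subseteq> R" using assms(4) by blast
  then have "finite {r. \<exists>d\<in>der_component \<D> r. f d \<noteq> 0}" using assms(3) by (rule finite_subset)
  with assms(1,2) show ?thesis by (simp add: graded_dual_def dual_space_def)
qed

lemma graded_dual_componentI:
  assumes "linear_functional_on der_scale \<D> f" "\<And>d. d \<notin> \<D> \<Longrightarrow> f d = 0"
    and "\<And>s d. s \<noteq> - r \<Longrightarrow> d \<in> der_component \<D> s \<Longrightarrow> f d = 0"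
  shows "f \<in> graded_dual_component \<D> r"
  using graded_dualI[OF assms(1,2), of "{- r}"] assms(3) by (auto simp: graded_dual_component_def)

lemma graded_dual_component_eval:
  assumes f: "f \<in> graded_dual_component \<D> r" and d: "d \<in> \<D>"
  shows "f d = f (single (- r) (lookup d (- r)))"
proof -
  let ?s = "\<lambda>q. single q (lookup d q)"
  have fg: "f \<in> graded_dual \<D>" using f by (simp add: graded_dual_component_def)
  have 0: "f (?s q) = 0" if "q \<noteq> - r" for q
    using f that homogeneous_D[OF d, of q] by (auto simp: graded_dual_component_def der_component_def)
  have "f d = (\<Sum>q\<in>keys d. f (?s q))"
    by (rule linear_homogeneous_sum[OF graded_dual_linear[OF fg] d])
  also have "\<dots> = (\<Sum>q\<in>insert (- r) (keys d). f (?s q))"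
    by (rule sum.mono_neutral_left) (auto simp: in_keys_iff graded_dual_0[OF fg])
  also have "\<dots> = (\<Sum>q\<in>{- r}. f (?s q))"
    by (rule sum.mono_neutral_right) (auto simp: 0)
  finally show ?thesis by simp
qed

lemma center_functional_component: "center_functional \<D> u r \<in> graded_dual_component \<D> r"
proof (rule graded_dual_componentI)
  show "linear_functional_on der_scale \<D> (center_functional \<D> u r)"
    using der.subspace_add[OF subspace_D] der.subspace_scale[OF subspace_D]
    by (simp add: linear_functional_on_def center_functional_def lookup_add lookup_pm_scale distrib_left
        sum.distrib sum_distrib_left mult.left_commute)
  show "center_functional \<D> u r d = 0" if "d \<notin> \<D>" for d using that by (simp add: center_functional_def)
  show "center_functional \<D> u r d = 0" if "s \<noteq> - r" "d \<in> der_component \<D> s" for s d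
    using that by (auto simp: center_functional_def der_component_def lookup_single when_def)
qed

lemma center_functional_dual: "center_functional \<D> u r \<in> graded_dual \<D>"
  using center_functional_component by (simp add: graded_dual_component_def)

text \<open>A functional on \<open>\<D>\<^sub>-\<^sub>r\<close> extends to all of \<open>t\<^sup>-\<^sup>r \<otimes> D\<close>.\<close>

lemma graded_dual_component_eq:
  assumes f: "f \<in> graded_dual_component \<D> r"
  obtains u where "f = center_functional \<D> u r"
proof -
  interpret dual: vector_space_pair "(*s) :: complex \<Rightarrow> complex ^ 'n \<Rightarrow> _" "(*) :: complex \<Rightarrow> complex \<Rightarrow> complex"
    by (intro vector_space_pair.intro vec.vector_space_axioms) (unfold_locales, simp_all add: algebra_simps)
  let ?s = "\<lambda>w. single (- r) w"
  define U where "U = {w. ?s w \<in> \<D>}"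
  have fg: "f \<in> graded_dual \<D>" using f by (simp add: graded_dual_component_def)
  have U: "vec.subspace U"
    unfolding vec.subspace_def U_def
    using zero_D der.subspace_add[OF subspace_D] der.subspace_scale[OF subspace_D]
    by (auto simp: single_add simp flip: pm_scale_single)
  obtain B where B: "B \<subseteq> U" "vec.independent B" "U \<subseteq> vec.span B"
    by (rule vec.maximal_independent_subset[of U])
  obtain F where F: "Vector_Spaces.linear (*s) (*) F" "\<forall>w\<in>B. F w = f (?s w)"
    using dual.linear_independent_extend[OF B(2), of "\<lambda>w. f (?s w)"] by blast
  have Fadd: "F (x + y) = F x + F y" and Fscale: "F (c *s x) = c * F x" for x y c
    using F(1) by (simp_all add: Vector_Spaces.linear_iff)
  have F0: "F 0 = 0" using Fscale[of 0 0] by simp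
  have "vec.subspace {w\<in>U. F w = f (?s w)}"
    using U graded_dual_add[OF fg] graded_dual_scale[OF fg] graded_dual_0[OF fg]
    by (auto simp: vec.subspace_def U_def Fadd Fscale F0 single_add simp flip: pm_scale_single)
  then have "vec.span B \<subseteq> {w\<in>U. F w = f (?s w)}" using B(1) F(2) by (intro vec.span_minimal) auto
  with B(3) have FU: "F w = f (?s w)" if "w \<in> U" for w using that by blast
  let ?u = "\<chi> i. F (axis i 1)"
  have Fsum: "F w = (\<Sum>i\<in>UNIV. ?u $ i * w $ i)" for w
  proof -
    have "F (\<Sum>i\<in>I. w $ i *s axis i 1) = (\<Sum>i\<in>I. w $ i * F (axis i 1))" for I
      by (induction I rule: infinite_finite_induct) (simp_all add: Fadd Fscale F0)
    from this[of UNIV] show ?thesis by (simp add: basis_expansion mult.commute)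
  qed
  have "f = center_functional \<D> ?u r"
  proof
    fix d
    show "f d = center_functional \<D> ?u r d"
    proof (cases "d \<in> \<D>")
      case True
      then have "lookup d (- r) \<in> U" using homogeneous_D by (simp add: U_def)
      from FU[OF this] have "f d = F (lookup d (- r))"
        using graded_dual_component_eval[OF f True] by simp
      then show ?thesis using Fsum[of "lookup d (- r)"] True by (simp add: center_functional_def)
    next
      case False
      then show ?thesis using graded_dual_outside[OF fg] by (simp add: center_functional_def)
    qed
  qed
  then show ?thesis by (rule that)
qed

text \<open>Cut \<open>f\<close> down to the homogeneous components of \<open>\<D>\<close>; the
  finiteness built into \<open>graded_dual\<close> makes the sum finite.\<close>

lemma graded_dual_decomposition:
  assumes f: "f \<in> graded_dual \<D>"
  obtains R F where "finite R" "\<And>r. F r \<in> graded_dual_component \<D> r" "f = (\<Sum>r\<in>R. F r)"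
proof -
  let ?s = "\<lambda>d q. single q (lookup d q)"
  define F where "F r = (\<lambda>d. if d \<in> \<D> then f (?s d (- r)) else 0)" for r
  have F: "F r \<in> graded_dual_component \<D> r" for r
  proof (rule graded_dual_componentI)
    have "f (?s (d + d') (- r)) = f (?s d (- r)) + f (?s d' (- r))" if "d \<in> \<D>" "d' \<in> \<D>" for d d'
      using graded_dual_add[OF f homogeneous_D[OF that(1)] homogeneous_D[OF that(2)]] by (simp add: lookup_add single_add)
    moreover have "f (?s (der_scale c d) (- r)) = c * f (?s d (- r))" if "d \<in> \<D>" for c d
      using graded_dual_scale[OF f homogeneous_D[OF that]] by (simp add: lookup_pm_scale pm_scale_single)
    ultimately show "linear_functional_on der_scale \<D> (F r)"
      using der.subspace_add[OF subspace_D] der.subspace_scale[OF subspace_D]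
      by (simp add: linear_functional_on_def F_def)
    show "F r d = 0" if "d \<notin> \<D>" for d using that by (simp add: F_def)
    show "F r d = 0" if "s \<noteq> - r" "d \<in> der_component \<D> s" for s d
      using that graded_dual_0[OF f] by (auto simp: F_def der_component_def lookup_single when_def)
  qed
  let ?Q = "{r. \<exists>d\<in>der_component \<D> r. f d \<noteq> 0}"
  have fin: "finite ?Q" using f by (simp add: graded_dual_def)
  have "f = (\<Sum>r\<in>uminus ` ?Q. F r)"
  proof
    fix d
    show "f d = (\<Sum>r\<in>uminus ` ?Q. F r) d"
    proof (cases "d \<in> \<D>")
      case True
      have "f d = (\<Sum>q\<in>keys d. f (?s d q))"
        by (rule linear_homogeneous_sum[OF graded_dual_linear[OF f] True])
      also have "\<dots> = (\<Sum>q\<in>keys d \<union> ?Q. f (?s d q))"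
        using fin by (intro sum.mono_neutral_left) (auto simp: in_keys_iff graded_dual_0[OF f])
      also have "\<dots> = (\<Sum>q\<in>?Q. f (?s d q))"
        using fin homogeneous_D[OF True] by (intro sum.mono_neutral_right) (auto simp: der_component_def)
      also have "\<dots> = (\<Sum>r\<in>uminus ` ?Q. F r) d"
        using True by (simp add: sum_fun_apply F_def sum.reindex inj_on_def)
      finally show ?thesis .
    next
      case False
      then show ?thesis using graded_dual_outside[OF f] by (simp add: sum_fun_apply F_def)
    qed
  qed
  with fin F show ?thesis by (intro that[of "uminus ` ?Q" F]) auto
qed

lemma coadjoint_zero: "f \<in> graded_dual \<D> \<Longrightarrow> coadjoint \<D> 0 f = 0" "coadjoint \<D> d 0 = 0"
  by (rule ext, simp add: coadjoint_def der_bracket_0 graded_dual_0)+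

lemma coadjoint_degree_0:
  assumes f: "f \<in> graded_dual_component \<D> r" and u: "single 0 u \<in> \<D>"
  shows "coadjoint \<D> (single 0 u) f = fun_scale (pairing u r) f"
proof
  fix d
  have fg: "f \<in> graded_dual \<D>" using f by (simp add: graded_dual_component_def)
  have m: "pairing u (- r) = - pairing u r" by (simp add: pairing_def sum_negf)
  show "coadjoint \<D> (single 0 u) f d = fun_scale (pairing u r) f d"
  proof (cases "d \<in> \<D>")
    case True
    have "f (der_bracket (single 0 u) d)
        = f (der_scale (pairing u (- r)) (single (- r) (lookup d (- r))))"
      by (subst graded_dual_component_eval[OF f bracket_D[OF u True]])
        (simp add: lookup_der_bracket_single pm_scale_single)
    also have "\<dots> = pairing u (- r) * f d"
      by (simp add: graded_dual_scale[OF fg homogeneous_D[OF True]] flip: graded_dual_component_eval[OF f True])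
    finally show ?thesis using True by (simp add: coadjoint_def fun_scale_def m)
  next
    case False
    then show ?thesis using graded_dual_outside[OF fg] by (simp add: coadjoint_def fun_scale_def)
  qed
qed

text \<open>Here skewness makes the \<open>K_i\<close> central: both terms in the degree-zero
  component of the bracket pair a coefficient with its own degree up to sign.\<close>

lemma coadjoint_center_0:
  assumes "single r w \<in> \<D>"
  shows "coadjoint \<D> (single r w) (center_functional \<D> u 0) = 0"
proof
  fix d
  show "coadjoint \<D> (single r w) (center_functional \<D> u 0) d = 0 d"
  proof (cases "d \<in> \<D>")
    case True
    have "pairing w (- r) = 0" "pairing (lookup d (- r)) r = 0"
      using skew_single[OF assms] skew_D[OF True, of "- r"] by (simp_all add: pairing_def sum_negf)
    then show ?thesis
      by (simp add: coadjoint_def center_functional_def lookup_der_bracket_single)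
  qed (simp add: coadjoint_def)
qed

end

section \<open>Modules over extended affine Lie algebras\<close>

lemma pm_scale_zero: "s c 0 = 0 \<Longrightarrow> pm_scale s c 0 = 0"
  by (rule poly_mapping_eqI) (simp add: lookup_pm_scale)

lemma pm_scale_single': "s c 0 = 0 \<Longrightarrow> pm_scale s c (single r x) = single r (s c x)"
  by (rule poly_mapping_eqI) (simp add: lookup_pm_scale lookup_single when_def)

lemma fun_scale_zero: "fun_scale c 0 = 0" "fun_scale 0 f = 0"
  by (simp_all add: fun_scale_def fun_eq_iff)

section \<open>Brackets of monomials in the loop algebra\<close>

context cartan_decomposition
begin

lemma loop_bracket_single: "loop_bracket bracket (single r x) (single s y) =
    single (r + s) (bracket x y)"
  unfolding loop_bracket_def by (rule graded_prod_single) simp_all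

lemma loop_bracket_0: "loop_bracket bracket 0 l = 0" "loop_bracket bracket l 0 = 0"
  by (simp_all add: loop_bracket_def graded_prod_0)

lemma der_act_single: "der_act scale (single r u) (single s x) =
    single (r + s) (scale (pairing u s) x)"
  unfolding der_act_def by (rule graded_prod_single) simp_all

lemma der_act_0: "der_act scale 0 l = 0" "der_act scale d 0 = 0"
  by (simp_all add: der_act_def graded_prod_0)

lemma der_act_add: "der_act scale (d + d') l = der_act scale d l + der_act scale d' l"
  unfolding der_act_def by (rule graded_prod_add_left) (simp_all add: scale_left_distrib)

lemma loop_form_add: "loop_form form (p + q) l = loop_form form p l + loop_form form q l"
  unfolding loop_form_def
  by (rule lin_ext_add) (simp_all add: lin_ext_def form_add_left if_distrib sum.distrib cong: if_cong,
      simp add: sum.distrib[symmetric] if_distrib cong: if_cong)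

lemma loop_form_0: "loop_form form 0 l = 0"
  by (simp add: loop_form_def lin_ext_def)

lemma loop_form_single:
  "loop_form form (single r x) (single s y) = (if r + s = 0 then form x y else 0)"
  by (simp add: loop_form_def lin_ext_def)

lemma sigma_form_0: "sigma_form scale form \<D> 0 l = 0"
  by (rule ext) (simp add: sigma_form_def der_act_0 loop_form_0)

lemma sigma_form_0_right: "sigma_form scale form \<D> l 0 = 0"
  by (rule ext) (simp add: sigma_form_def loop_form_def lin_ext_def)

text \<open>Only the component of \<open>d\<close> of degree \<open>- (r + s)\<close> brings the two
  monomials into opposite degrees, which produces a functional of degree
  \<open>r + s\<close>.\<close>

lemma sigma_form_single:
  "sigma_form scale form \<D> (single r x) (single s y) =
    fun_scale (form x y) (center_functional \<D> (vec_of_int r) (r + s))"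
proof
  fix d
  have "loop_form form (der_act scale d (single r x)) (single s y)
      = form x y * (\<Sum>i\<in>UNIV. vec_of_int r $ i * lookup d (- (r + s)) $ i)"
  proof (induction d rule: pm_induct)
    case (single q w)
    have "q + r + s = 0 \<longleftrightarrow> q = - (r + s)" by (metis add.assoc eq_neg_iff_add_eq_0)
    then show ?case
      by (auto simp: der_act_single loop_form_single form_scale_left lookup_single when_def pairing_def vec_of_int_def
          mult.commute)
  next
    case (add p q)
    then show ?case by (simp add: der_act_add loop_form_add lookup_add distrib_left sum.distrib)
  qed
  then show "sigma_form scale form \<D> (single r x) (single s y) d =
      fun_scale (form x y) (center_functional \<D> (vec_of_int r) (r + s)) d"
    by (simp add: sigma_form_def fun_scale_def center_functional_def)
qed

end

locale eala_module = normalized_simple_lie_algebra scale bracket h form \<Delta> \<theta> + graded_derivations \<D>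
  + lie_rep "eala_scale scale" "eala \<D>" "eala_bracket scale bracket form \<D> \<phi>" sV \<rho>
  for scale :: "complex \<Rightarrow> 'g::ab_group_add \<Rightarrow> 'g" and bracket :: "'g \<Rightarrow> 'g \<Rightarrow> 'g"
    and h :: "'g set" and form :: "'g \<Rightarrow> 'g \<Rightarrow> complex"
    and \<Delta> :: "('g \<Rightarrow> complex) set" and \<theta> :: "'g \<Rightarrow> complex"
    and \<D> :: "('n::finite) der set" and \<phi>
    and sV :: "complex \<Rightarrow> 'v::ab_group_add \<Rightarrow> 'v" and \<rho> :: "('g, 'n) eala_elem \<Rightarrow> 'v \<Rightarrow> 'v" +
  assumes card: "CARD('n) \<ge> 2"
    and fgc: "fgc_data \<D> \<phi>"
    and irreducible: "irreducible_module (eala_scale scale) (eala \<D>) (eala_bracket scale bracket form \<D> \<phi>) sV \<rho>"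
    and quasi_finite: "quasi_finite eala_d sV \<rho>"
begin

abbreviation "E_bracket \<equiv> eala_bracket scale bracket form \<D> \<phi>"

lemma degree_0_D: "single 0 u \<in> \<D>"
proof -
  have "single 0 u \<in> der_component \<D> 0" using fgc by (auto simp: fgc_data_def)
  then show ?thesis by (simp add: der_component_def)
qed

lemma cocycle_degree_0:
  assumes "d \<in> \<D>"
  shows "\<phi> (single 0 u) d = 0"
proof -
  have "single 0 u \<in> der_component \<D> 0" using degree_0_D by (auto simp: der_component_def)
  then show ?thesis
    using fgc assms unfolding fgc_data_def affine_cocycle_def by blast
qed

lemma cocycle_0: "d \<in> \<D> \<Longrightarrow> \<phi> 0 d = 0"
  using cocycle_degree_0[of d 0] by simp

lemma graded_dual_zero: "0 \<in> graded_dual \<D>"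
  using center_functional_dual[of 0 0] center_functional_scale[of \<D> 0 0 0]
  by (simp add: fun_scale_zero)

lemma component_dual: "f \<in> graded_dual_component \<D> r \<Longrightarrow> f \<in> graded_dual \<D>"
  by (simp add: graded_dual_component_def)

lemma loop_mem: "(l, 0, 0) \<in> eala \<D>"
  and center_mem: "f \<in> graded_dual \<D> \<Longrightarrow> (0, f, 0) \<in> eala \<D>"
  and der_mem: "d \<in> \<D> \<Longrightarrow> (0, 0, d) \<in> eala \<D>"
  using graded_dual_zero zero_D by (simp_all add: eala_def)

lemma eala_zero: "0 \<in> eala \<D>"
  using loop_mem[of 0] by (simp add: zero_prod_def)

lemma graded_dual_sum: "f \<in> graded_dual \<D> \<Longrightarrow> f' \<in> graded_dual \<D> \<Longrightarrow> f + f' \<in> graded_dual \<D>"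
proof -
  assume f: "f \<in> graded_dual \<D>" "f' \<in> graded_dual \<D>"
  show "f + f' \<in> graded_dual \<D>"
  proof (rule graded_dualI)
    show "linear_functional_on der_scale \<D> (f + f')"
      using f[THEN graded_dual_linear] by (simp add: linear_functional_on_def distrib_left)
    show "(f + f') d = 0" if "d \<notin> \<D>" for d using f[THEN graded_dual_outside] that by simp
    show "finite ({r. \<exists>d\<in>der_component \<D> r. f d \<noteq> 0} \<union> {r. \<exists>d\<in>der_component \<D> r. f' d \<noteq> 0})"
      using f by (simp add: graded_dual_def)
  qed auto
qed

lemma eala_add: "x \<in> eala \<D> \<Longrightarrow> y \<in> eala \<D> \<Longrightarrow> x + y \<in> eala \<D>"
  by (auto simp: eala_def graded_dual_sum der.subspace_add[OF subspace_D])

lemma eala_bracket_loop: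
  "E_bracket (single r x, 0, 0) (single s y, 0, 0) =
    (single (r + s) (bracket x y), 0, 0) +
    eala_scale scale (form x y) (0, center_functional \<D> (vec_of_int r) (r + s), 0)"
  by (simp add: eala_bracket_def eala_scale_def loop_bracket_single der_act_0 sigma_form_single coadjoint_zero graded_dual_zero
      der_bracket_0 cocycle_0 zero_D pm_scale_zero)

lemma eala_bracket_center_loop: "f \<in> graded_dual \<D> \<Longrightarrow> E_bracket (0, f, 0) (l, 0, 0) = 0"
  by (simp add: eala_bracket_def loop_bracket_0 der_act_0 sigma_form_0 coadjoint_zero der_bracket_0 cocycle_0 zero_D
      zero_prod_def)

lemma eala_bracket_loop_center: "f \<in> graded_dual \<D> \<Longrightarrow> E_bracket (l, 0, 0) (0, f, 0) = 0"
  by (simp add: eala_bracket_def loop_bracket_0 der_act_0 sigma_form_0_right coadjoint_zero der_bracket_0 cocycle_0 zero_D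
      zero_prod_def)

lemma eala_bracket_center: "f \<in> graded_dual \<D> \<Longrightarrow> f' \<in> graded_dual \<D> \<Longrightarrow> E_bracket (0, f, 0) (0, f', 0) = 0"
  by (simp add: eala_bracket_def loop_bracket_0 der_act_0 sigma_form_0 coadjoint_zero der_bracket_0 cocycle_0 zero_D
      zero_prod_def)

lemma cocycle_0_right: "d \<in> \<D> \<Longrightarrow> \<phi> d 0 = 0"
proof -
  assume d: "d \<in> \<D>"
  have "\<phi> d (der_scale 0 0) = fun_scale 0 (\<phi> d 0)"
    using fgc d zero_D unfolding fgc_data_def affine_cocycle_def by blast
  then show ?thesis by (simp add: fun_scale_zero)
qed

lemma eala_bracket_loop_der:
  assumes "single r w \<in> \<D>"
  shows "E_bracket (single 0 y, 0, 0) (0, 0, single r w) = 0"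
  by (simp add: eala_bracket_def loop_bracket_0 der_act_0 der_act_single sigma_form_0_right coadjoint_zero der_bracket_0
      cocycle_0 assms zero_prod_def)

lemma eala_bracket_center_der:
  assumes "single r w \<in> \<D>"
  shows "E_bracket (0, center_functional \<D> u 0, 0) (0, 0, single r w) = 0"
  by (simp add: eala_bracket_def loop_bracket_0 der_act_0 sigma_form_0 coadjoint_zero der_bracket_0
      cocycle_0 coadjoint_center_0 assms zero_prod_def)

lemma degree_loop: "E_bracket (eala_d i) (single r x, 0, 0) =
    eala_scale scale (of_int (r $ i)) (single r x, 0, 0)"
  by (simp add: eala_bracket_def eala_d_def eala_scale_def loop_bracket_0 der_act_0 der_act_single sigma_form_0
      coadjoint_zero graded_dual_zero der_bracket_0 cocycle_0_right degree_0_D pairing_axis fun_scale_zero pm_scale_zero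
      pm_scale_single')

lemma degree_center:
  assumes "f \<in> graded_dual_component \<D> r"
  shows "E_bracket (eala_d i) (0, f, 0) = eala_scale scale (of_int (r $ i)) (0, f, 0)"
  using coadjoint_degree_0[OF assms degree_0_D, of "axis i 1"]
  by (simp add: eala_bracket_def eala_d_def eala_scale_def loop_bracket_0 der_act_0 sigma_form_0 coadjoint_zero
      component_dual[OF assms] der_bracket_0 cocycle_0_right degree_0_D pairing_axis pm_scale_zero)

lemma degree_der:
  assumes "single r w \<in> \<D>"
  shows "E_bracket (eala_d i) (0, 0, single r w) =
    eala_scale scale (of_int (r $ i)) (0, 0, single r w)"
  by (simp add: eala_bracket_def eala_d_def eala_scale_def loop_bracket_0 der_act_0 sigma_form_0 coadjoint_zero
      graded_dual_zero der_bracket_single cocycle_degree_0 assms pairing_axis pm_scale_single fun_scale_zero pm_scale_zero)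

text \<open>Homogeneous, so that each shifts weights by a fixed degree; they commute with the simple
  algebra in degree zero and with the \<open>K_i\<close>.\<close>

definition gens :: "('g, 'n) eala_elem set"
  where "gens = {(0, f, 0) | f r. f \<in> graded_dual_component \<D> r} \<union>
    {(0, 0, single r w) | r w. single r w \<in> \<D>}"

lemma gensI:
  "f \<in> graded_dual_component \<D> r \<Longrightarrow> (0, f, 0) \<in> gens"
  "single r w \<in> \<D> \<Longrightarrow> (0, 0, single r w) \<in> gens"
  unfolding gens_def by blast+

lemma gens_cases:
  assumes "y \<in> gens"
  obtains (center) r f where "y = (0, f, 0)" "f \<in> graded_dual_component \<D> r"
  | (der) r w where "y = (0, 0, single r w)" "single r w \<in> \<D>"
  using assms by (auto simp: gens_def)

lemma gens_generate:
  assumes W: "V.subspace W" "\<And>y w. y \<in> gens \<Longrightarrow> w \<in> W \<Longrightarrow> \<rho> y w \<in> W"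
    and loop: "\<And>l w. w \<in> W \<Longrightarrow> \<rho> (l, 0, 0) w \<in> W" and y: "y \<in> eala \<D>" and w: "w \<in> W"
  shows "\<rho> y w \<in> W"
proof -
  have zero: "\<rho> 0 w \<in> W" by (simp add: rho_0[OF eala_zero] V.subspace_0[OF W(1)])
  have center: "\<rho> (0, f, 0) w \<in> W" if f: "f \<in> graded_dual \<D>" for f
  proof -
    obtain R F where F: "finite R" "\<And>r. F r \<in> graded_dual_component \<D> r" "f = (\<Sum>r\<in>R. F r)"
      by (rule graded_dual_decomposition[OF f]) blast
    \<comment> \<open>Membership is carried along, since additivity of \<open>\<rho>\<close> is
      available on \<open>eala \<D>\<close> only.\<close>
    have "((0, sum F R, 0) :: ('g, 'n) eala_elem) \<in> eala \<D> \<and> \<rho> (0, sum F R, 0) w \<in> W"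
      using F(1)
    proof (induction R rule: finite_induct)
      case empty
      show ?case using eala_zero zero by (simp only: sum.empty zero_prod_def simp_thms)
    next
      case (insert r R)
      have m: "(0, F r, 0) \<in> eala \<D>" by (rule center_mem[OF component_dual[OF F(2)]])
      have s: "(0, sum F (insert r R), 0) = (0, F r, 0) + ((0, sum F R, 0) :: ('g, 'n) eala_elem)"
        using insert by simp
      have "\<rho> (0, F r, 0) w \<in> W" by (rule W(2)[OF gensI(1)[OF F(2)] w])
      then show ?case
        unfolding s using insert.IH
        by (intro conjI eala_add m) (simp_all only: rho_add[OF m] V.subspace_add[OF W(1)])
    qed
    then show ?thesis by (simp add: F(3))
  qed
  have der: "\<rho> (0, 0, d) w \<in> W" if d: "d \<in> \<D>" for d
  proof -
    let ?s = "\<lambda>q. single q (lookup d q)"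
    have "sum ?s I \<in> \<D> \<and> \<rho> (0, 0, sum ?s I) w \<in> W" for I
    proof (induction I rule: infinite_finite_induct)
      case (insert r I)
      have "\<rho> (0, 0, ?s r) w \<in> W"
        by (rule W(2)[OF gensI(2)[OF homogeneous_D[OF d]] w])
      moreover have "\<rho> (0, 0, ?s r + sum ?s I) w = \<rho> (0, 0, ?s r) w + \<rho> (0, 0, sum ?s I) w"
        using rho_add[OF der_mem[OF homogeneous_D[OF d, of r]] der_mem, of "sum ?s I" w] insert by simp
      ultimately show ?case
        unfolding sum.insert[OF insert(1,2)] using insert.IH
        by (intro conjI der.subspace_add[OF subspace_D homogeneous_D[OF d]]) (simp_all only: V.subspace_add[OF W(1)])
    qed (use zero zero_D in \<open>simp_all only: sum.empty sum.infinite zero_prod_def simp_thms\<close>)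
    from this[of "keys d"] show ?thesis by (simp add: poly_mapping_sum_single)
  qed
  obtain l f d where y: "y = (l, f, d)" "f \<in> graded_dual \<D>" "d \<in> \<D>" using y by (auto simp: eala_def)
  have "\<rho> ((l, 0, 0) + (0, f, d)) w = \<rho> (l, 0, 0) w + \<rho> (0, f, d) w"
    by (rule rho_add[OF loop_mem]) (use y in \<open>simp add: eala_def\<close>)
  moreover have "\<rho> ((0, f, 0) + (0, 0, d)) w = \<rho> (0, f, 0) w + \<rho> (0, 0, d) w"
    by (rule rho_add[OF center_mem[OF y(2)] der_mem[OF y(3)]])
  ultimately show ?thesis
    using loop[OF w] center[OF y(2)] der[OF y(3)] V.subspace_add[OF W(1)] by (simp add: y(1))
qed

sublocale rep: graded_rep scale bracket h form \<Delta> \<theta> "eala_scale scale" "eala \<D>" E_bracket sV \<rho>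
  "\<lambda>l. (l, 0, 0)" "\<lambda>u r. (0, center_functional \<D> u r, 0)" "\<lambda>u. (0, 0, single 0 u)" gens
proof
  note dual = center_functional_dual
  have d: "eala_d i = (0, 0, single 0 (axis i 1))" for i by (rule eala_d_def)
  show "CARD('n) \<ge> 2" by (rule card)
  show "irreducible_module (eala_scale scale) (eala \<D>) E_bracket sV \<rho>" by (rule irreducible)
  show "quasi_finite (\<lambda>i. (0, 0, single 0 (axis i 1))) sV \<rho>"
    using quasi_finite unfolding d[abs_def] .
  show "0 \<in> eala \<D>" by (rule eala_zero)
  show "z + z' \<in> eala \<D>" if "z \<in> eala \<D>" "z' \<in> eala \<D>" for z z' :: "('g, 'n) eala_elem"
    using that by (rule eala_add)
  show "(l, 0, 0) \<in> eala \<D>" for l :: "('g, 'n) loop" by (rule loop_mem)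
  show "(0, center_functional \<D> u r, 0) \<in> eala \<D>" for u r by (rule center_mem[OF dual])
  show "(0, 0, single 0 u) \<in> eala \<D>" for u by (rule der_mem[OF degree_0_D])
  show "z \<in> eala \<D>" if "z \<in> gens" for z
    using that by (cases rule: gens_cases) (simp_all only: center_mem component_dual der_mem)
  show "eala_scale scale c (z + z') = eala_scale scale c z + eala_scale scale c z'" for c and z z' :: "('g, 'n) eala_elem"
  proof -
    interpret loop: vector_space "pm_scale scale :: _ \<Rightarrow> ('g, 'n) loop \<Rightarrow> _"
      by (rule vector_space_pm_scale) (rule vector_space_axioms)
    show ?thesis
      by (simp add: eala_scale_def split_def plus_prod_def loop.scale_right_distrib der.scale_right_distrib
          fun_scale_def distrib_left plus_fun_def)
  qed
  show "((l + l', 0, 0) :: ('g, 'n) eala_elem) = (l, 0, 0) + (l', 0, 0)" for l l' :: "('g, 'n) loop" by simp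
  show "eala_scale scale c (single r x, 0, 0) = (single r (scale c x), 0, 0)" for c r x
    by (simp add: eala_scale_def fun_scale_zero pm_scale_zero pm_scale_single')
  show "((0, center_functional \<D> (u + w) r, 0) :: ('g, 'n) eala_elem) = (0, center_functional \<D> u r, 0) + (0, center_functional \<D> w r, 0)" for u w r
    by (simp add: center_functional_add)
  show "eala_scale scale c (0, center_functional \<D> u r, 0) = (0, center_functional \<D> (c *s u) r, 0)" for c u r
    by (simp add: eala_scale_def pm_scale_zero center_functional_scale)
  show "((0, 0, single 0 (u + w)) :: ('g, 'n) eala_elem) = (0, 0, single 0 u) + (0, 0, single 0 w)"
    for u w :: "complex ^ 'n"
    by (simp add: single_add)
  show "eala_scale scale c (0, 0, single 0 u) = (0, 0, single 0 (c *s u))" for c u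
    by (simp add: eala_scale_def pm_scale_zero fun_scale_zero pm_scale_single)
  show "E_bracket (single r x, 0, 0) (single s y, 0, 0) =
      (single (r + s) (bracket x y), 0, 0) +
      eala_scale scale (form x y) (0, center_functional \<D> (vec_of_int r) (r + s), 0)" for r s x y
    by (rule eala_bracket_loop)
  show "E_bracket (0, center_functional \<D> u r, 0) (l, 0, 0) = 0" for u r l by (rule eala_bracket_center_loop[OF dual])
  show "E_bracket (0, 0, single 0 (axis i 1)) (single r x, 0, 0) =
      eala_scale scale (of_int (r $ i)) (single r x, 0, 0)" for i r x
    unfolding d[symmetric] by (rule degree_loop)
  show "E_bracket (0, 0, single 0 (axis i 1)) (0, center_functional \<D> u r, 0) =
      eala_scale scale (of_int (r $ i)) (0, center_functional \<D> u r, 0)" for i r u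
    unfolding d[symmetric] by (rule degree_center[OF center_functional_component])
  show "\<exists>r. \<forall>i. E_bracket (0, 0, single 0 (axis i 1)) z = eala_scale scale (of_int (r $ i)) z"
    if "z \<in> gens" for z
    unfolding d[symmetric] using that by (cases rule: gens_cases) (use degree_center degree_der in blast)+
  show "E_bracket (single 0 x, 0, 0) z = 0" if "z \<in> gens" for x z
    using that by (cases rule: gens_cases) (simp_all only: eala_bracket_loop_center component_dual eala_bracket_loop_der)
  show "E_bracket (0, center_functional \<D> u 0, 0) z = 0" if "z \<in> gens" for u z
    using that
    by (cases rule: gens_cases) (simp_all only: eala_bracket_center component_dual dual eala_bracket_center_der)
  show "\<rho> z v \<in> W" if "V.subspace W" "\<And>l w. w \<in> W \<Longrightarrow> \<rho> (l, 0, 0) w \<in> W"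
    "\<And>z w. z \<in> gens \<Longrightarrow> w \<in> W \<Longrightarrow> \<rho> z w \<in> W" "z \<in> eala \<D>" "v \<in> W" for W z v
    by (rule gens_generate) (use that in blast)+
qed

text \<open>Composition with \<open>der_twist A\<close> turns a functional of degree
  \<open>k\<close> on the twisted derivations into one of degree \<open>matrix_inv A *v k\<close> on
  \<open>\<D>\<close>. By \<open>graded_dual_component_eq\<close> it is a
  \<open>center_functional\<close>, so the annihilation obtained from \<open>ghw\<close> applies to
  it.\<close>

lemma restricted_ghw:
  assumes rep.core.ghw
  shows "eala_restricted_ghw \<D> sV \<rho>"
proof -
  obtain A :: "int ^ 'n ^ 'n" and \<mu> v and N :: nat where A: "invertible A" and v: "v \<noteq> 0"
    "\<And>u. \<rho> (0, 0, single 0 u) v = sV (\<Sum>i\<in>UNIV. u $ i * \<mu> $ i) v"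
    and ann: "\<And>k x u. \<forall>i. int N \<le> k $ i \<Longrightarrow> \<rho> ((single (matrix_inv A *v k) x, 0, 0) +
      (0, center_functional \<D> u (matrix_inv A *v k), 0)) v = 0"
    by (rule rep.ghw_twist[OF assms]) (rule that; assumption)
  note inj = eala_twist_inj[OF A]
  note bij = der_twist_inverse(2)[OF A]
  \<comment> \<open>The weight of \<open>v\<close> for the twisted degree operators, as each
    \<open>d_i\<close> pulls back to the coefficient row
    \<open>axis i 1 v* complex_matrix A\<close>.\<close>
  define \<nu> where "\<nu> = (\<chi> i. \<Sum>j\<in>UNIV. (axis i 1 v* complex_matrix A) $ j * \<mu> $ j)"
  have inv_d: "inv (eala_twist A) (eala_d i) = (0, 0, single 0 (axis i 1 v* complex_matrix A))" for i
  proof (rule inv_f_eq[OF inj])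
    show "eala_twist A (0, 0, single 0 (axis i 1 v* complex_matrix A)) = eala_d i"
      by (simp add: eala_twist_def eala_d_def der_twist_single D_twist_inverse[OF A] loop_twist_def lin_ext_def
          zero_fun_def fun_eq_iff)
  qed
  have "v \<in> D_weight_space eala_d sV (\<lambda>y. \<rho> (inv (eala_twist A) y)) \<nu>"
    by (simp add: D_weight_space_def inv_d v(2) \<nu>_def)
  moreover have "\<rho> (inv (eala_twist A) y) v = 0"
    if k: "\<forall>i. int N \<le> k $ i" and y: "y \<in> eala_core_component (der_twist A ` \<D>) k" for k y
  proof -
    let ?k = "matrix_inv A *v k"
    obtain x f where yf: "y = (single k x, f, 0)" "f \<in> graded_dual_component (der_twist A ` \<D>) k"
      using y by (auto simp: eala_core_component_def)
    have flin: "linear_functional_on der_scale (der_twist A ` \<D>) f" and fout: "\<And>d. d \<notin> der_twist A ` \<D> \<Longrightarrow> f d = 0"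
      and fcomp: "\<And>s d. s \<noteq> - k \<Longrightarrow> d \<in> der_component (der_twist A ` \<D>) s \<Longrightarrow> f d = 0"
      using yf(2) by (auto simp: graded_dual_component_def graded_dual_def dual_space_def)
    have "f \<circ> der_twist A \<in> graded_dual_component \<D> ?k"
    proof (rule graded_dual_componentI)
      show "linear_functional_on der_scale \<D> (f \<circ> der_twist A)"
        using flin by (simp add: linear_functional_on_def der_twist_add der_twist_scale)
      show "(f \<circ> der_twist A) d = 0" if "d \<notin> \<D>" for d
        using fout[of "der_twist A d"] that bij_is_inj[OF bij] by (auto dest: injD)
      show "(f \<circ> der_twist A) d = 0" if s: "s \<noteq> - ?k" and d: "d \<in> der_component \<D> s" for s d
      proof -
        obtain w where w: "d = single s w" "d \<in> \<D>" using d by (auto simp: der_component_def)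
        have "A *v s \<noteq> - k"
        proof
          assume "A *v s = - k"
          then have "s = matrix_inv A *v (- k)" using matrix_inv_cancel(2)[OF A, of s] by simp
          also have "\<dots> = - ?k" using matrix_vector_mult_diff_distrib[of "matrix_inv A" 0 k] by simp
          finally show False using s by simp
        qed
        moreover have "der_twist A d \<in> der_component (der_twist A ` \<D>) (A *v s)"
          unfolding der_component_def using w(2) der_twist_single[of A s w] w(1) by blast
        ultimately show ?thesis using fcomp by simp
      qed
    qed
    then obtain u where u: "f \<circ> der_twist A = center_functional \<D> u ?k" by (rule graded_dual_component_eq)
    have "inv (eala_twist A) y = (single ?k x, f \<circ> der_twist A, 0)"
    proof (rule inv_f_eq[OF inj])
      have "f \<circ> der_twist A \<circ> inv (der_twist A) = f"
        using surj_f_inv_f[OF bij_is_surj[OF bij]] by (simp add: fun_eq_iff)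
      moreover have "der_twist A 0 = 0" by (simp add: der_twist_def lin_ext_def)
      ultimately show "eala_twist A (single ?k x, f \<circ> der_twist A, 0) = y"
        by (simp add: eala_twist_def yf(1) loop_twist_single matrix_inv_cancel(1)[OF A])
    qed
    then show ?thesis using ann[OF k, of x u] by (simp add: u)
  qed
  ultimately show ?thesis
    unfolding eala_restricted_ghw_def untwisted_ghw_def using A v(1) by blast
qed

lemma level_zero:
  assumes "\<not> rep.core.ghw"
  shows "level_zero (eala_K \<D>) \<rho>"
  using rep.core.level_zero[OF assms] by (simp add: level_zero_def eala_K_def center_functional_axis)

lemma integrable:
  assumes "\<not> rep.core.ghw"
  shows "integrable_module (eala_scale scale) (eala_H h \<D>)
    {(l, 0, 0) | l. l \<in> real_root_vectors scale bracket h} sV \<rho>"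
proof -
  have "eala_H h \<D> = {(single 0 x, 0, 0) + (0, center_functional \<D> a 0, 0) +
      (0, 0, single 0 u) | x a u. x \<in> h}"
    by (simp only: eala_H_def center_functional_eq add_Pair add_0_left add_0_right)
  moreover have "{(l, 0, 0) | l. l \<in> real_root_vectors scale bracket h} =
      (\<lambda>l. (l, 0, 0) :: ('g, 'n) eala_elem) ` real_root_vectors scale bracket h" by blast
  ultimately show ?thesis using rep.integrable[OF assms] by (simp only:)
qed

end

section \<open>Modules over toroidal Lie algebras\<close>

abbreviation center_single :: "int ^ 'n \<Rightarrow> complex ^ 'n \<Rightarrow> ('n::finite) center"
  where "center_single r a \<equiv> abs_center (single r a)"

lemma center_zero: "(0 :: ('n::finite) center) = abs_center 0"
  by (simp add: zero_center_def)

lemma center_single_add: "center_single r (a + b) = center_single r a + center_single r b"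
  by (simp add: plus_center.abs_eq single_add)

lemma center_single_scale: "center_scale c (center_single r a) = center_single r (c *s a)"
  by (simp add: center_scale.abs_eq pm_scale_single)

lemma center_scale_0: "center_scale c 0 = 0"
  by (simp add: center_zero center_scale.abs_eq pm_scale_zero)

text \<open>Lets additive identities on the quotient be checked on classes of monomials.\<close>

lemma center_induct [case_names single add]:
  assumes "\<And>r a. Q (center_single r a)" "\<And>y z. Q y \<Longrightarrow> Q z \<Longrightarrow> Q (y + z)"
  shows "Q z"
proof (induction z rule: center.abs_induct)
  case (1 p)
  show ?case
  proof (induction p rule: pm_induct)
    case (single r a)
    show ?case by (rule assms(1))
  next
    case (add p q)
    then have "Q (abs_center p + abs_center q)" by (rule assms(2))
    then show ?case by (simp only: plus_center.abs_eq)
  qed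
qed

lemma center_d_act_single: "center_d_act u (center_single r a) = center_single r (pairing u r *s a)"
  by (simp add: center_d_act.abs_eq)

lemma center_d_act_0: "center_d_act 0 z = 0" "center_d_act u 0 = 0"
proof -
  show "center_d_act 0 z = 0"
    by (induction z rule: center.abs_induct) (simp add: center_d_act.abs_eq center_zero lin_ext_def)
  show "center_d_act u 0 = 0" by (simp add: center_d_act.abs_eq center_zero lin_ext_def)
qed

lemma tor_cocycle_0: "tor_cocycle B 0 l = 0" "tor_cocycle B l 0 = 0"
  by (simp_all add: tor_cocycle_def graded_prod_0 center_zero)

lemma center_twist_single: "center_twist A (center_single m a) = center_single (A *v m) (complex_matrix A *v a)"
  by (simp add: center_twist.abs_eq)

lemma center_twist_add: "center_twist A (y + z) = center_twist A y + center_twist A z"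
proof (induction y rule: center.abs_induct)
  case (1 p)
  show ?case
  proof (induction z rule: center.abs_induct)
    case (1 q)
    have "lin_ext (\<lambda>m a. single (A *v m) (complex_matrix A *v a)) (p + q) =
      lin_ext (\<lambda>m a. single (A *v m) (complex_matrix A *v a)) p +
      lin_ext (\<lambda>m a. single (A *v m) (complex_matrix A *v a)) q"
      by (rule lin_ext_add) (simp_all add: single_add matrix_vector_right_distrib)
    then show ?case by (simp add: plus_center.abs_eq center_twist.abs_eq)
  qed
qed

lemma complex_matrix_inv:
  assumes "invertible (A :: int ^ 'n ^ 'n)"
  shows "complex_matrix A *v (complex_matrix (matrix_inv A) *v a) = a"
    "complex_matrix (matrix_inv A) *v (complex_matrix A *v a) = a"
proof -
  have "complex_matrix (mat 1 :: int ^ 'n ^ 'n) = mat 1"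
    by (simp add: complex_matrix_def mat_def vec_eq_iff)
  then show "complex_matrix A *v (complex_matrix (matrix_inv A) *v a) = a"
    "complex_matrix (matrix_inv A) *v (complex_matrix A *v a) = a"
    by (simp_all add: matrix_vector_mul_assoc complex_matrix_mult matrix_inv_int[OF assms])
qed

lemma center_twist_inverse:
  assumes "invertible (A :: int ^ 'n ^ 'n)"
  shows "center_twist (matrix_inv A) (center_twist A z) = z"
  by (induction z rule: center_induct)
    (simp_all add: center_twist_single center_twist_add matrix_inv_cancel[OF assms] complex_matrix_inv[OF assms])

lemma tor_twist_inj:
  assumes "invertible (A :: int ^ 'n ^ 'n)"
  shows "inj (tor_twist A :: ('g::ab_group_add, 'n) tor_elem \<Rightarrow> _)"
proof (rule injI)
  fix x y :: "('g, 'n) tor_elem"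
  assume eq: "tor_twist A x = tor_twist A y"
  obtain l z u l' z' u' where xy: "x = (l, z, u)" "y = (l', z', u')" by (metis prod_cases3)
  have "l = l'" using eq loop_twist_inj[OF assms] by (auto simp: xy tor_twist_def dest: injD)
  moreover have "z = z'" using eq center_twist_inverse[OF assms] by (auto simp: xy tor_twist_def) metis
  moreover have "u = u'"
  proof -
    have "D_twist A u v* complex_matrix A = D_twist A u' v* complex_matrix A"
      using eq by (simp add: xy tor_twist_def)
    then show ?thesis by (simp only: D_twist_inverse(2)[OF assms])
  qed
  ultimately show "x = y" by (simp add: xy)
qed

locale toroidal_module = normalized_simple_lie_algebra scale bracket h form \<Delta> \<theta>
  + lie_rep "tor_scale scale" UNIV "tor_bracket scale bracket form" sV \<rho>
  for scale :: "complex \<Rightarrow> 'g::ab_group_add \<Rightarrow> 'g" and bracket :: "'g \<Rightarrow> 'g \<Rightarrow> 'g"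
    and h :: "'g set" and form :: "'g \<Rightarrow> 'g \<Rightarrow> complex"
    and \<Delta> :: "('g \<Rightarrow> complex) set" and \<theta> :: "'g \<Rightarrow> complex"
    and sV :: "complex \<Rightarrow> 'v::ab_group_add \<Rightarrow> 'v" and \<rho> :: "('g, 'n::finite) tor_elem \<Rightarrow> 'v \<Rightarrow> 'v" +
  assumes card: "CARD('n) \<ge> 2"
    and irreducible: "irreducible_module (tor_scale scale) UNIV (tor_bracket scale bracket form) sV \<rho>"
    and quasi_finite: "quasi_finite tor_d sV \<rho>"
begin

abbreviation "T_bracket \<equiv> tor_bracket scale bracket form"

lemma tor_bracket_loop:
  "T_bracket (single r x, 0, 0) (single s y, 0, 0) =
    (single (r + s) (bracket x y), 0, 0) +
    tor_scale scale (form x y) (0, center_single (r + s) (vec_of_int r), 0)"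
proof -
  have "graded_prod (\<lambda>r s x y. form x y *s vec_of_int r) (single r x) (single s y) =
      single (r + s) (form x y *s vec_of_int r)"
    by (rule graded_prod_single) simp_all
  then show ?thesis
    by (simp add: tor_bracket_def tor_scale_def loop_bracket_single der_act_0 tor_cocycle_def center_d_act_0
        center_single_scale pm_scale_zero)
qed

lemma tor_bracket_center_loop: "T_bracket (0, z, 0) (l, 0, 0) = 0"
  and tor_bracket_loop_center: "T_bracket (l, 0, 0) (0, z, 0) = 0"
  and tor_bracket_center: "T_bracket (0, z, 0) (0, z', 0) = 0"
  by (simp_all add: tor_bracket_def loop_bracket_0 der_act_0 tor_cocycle_0 center_d_act_0 zero_prod_def)

lemma tor_bracket_loop_der: "T_bracket (single 0 y, 0, 0) (0, 0, u) = 0"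
  by (simp add: tor_bracket_def loop_bracket_0 der_act_0 der_act_single tor_cocycle_0 center_d_act_0 zero_prod_def)

lemma tor_bracket_center_der: "T_bracket (0, center_single 0 a, 0) (0, 0, u) = 0"
  by (simp add: tor_bracket_def loop_bracket_0 der_act_0 tor_cocycle_0 center_d_act_0 center_d_act_single
      center_zero[symmetric] zero_prod_def)

lemma degree_loop: "T_bracket (tor_d i) (single r x, 0, 0) =
    tor_scale scale (of_int (r $ i)) (single r x, 0, 0)"
  by (simp add: tor_bracket_def tor_d_def tor_scale_def loop_bracket_0 der_act_0 der_act_single tor_cocycle_0
      center_d_act_0 center_scale_0 pairing_axis pm_scale_single')

lemma degree_center: "T_bracket (tor_d i) (0, center_single r a, 0) =
    tor_scale scale (of_int (r $ i)) (0, center_single r a, 0)"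
  by (simp add: tor_bracket_def tor_d_def tor_scale_def loop_bracket_0 der_act_0 tor_cocycle_0
      center_d_act_0 center_d_act_single center_single_scale pairing_axis pm_scale_zero)

text \<open>The factor is written as a coordinate of the zero vector, the shape in which the degree
  of a generator is expected.\<close>

lemma degree_der: "T_bracket (tor_d i) (0, 0, u) = tor_scale scale (of_int ((0 :: int ^ 'n) $ i)) (0, 0, u)"
proof -
  have "center_scale 0 (0 :: 'n center) = 0" by (rule center_scale_0)
  then show ?thesis
    by (simp add: tor_bracket_def tor_d_def tor_scale_def loop_bracket_0 der_act_0 tor_cocycle_0 center_d_act_0
        pm_scale_zero)
qed

definition gens :: "('g, 'n) tor_elem set"
  where "gens = {(0, center_single r a, 0) | r a. True} \<union> {(0, 0, u) | u. True}"

lemma gensI: "(0, center_single r a, 0) \<in> gens" "(0, 0, u) \<in> gens"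
  unfolding gens_def by blast+

lemma gens_cases:
  assumes "y \<in> gens"
  obtains (center) r a where "y = (0, center_single r a, 0)" | (der) u where "y = (0, 0, u)"
  using assms by (auto simp: gens_def)

lemma gens_generate:
  assumes W: "V.subspace W" "\<And>y w. y \<in> gens \<Longrightarrow> w \<in> W \<Longrightarrow> \<rho> y w \<in> W"
    and loop: "\<And>l w. w \<in> W \<Longrightarrow> \<rho> (l, 0, 0) w \<in> W" and w: "w \<in> W"
  shows "\<rho> y w \<in> W"
proof -
  have center: "\<rho> (0, z, 0) w \<in> W" for z
  proof (induction z rule: center_induct)
    case (single r a)
    show ?case by (rule W(2)[OF gensI(1) w])
  next
    case (add y z)
    have "\<rho> (0, y + z, 0) w = \<rho> (0, y, 0) w + \<rho> (0, z, 0) w"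
      using rho_add[of "(0, y, 0)" "(0, z, 0)" w] by simp
    then show ?case using V.subspace_add[OF W(1) add] by (simp only:)
  qed
  obtain l z u where y: "y = (l, z, u)" by (metis prod_cases3)
  have "\<rho> ((l, 0, 0) + ((0, z, 0) + (0, 0, u))) w = \<rho> (l, 0, 0) w + (\<rho> (0, z, 0) w + \<rho> (0, 0, u) w)"
    by (simp only: rho_add UNIV_I)
  moreover have "\<rho> (0, 0, u) w \<in> W" by (rule W(2)[OF gensI(2) w])
  ultimately show ?thesis
    using loop[OF w] center V.subspace_add[OF W(1)] by (simp add: y)
qed

sublocale rep: graded_rep scale bracket h form \<Delta> \<theta> "tor_scale scale" UNIV T_bracket sV \<rho>
  "\<lambda>l. (l, 0, 0)" "\<lambda>u r. (0, center_single r u, 0)" "\<lambda>u. (0, 0, u)" gens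
proof
  have d: "tor_d i = (0, 0, axis i 1)" for i by (rule tor_d_def)
  show "CARD('n) \<ge> 2" by (rule card)
  show "irreducible_module (tor_scale scale) UNIV T_bracket sV \<rho>" by (rule irreducible)
  show "quasi_finite (\<lambda>i. (0, 0, axis i 1)) sV \<rho>" using quasi_finite unfolding d[abs_def] .
  show "tor_scale scale c (z + z') = tor_scale scale c z + tor_scale scale c z'" for c and z z' :: "('g, 'n) tor_elem"
  proof -
    interpret loop: vector_space "pm_scale scale :: _ \<Rightarrow> ('g, 'n) loop \<Rightarrow> _"
      by (rule vector_space_pm_scale) (rule vector_space_axioms)
    have "center_scale c (y + z) = center_scale c y + center_scale c z" for y z :: "'n center"
      by (transfer, simp add: der.scale_right_distrib central_equiv_def central_relations_def der.span_zero)
    then show ?thesis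
      by (simp add: tor_scale_def split_def plus_prod_def loop.scale_right_distrib vec.scale_right_distrib)
  qed
  show "((l + l', 0, 0) :: ('g, 'n) tor_elem) = (l, 0, 0) + (l', 0, 0)" for l l' :: "('g, 'n) loop" by simp
  show "tor_scale scale c (single r x, 0, 0) = (single r (scale c x), 0, 0)" for c r x
    by (simp add: tor_scale_def center_scale_0 pm_scale_single')
  show "((0, center_single r (u + w), 0) :: ('g, 'n) tor_elem) = (0, center_single r u, 0) + (0, center_single r w, 0)" for u w r
    by (simp add: center_single_add)
  show "tor_scale scale c (0, center_single r u, 0) = (0, center_single r (c *s u), 0)" for c u r
    by (simp add: tor_scale_def center_single_scale pm_scale_zero)
  show "((0, 0, u + w) :: ('g, 'n) tor_elem) = (0, 0, u) + (0, 0, w)" for u w by simp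
  show "tor_scale scale c (0, 0, u) = (0, 0, c *s u)" for c u
    by (simp add: tor_scale_def pm_scale_zero center_scale_0)
  show "T_bracket (single r x, 0, 0) (single s y, 0, 0) =
      (single (r + s) (bracket x y), 0, 0) +
      tor_scale scale (form x y) (0, center_single (r + s) (vec_of_int r), 0)" for r s x y
    by (rule tor_bracket_loop)
  show "T_bracket (0, center_single r u, 0) (l, 0, 0) = 0" for u r l by (rule tor_bracket_center_loop)
  show "T_bracket (0, 0, axis i 1) (single r x, 0, 0) =
      tor_scale scale (of_int (r $ i)) (single r x, 0, 0)" for i r x
    unfolding d[symmetric] by (rule degree_loop)
  show "T_bracket (0, 0, axis i 1) (0, center_single r u, 0) =
      tor_scale scale (of_int (r $ i)) (0, center_single r u, 0)" for i r u
    unfolding d[symmetric] by (rule degree_center)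
  show "\<exists>r. \<forall>i. T_bracket (0, 0, axis i 1) z = tor_scale scale (of_int (r $ i)) z" if "z \<in> gens" for z
    unfolding d[symmetric] using that by (cases rule: gens_cases) (use degree_center degree_der in blast)+
  show "T_bracket (single 0 x, 0, 0) z = 0" if "z \<in> gens" for x z
    using that by (cases rule: gens_cases) (simp_all only: tor_bracket_loop_center tor_bracket_loop_der)
  show "T_bracket (0, center_single 0 u, 0) z = 0" if "z \<in> gens" for u z
    using that by (cases rule: gens_cases) (simp_all only: tor_bracket_center tor_bracket_center_der)
  show "\<rho> z v \<in> W" if "V.subspace W" "\<And>l w. w \<in> W \<Longrightarrow> \<rho> (l, 0, 0) w \<in> W"
    "\<And>z w. z \<in> gens \<Longrightarrow> w \<in> W \<Longrightarrow> \<rho> z w \<in> W" "v \<in> W" for W z v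
    by (rule gens_generate) (use that in blast)+
qed simp_all

lemma restricted_ghw:
  assumes rep.core.ghw
  shows "tor_restricted_ghw sV \<rho>"
proof -
  obtain A :: "int ^ 'n ^ 'n" and \<mu> v and N :: nat where A: "invertible A" and v: "v \<noteq> 0"
    "\<And>u. \<rho> (0, 0, u) v = sV (\<Sum>i\<in>UNIV. u $ i * \<mu> $ i) v"
    and ann: "\<And>k x u. \<forall>i. int N \<le> k $ i \<Longrightarrow> \<rho> ((single (matrix_inv A *v k) x, 0, 0) +
      (0, center_single (matrix_inv A *v k) u, 0)) v = 0"
    by (rule rep.ghw_twist[OF assms]) (rule that; assumption)
  note inj = tor_twist_inj[OF A]
  define \<nu> where "\<nu> = (\<chi> i. \<Sum>j\<in>UNIV. (axis i 1 v* complex_matrix A) $ j * \<mu> $ j)"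
  have loop0: "loop_twist A 0 = 0" by (simp add: loop_twist_def lin_ext_def)
  have center0: "center_twist A 0 = 0" by (simp add: center_zero center_twist.abs_eq lin_ext_def)
  have inv_d: "inv (tor_twist A) (tor_d i) = (0, 0, axis i 1 v* complex_matrix A)" for i
    by (rule inv_f_eq[OF inj]) (simp add: tor_twist_def tor_d_def D_twist_inverse[OF A] loop0 center0)
  have "v \<in> D_weight_space tor_d sV (\<lambda>y. \<rho> (inv (tor_twist A) y)) \<nu>"
    by (simp add: D_weight_space_def inv_d v(2) \<nu>_def)
  moreover have "\<rho> (inv (tor_twist A) y) v = 0"
    if k: "\<forall>i. int N \<le> k $ i" and y: "y \<in> tor_core_component k" for k y
  proof -
    obtain x a where ya: "y = (single k x, center_single k a, 0)"
      using y by (auto simp: tor_core_component_def)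
    \<comment> \<open>The twist applies \<open>complex_matrix A\<close> to central coefficients, so
      the preimage carries the inverse matrix.\<close>
    let ?a = "complex_matrix (matrix_inv A) *v a"
    have "inv (tor_twist A) y = (single (matrix_inv A *v k) x, center_single (matrix_inv A *v k) ?a, 0)"
      by (rule inv_f_eq[OF inj])
        (simp add: tor_twist_def ya loop_twist_single center_twist_single D_twist_0 matrix_inv_cancel(1)[OF A]
          complex_matrix_inv(1)[OF A])
    then show ?thesis using ann[OF k, of x ?a] by simp
  qed
  ultimately show ?thesis
    unfolding tor_restricted_ghw_def untwisted_ghw_def using A v(1) by blast
qed

lemma level_zero:
  assumes "\<not> rep.core.ghw"
  shows "level_zero tor_K \<rho>"
  using rep.core.level_zero[OF assms] by (simp add: level_zero_def tor_K_def)

lemma integrable: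
  assumes "\<not> rep.core.ghw"
  shows "integrable_module (tor_scale scale) (tor_H h)
    {(l, 0, 0) | l. l \<in> real_root_vectors scale bracket h} sV \<rho>"
proof -
  have "(tor_H h :: ('g, 'n) tor_elem set) = {(single 0 x, 0, 0) + (0, center_single 0 a, 0) + (0, 0, u) | x a u. x \<in> h}"
    by (simp only: tor_H_def add_Pair add_0_left add_0_right)
  moreover have "{(l, 0, 0) | l. l \<in> real_root_vectors scale bracket h} =
      (\<lambda>l. (l, 0, 0) :: ('g, 'n) tor_elem) ` real_root_vectors scale bracket h" by blast
  ultimately show ?thesis using rep.integrable[OF assms] by (simp only:)
qed

end

theorem proposition9p9:
  fixes n :: nat
    and scale :: "complex \<Rightarrow> 'g::ab_group_add \<Rightarrow> 'g"
    and br :: "'g \<Rightarrow> 'g \<Rightarrow> 'g"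
    and h :: "'g set"
    and form :: "'g \<Rightarrow> 'g \<Rightarrow> complex"
    and \<Delta> :: "('g \<Rightarrow> complex) set"
    and \<theta> :: "'g \<Rightarrow> complex"
    and sV :: "complex \<Rightarrow> 'v::ab_group_add \<Rightarrow> 'v"
  assumes "n \<ge> 1"
    and "CARD('n::finite) = n + 1"
    and "normalized_simple_lie_algebra scale br h form \<Delta> \<theta>"
  shows
    "(\<forall>(\<D> :: 'n der set) \<phi> (\<rho> :: ('g, 'n) eala_elem \<Rightarrow> 'v \<Rightarrow> 'v).
        fgc_data \<D> \<phi> \<and>
        irreducible_module (eala_scale scale) (eala \<D>) (eala_bracket scale br form \<D> \<phi>) sV \<rho> \<and>
        quasi_finite eala_d sV \<rho> \<and>
        (\<exists>x\<in>eala_core \<D>. \<exists>v. \<rho> x v \<noteq> 0)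
        \<longrightarrow>
        (level_zero (eala_K \<D>) \<rho> \<and>
          integrable_module (eala_scale scale) (eala_H h \<D>)
            {(l, 0, 0) | l. l \<in> real_root_vectors scale br h} sV \<rho>) \<or>
        eala_restricted_ghw \<D> sV \<rho>) \<and>
     (\<forall>\<rho> :: ('g, 'n) tor_elem \<Rightarrow> 'v \<Rightarrow> 'v.
        irreducible_module (tor_scale scale) UNIV (tor_bracket scale br form) sV \<rho> \<and>
        quasi_finite tor_d sV \<rho> \<and>
        (\<exists>x\<in>tor_core. \<exists>v. \<rho> x v \<noteq> 0)
        \<longrightarrow>
        (level_zero tor_K \<rho> \<and>
          integrable_module (tor_scale scale) (tor_H h)
            {(l, 0, 0) | l. l \<in> real_root_vectors scale br h} sV \<rho>) \<or>
        tor_restricted_ghw sV \<rho>)"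
proof (intro conjI allI impI)
  interpret normalized_simple_lie_algebra scale br h form \<Delta> \<theta> by (rule assms(3))
  have card: "CARD('n) \<ge> 2" using assms(1,2) by simp
  {
    fix \<D> :: "'n der set" and \<phi> and \<rho> :: "('g, 'n) eala_elem \<Rightarrow> 'v \<Rightarrow> 'v"
    assume *: "fgc_data \<D> \<phi> \<and>
        irreducible_module (eala_scale scale) (eala \<D>) (eala_bracket scale br form \<D> \<phi>) sV \<rho> \<and>
        quasi_finite eala_d sV \<rho> \<and> (\<exists>x\<in>eala_core \<D>. \<exists>v. \<rho> x v \<noteq> 0)"
    interpret eala_module scale br h form \<Delta> \<theta> \<D> \<phi> sV \<rho>
      using * card by unfold_locales (simp_all add: fgc_data_def irreducible_module_def)
    show "(level_zero (eala_K \<D>) \<rho> \<and> integrable_module (eala_scale scale) (eala_H h \<D>)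
        {(l, 0, 0) | l. l \<in> real_root_vectors scale br h} sV \<rho>) \<or> eala_restricted_ghw \<D> sV \<rho>"
      using restricted_ghw level_zero integrable by blast
  next
    fix \<rho> :: "('g, 'n) tor_elem \<Rightarrow> 'v \<Rightarrow> 'v"
    assume *: "irreducible_module (tor_scale scale) UNIV (tor_bracket scale br form) sV \<rho> \<and>
        quasi_finite tor_d sV \<rho> \<and> (\<exists>x\<in>tor_core. \<exists>v. \<rho> x v \<noteq> 0)"
    interpret toroidal_module scale br h form \<Delta> \<theta> sV \<rho>
      using * card by unfold_locales (simp_all add: irreducible_module_def)
    show "(level_zero tor_K \<rho> \<and> integrable_module (tor_scale scale) (tor_H h)
        {(l, 0, 0) | l. l \<in> real_root_vectors scale br h} sV \<rho>) \<or> tor_restricted_ghw sV \<rho>"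
      using restricted_ghw level_zero integrable by blast
  }
qed

end
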